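(* Let $\Omega\subseteq\mathbb{R}^d$ be a bounded domain with Lipschitz continuous boundary, let $\sigma,\tau>d/2$, and let $W=\mathbb{R}^{n\times n}$ or $W=\mathbb{S}^{n\times n}$. Let $F:H^{\sigma}(\Omega;W)\to H^{\tau}(\Omega;W)$ be linear and bounded. Let $X=\{x_1,\ldots,x_N\}\subseteq\Omega$ be given and define, for $1\le k\le N$ and for $1\le i,j\le n$ if $W=\mathbb{R}^{n\times n}$ (respectively $1\le i\le j\le n$ if $W=\mathbb{S}^{n\times n}$), \[ \lambda_k^{(i,j)}(M):=e_i^T F(M)(x_k)e_j,\qquad M\in H^\sigma(\Omega;W). \] Then each $\lambda_k^{(i,j)}$ belongs to the dual of $H^\sigma(\Omega;W)$. Assume further that these functionals are linearly independent. If $S$ denotes the optimal recovery of $M\in H^\sigma(\Omega;W)$ based on these functionals and a reproducing kernel of $H^\sigma(\Omega;W)$, then \[ \|F(M)-F(S)\|_{L_\infty(\Omega;\mathbb{R}^{n\times n})}\le C\,h_{X,\Omega}^{\tau-d/2}\,\|M\|_{H^\sigma(\Omega;\mathbb{R}^{n\times n})}, \] where $C>0$ is a constant independent of $X$ and $M$.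
   Context: $\mathbb{S}^{n\times n}$ is the space of symmetric real $n\times n$ matrices and $e_i$ is the $i$-th standard unit vector of $\mathbb{R}^n$. $H^\sigma(\Omega)$ is the $L_2$-based Sobolev space of (possibly non-integer) order $\sigma$; for $\sigma>d/2$ its elements are identified with their continuous representatives. $H^\sigma(\Omega;W)$ is the space of $W$-valued functions with every component in $H^\sigma(\Omega)$, with inner product $\langle M,S\rangle=\sum_{i,j=1}^n\langle M_{ij},S_{ij}\rangle_{H^\sigma(\Omega)}$; any equivalent inner product on $H^\sigma(\Omega)$ may be used, and the choice of inner product determines the reproducing kernel. Optimal recovery: given linearly independent bounded linear functionals $\lambda_1,\dots,\lambda_L$ on a Hilbert space $H$ and $f\in H$, the optimal recovery of $f$ is the (unique) element $s^*\in H$ which minimises $\|s\|_H$ among all $s\in H$ with $\lambda_j(s)=\lambda_j(f)$, $1\le j\le L$. Here $H=H^\sigma(\Omega;W)$ with the norm belonging to the chosen reproducing kernel. The fill distance is $h_{X,\Omega}:=\sup_{x\in\Omega}\min_{x_i\in X}\|x-x_i\|_2$, and $\|A\|_{L_\infty(\Omega;\mathbb{R}^{n\times n})}:=\max_{i,j=1,\dots,n}\|a_{ij}\|_{L_\infty(\Omega)}$ for $A=(a_{ij})$. *)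

theory Defs
  imports "HOL-Analysis.Analysis" "HOL-Probability.Essential_Supremum"
begin

section \<open>Bounded Lipschitz domains\<close>

text \<open>Near every boundary point, \<open>\<Omega>\<close> is, after a rotation, the strict epigraph of a Lipschitz
  function. The rotated last coordinate of \<open>x\<close> is \<open>x \<bullet> e\<close> for a unit vector \<open>e\<close>, and the remaining
  coordinates are those of the orthogonal projection of \<open>x\<close> to the hyperplane \<open>e\<^sup>\<bottom>\<close>.\<close>

definition bounded_lipschitz_domain :: "(real^'d) set \<Rightarrow> bool" where
  "bounded_lipschitz_domain \<Omega> \<longleftrightarrow>
     open \<Omega> \<and> connected \<Omega> \<and> \<Omega> \<noteq> {} \<and> bounded \<Omega> \<and>
     (\<forall>p\<in>frontier \<Omega>. \<exists>r>0. \<exists>e \<gamma> L. norm e = 1 \<and> L-lipschitz_on {y. y \<bullet> e = 0} \<gamma> \<and>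
        \<Omega> \<inter> ball p r = {x \<in> ball p r. \<gamma> (x - (x \<bullet> e) *\<^sub>R e) < x \<bullet> e})"

section \<open>Weak derivatives and Sobolev spaces\<close>

text \<open>Square integrable functions, with Borel representatives (every class of Lebesgue measurable
  functions modulo null sets has one).\<close>

abbreviation vol_on :: "(real^'d) set \<Rightarrow> (real^'d) measure" where
  "vol_on \<Omega> \<equiv> restrict_space lborel \<Omega>"

definition L2_on :: "(real^'d) set \<Rightarrow> (real^'d \<Rightarrow> real) set" where
  "L2_on \<Omega> = {u. u \<in> borel_measurable (vol_on \<Omega>) \<and> integrable (vol_on \<Omega>) (\<lambda>x. (u x)\<^sup>2)}"

text \<open>Derivatives of order \<open>m\<close> are indexed by lists of coordinates of length \<open>m\<close>:
  \<open>[i\<^sub>1, \<dots>, i\<^sub>m]\<close> stands for \<open>\<partial>\<^sub>i\<^sub>1 \<dots> \<partial>\<^sub>i\<^sub>m\<close>.\<close>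

definition partial_deriv :: "'d::finite \<Rightarrow> (real^'d \<Rightarrow> real) \<Rightarrow> real^'d \<Rightarrow> real" where
  "partial_deriv i f x = frechet_derivative f (at x) (axis i 1)"

definition iter_partial :: "'d::finite list \<Rightarrow> (real^'d \<Rightarrow> real) \<Rightarrow> real^'d \<Rightarrow> real" where
  "iter_partial is f = foldr partial_deriv is f"

definition test_functions :: "(real^'d) set \<Rightarrow> (real^'d \<Rightarrow> real) set" where
  "test_functions \<Omega> =
     {\<phi>. (\<forall>is x. iter_partial is \<phi> differentiable (at x)) \<and>
         compact (closure {x. \<phi> x \<noteq> 0}) \<and> closure {x. \<phi> x \<noteq> 0} \<subseteq> \<Omega>}"

definition has_weak_deriv ::
    "(real^'d) set \<Rightarrow> 'd list \<Rightarrow> (real^'d \<Rightarrow> real) \<Rightarrow> (real^'d \<Rightarrow> real) \<Rightarrow> bool" where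
  "has_weak_deriv \<Omega> is u v \<longleftrightarrow>
     (\<forall>\<phi>\<in>test_functions \<Omega>.
        integral\<^sup>L (vol_on \<Omega>) (\<lambda>x. u x * iter_partial is \<phi> x) =
        (-1) ^ length is * integral\<^sup>L (vol_on \<Omega>) (\<lambda>x. v x * \<phi> x))"

text \<open>The choice is immaterial: weak derivatives are unique up to a null set of \<open>\<Omega>\<close>.\<close>

definition weak_deriv :: "(real^'d) set \<Rightarrow> 'd list \<Rightarrow> (real^'d \<Rightarrow> real) \<Rightarrow> real^'d \<Rightarrow> real" where
  "weak_deriv \<Omega> is u = (SOME v. v \<in> L2_on \<Omega> \<and> has_weak_deriv \<Omega> is u v)"

text \<open>The order is split as \<open>\<sigma> = sob_int \<sigma> + sob_frac \<sigma>\<close>; the Slobodeckij (double integral) term on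
  the derivatives of top order is present only for non-integer \<open>\<sigma>\<close>.\<close>

definition sob_int :: "real \<Rightarrow> nat" where
  "sob_int \<sigma> = nat \<lfloor>\<sigma>\<rfloor>"

definition sob_frac :: "real \<Rightarrow> real" where
  "sob_frac \<sigma> = \<sigma> - real (sob_int \<sigma>)"

definition slobodeckij_integrand ::
    "real \<Rightarrow> (real^'d \<Rightarrow> real) \<Rightarrow> (real^'d \<Rightarrow> real) \<Rightarrow> (real^'d) \<times> (real^'d) \<Rightarrow> real" where
  "slobodeckij_integrand s v w =
     (\<lambda>(x, y). (v x - v y) * (w x - w y) / dist x y powr (real CARD('d) + 2 * s))"

definition sobolev_classes :: "real \<Rightarrow> (real^'d) set \<Rightarrow> (real^'d \<Rightarrow> real) set" where
  "sobolev_classes \<sigma> \<Omega> =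
     {u. u \<in> L2_on \<Omega> \<and>
         (\<forall>is. length is \<le> sob_int \<sigma> \<longrightarrow> (\<exists>v\<in>L2_on \<Omega>. has_weak_deriv \<Omega> is u v)) \<and>
         (sob_frac \<sigma> > 0 \<longrightarrow>
           (\<forall>is. length is = sob_int \<sigma> \<longrightarrow>
              integrable (vol_on \<Omega> \<Otimes>\<^sub>M vol_on \<Omega>)
                (slobodeckij_integrand (sob_frac \<sigma>) (weak_deriv \<Omega> is u) (weak_deriv \<Omega> is u))))}"

text \<open>For \<open>\<sigma> > d/2\<close> the elements of \<open>H\<^sup>\<sigma>(\<Omega>)\<close> are identified with their continuous representatives.
  Functions are total, so they are set to zero outside \<open>\<Omega>\<close> to make the representative unique.\<close>

definition sobolev :: "real \<Rightarrow> (real^'d) set \<Rightarrow> (real^'d \<Rightarrow> real) set" where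
  "sobolev \<sigma> \<Omega> = {u \<in> sobolev_classes \<sigma> \<Omega>. continuous_on \<Omega> u \<and> (\<forall>x. x \<notin> \<Omega> \<longrightarrow> u x = 0)}"

text \<open>Summing over lists counts the multi-index \<open>\<alpha>\<close> with the multiplicity \<open>|\<alpha>|!/\<alpha>!\<close>, which gives an
  inner product equivalent to the one without multiplicities.\<close>

definition sobolev_inner ::
    "real \<Rightarrow> (real^'d) set \<Rightarrow> (real^'d \<Rightarrow> real) \<Rightarrow> (real^'d \<Rightarrow> real) \<Rightarrow> real" where
  "sobolev_inner \<sigma> \<Omega> u v =
     (\<Sum>is | length is \<le> sob_int \<sigma>.
        integral\<^sup>L (vol_on \<Omega>) (\<lambda>x. weak_deriv \<Omega> is u x * weak_deriv \<Omega> is v x)) +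
     (if sob_frac \<sigma> > 0 then
        (\<Sum>is | length is = sob_int \<sigma>.
           integral\<^sup>L (vol_on \<Omega> \<Otimes>\<^sub>M vol_on \<Omega>)
             (slobodeckij_integrand (sob_frac \<sigma>) (weak_deriv \<Omega> is u) (weak_deriv \<Omega> is v)))
      else 0)"

section \<open>Inner products, functionals and operators on spaces of functions\<close>

definition inner_product_on ::
    "('x \<Rightarrow> 'b::real_vector) set \<Rightarrow> (('x \<Rightarrow> 'b) \<Rightarrow> ('x \<Rightarrow> 'b) \<Rightarrow> real) \<Rightarrow> bool" where
  "inner_product_on V ip \<longleftrightarrow>
     (\<forall>u\<in>V. \<forall>v\<in>V. ip u v = ip v u) \<and>
     (\<forall>u\<in>V. \<forall>v\<in>V. \<forall>w\<in>V. ip (\<lambda>x. u x + v x) w = ip u w + ip v w) \<and>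
     (\<forall>c. \<forall>u\<in>V. \<forall>v\<in>V. ip (\<lambda>x. c *\<^sub>R u x) v = c * ip u v) \<and>
     (\<forall>u\<in>V. 0 \<le> ip u u) \<and>
     (\<forall>u\<in>V. ip u u = 0 \<longrightarrow> u = (\<lambda>x. 0))"

definition ip_norm :: "('f \<Rightarrow> 'f \<Rightarrow> real) \<Rightarrow> 'f \<Rightarrow> real" where
  "ip_norm ip u = sqrt (ip u u)"

definition equivalent_norms_on :: "'f set \<Rightarrow> ('f \<Rightarrow> real) \<Rightarrow> ('f \<Rightarrow> real) \<Rightarrow> bool" where
  "equivalent_norms_on V p q \<longleftrightarrow> (\<exists>a>0. \<exists>b>0. \<forall>u\<in>V. a * p u \<le> q u \<and> q u \<le> b * p u)"

definition in_dual ::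
    "('x \<Rightarrow> 'b::real_vector) set \<Rightarrow> (('x \<Rightarrow> 'b) \<Rightarrow> real) \<Rightarrow> (('x \<Rightarrow> 'b) \<Rightarrow> real) \<Rightarrow> bool" where
  "in_dual V nrm f \<longleftrightarrow>
     (\<forall>u\<in>V. \<forall>v\<in>V. f (\<lambda>x. u x + v x) = f u + f v) \<and>
     (\<forall>c. \<forall>u\<in>V. f (\<lambda>x. c *\<^sub>R u x) = c * f u) \<and>
     (\<exists>B. \<forall>u\<in>V. \<bar>f u\<bar> \<le> B * nrm u)"

definition bounded_linear_operator ::
    "('x \<Rightarrow> 'b::real_vector) set \<Rightarrow> (('x \<Rightarrow> 'b) \<Rightarrow> real) \<Rightarrow>
     ('y \<Rightarrow> 'c::real_vector) set \<Rightarrow> (('y \<Rightarrow> 'c) \<Rightarrow> real) \<Rightarrow>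
     (('x \<Rightarrow> 'b) \<Rightarrow> ('y \<Rightarrow> 'c)) \<Rightarrow> bool" where
  "bounded_linear_operator V nV U nU F \<longleftrightarrow>
     (\<forall>u\<in>V. F u \<in> U) \<and>
     (\<forall>u\<in>V. \<forall>v\<in>V. F (\<lambda>x. u x + v x) = (\<lambda>y. F u y + F v y)) \<and>
     (\<forall>c. \<forall>u\<in>V. F (\<lambda>x. c *\<^sub>R u x) = (\<lambda>y. c *\<^sub>R F u y)) \<and>
     (\<exists>B. \<forall>u\<in>V. nU (F u) \<le> B * nV u)"

definition lin_indep_functionals :: "'f set \<Rightarrow> 'l set \<Rightarrow> ('l \<Rightarrow> 'f \<Rightarrow> real) \<Rightarrow> bool" where
  "lin_indep_functionals V J \<Lambda> \<longleftrightarrow>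
     (\<forall>c. (\<forall>u\<in>V. (\<Sum>l\<in>J. c l * \<Lambda> l u) = 0) \<longrightarrow> (\<forall>l\<in>J. c l = 0))"

definition is_optimal_recovery ::
    "'f set \<Rightarrow> ('f \<Rightarrow> real) \<Rightarrow> 'l set \<Rightarrow> ('l \<Rightarrow> 'f \<Rightarrow> real) \<Rightarrow> 'f \<Rightarrow> 'f \<Rightarrow> bool" where
  "is_optimal_recovery V nrm J \<Lambda> f s \<longleftrightarrow>
     s \<in> V \<and> (\<forall>l\<in>J. \<Lambda> l s = \<Lambda> l f) \<and>
     (\<forall>t\<in>V. (\<forall>l\<in>J. \<Lambda> l t = \<Lambda> l f) \<longrightarrow> nrm s \<le> nrm t)"

section \<open>Matrix-valued functions\<close>

definition mat_sobolev ::
    "real \<Rightarrow> (real^'d) set \<Rightarrow> (real^'n^'n) set \<Rightarrow> (real^'d \<Rightarrow> real^'n^'n) set" where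
  "mat_sobolev \<sigma> \<Omega> W =
     {M. (\<forall>x\<in>\<Omega>. M x \<in> W) \<and> (\<forall>i j. (\<lambda>x. M x $ i $ j) \<in> sobolev \<sigma> \<Omega>)}"

definition mat_inner ::
    "(('x \<Rightarrow> real) \<Rightarrow> ('x \<Rightarrow> real) \<Rightarrow> real) \<Rightarrow>
     ('x \<Rightarrow> real^'n^'n) \<Rightarrow> ('x \<Rightarrow> real^'n^'n) \<Rightarrow> real" where
  "mat_inner ip M S = (\<Sum>i\<in>UNIV. \<Sum>j\<in>UNIV. ip (\<lambda>x. M x $ i $ j) (\<lambda>x. S x $ i $ j))"

text \<open>A kernel \<open>\<Phi> : \<Omega> \<times> \<Omega> \<rightarrow> L(W)\<close>. The inner product of \<^typ>\<open>real^'n^'n\<close> is the Frobenius inner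
  product. Kernel sections are set to zero outside \<open>\<Omega>\<close>, as are the elements of the spaces above.\<close>

definition reproducing_kernel ::
    "(real^'d) set \<Rightarrow> (real^'n^'n) set \<Rightarrow> (real^'d \<Rightarrow> real^'n^'n) set \<Rightarrow>
     ((real^'d \<Rightarrow> real^'n^'n) \<Rightarrow> (real^'d \<Rightarrow> real^'n^'n) \<Rightarrow> real) \<Rightarrow>
     (real^'d \<Rightarrow> real^'d \<Rightarrow> real^'n^'n \<Rightarrow> real^'n^'n) \<Rightarrow> bool" where
  "reproducing_kernel \<Omega> W H ip \<Phi> \<longleftrightarrow>
     (\<forall>x\<in>\<Omega>. \<forall>y\<in>\<Omega>. (\<forall>A\<in>W. \<Phi> x y A \<in> W) \<and>
        (\<forall>A\<in>W. \<forall>B\<in>W. \<Phi> x y (A + B) = \<Phi> x y A + \<Phi> x y B) \<and>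
        (\<forall>c. \<forall>A\<in>W. \<Phi> x y (c *\<^sub>R A) = c *\<^sub>R \<Phi> x y A)) \<and>
     (\<forall>y\<in>\<Omega>. \<forall>A\<in>W. (\<lambda>x. if x \<in> \<Omega> then \<Phi> x y A else 0) \<in> H \<and>
        (\<forall>M\<in>H. M y \<bullet> A = ip M (\<lambda>x. if x \<in> \<Omega> then \<Phi> x y A else 0)))"

text \<open>Extended-real valued, so that a bound on it includes essential boundedness.\<close>

definition mat_Linf_norm :: "(real^'d) set \<Rightarrow> (real^'d \<Rightarrow> real^'n^'n) \<Rightarrow> ereal" where
  "mat_Linf_norm \<Omega> A = Max (range (\<lambda>(i, j). esssup (vol_on \<Omega>) (\<lambda>x. ereal \<bar>A x $ i $ j\<bar>)))"

definition fill_distance :: "(real^'d) set \<Rightarrow> (real^'d) set \<Rightarrow> real" where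
  "fill_distance X \<Omega> = (SUP x\<in>\<Omega>. Min ((\<lambda>y. norm (x - y)) ` X))"

definition entry_functional ::
    "((real^'d \<Rightarrow> real^'n^'n) \<Rightarrow> (real^'d \<Rightarrow> real^'n^'n)) \<Rightarrow> (nat \<Rightarrow> real^'d) \<Rightarrow>
     nat \<times> 'n \<times> 'n \<Rightarrow> (real^'d \<Rightarrow> real^'n^'n) \<Rightarrow> real" where
  "entry_functional F x = (\<lambda>(k, i, j) M. axis i 1 \<bullet> (F M (x k) *v axis j 1))"

end

theory Submission
  imports Defs "HOL-Probability.Probability_Measure"
begin

text \<open>The interpolation conditions say that \<open>F(M)\<close> and \<open>F(S)\<close> agree on \<open>X\<close>, entry by entry (when \<open>W\<close>
  consists of symmetric matrices, the entries below the diagonal follow by symmetry), and the minimality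
  of \<open>S\<close> gives \<open>\<parallel>S\<parallel> \<le> \<parallel>M\<parallel>\<close>. The error bound is therefore a sampling inequality in \<open>H\<^sup>\<tau>(\<Omega>)\<close>: two
  functions that agree on \<open>X\<close> differ by at most \<open>C h\<^bsup>\<tau> - d/2\<^esup>\<close> times the sum of their norms
  (\<open>sobolev_sampling\<close>). That the functionals are bounded is the Sobolev embedding
  (\<open>sobolev_embedding\<close>).

  Both rest on \<open>local_polynomial_approximation\<close>. Let \<open>B\<close> be a ball of radius \<open>\<rho>\<close>, and consider the points
  at distance \<open>O(\<rho>)\<close> from its centre from which all of \<open>B\<close> is visible inside \<open>\<Omega>\<close>. At these points, \<open>u\<close>
  differs by at most \<open>C \<rho>\<^bsup>\<tau> - d/2\<^esup> \<parallel>u\<parallel>\<close> from one polynomial \<open>P\<close> of degree \<open>k = \<lfloor>\<tau>\<rfloor>\<close>.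
  The cone property of a Lipschitz domain provides, for each \<open>y \<in> \<Omega>\<close>, such a ball with \<open>\<rho>\<close> a fixed multiple
  of the fill distance \<open>h\<close>. If this multiple is large enough, a polynomial of degree \<open>k\<close> that is small on
  \<open>X \<inter> B\<close> is small on \<open>B\<close> (\<open>poly_deg_le_norming_set\<close>) and hence at \<open>y\<close> (\<open>poly_deg_le_extrapolate\<close>); this
  is applied to the difference of the polynomials of the two functions.

  The polynomial is the average over \<open>z \<in> B\<close> of the Taylor polynomials of degree \<open>k\<close> of \<open>u\<close> at \<open>z\<close>, after
  a mollification of \<open>u\<close> which makes Taylor's formula classical and does not enter the constants. To
  estimate \<open>u(x) - P(x)\<close>, contract \<open>B\<close> towards \<open>x\<close> by factors of two. The averages of the Taylor values
  at \<open>x\<close> converge to \<open>u(x)\<close>, and by Taylor's formula two consecutive ones differ by an average of the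
  derivatives of order \<open>k\<close>, from which any constant may be subtracted
  (\<open>taylor_step\<close>). By Jensen's inequality, this average is controlled by the \<open>L\<^sub>2\<close> norm of these derivatives
  if \<open>\<tau>\<close> is an integer, and by their Slobodeckij seminorm otherwise. At the \<open>j\<close>-th step this gives
  \<open>(2\<^bsup>-j\<^esup> \<rho>)\<^bsup>\<tau> - d/2\<^esup>\<close>, and the sum over \<open>j\<close> is a geometric series because \<open>\<tau> > d/2\<close>.\<close>

section \<open>Polynomials of bounded degree on lines\<close>

definition lagrange :: "nat \<Rightarrow> nat \<Rightarrow> real poly" where
  "lagrange k j = smult (inverse (\<Prod>i\<in>{..k} - {j}. real j - real i)) (\<Prod>i\<in>{..k} - {j}. [:- real i, 1:])"

lemma poly_lagrange_node:
  assumes "i \<le> k" "j \<le> k"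
  shows "poly (lagrange k j) (real i) = (if i = j then 1 else 0)"
proof (cases "i = j")
  case True
  then show ?thesis by (simp add: lagrange_def poly_prod field_simps)
next
  case False
  then have "(\<Prod>x\<in>{..k} - {j}. real i - real x) = 0"
    using assms by (intro prod_zero) auto
  with False show ?thesis by (simp add: lagrange_def poly_prod)
qed

lemma degree_lagrange:
  assumes "j \<le> k" shows "degree (lagrange k j) \<le> k"
proof -
  have "degree (\<Prod>i\<in>{..k} - {j}. [:- real i, 1:]) \<le> (\<Sum>i\<in>{..k} - {j}. degree [:- real i, 1:])"
    by (rule degree_prod_sum_le[unfolded o_def]) auto
  also have "... = k" using assms by simp
  finally show ?thesis by (simp add: lagrange_def order.trans[OF degree_smult_le])
qed

lemma lagrange_interpolation:
  assumes "degree p \<le> k"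
  shows "poly p s = (\<Sum>j\<le>k. poly (lagrange k j) s * poly p (real j))"
proof -
  let ?q = "\<Sum>j\<le>k. smult (poly p (real j)) (lagrange k j)"
  have "p = ?q"
  proof (rule poly_eqI_degree[of "real ` {..k}"])
    show "degree p < card (real ` {..k})" using assms by (simp add: card_image)
    have "degree ?q \<le> k"
      by (intro degree_sum_le) (auto intro!: order.trans[OF degree_smult_le] degree_lagrange)
    then show "degree ?q < card (real ` {..k})" by (simp add: card_image)
    fix x assume "x \<in> real ` {..k}"
    then obtain i where i: "i \<le> k" "x = real i" by auto
    have "poly ?q x = (\<Sum>j\<le>k. poly p (real j) * (if i = j then 1 else 0))"
      unfolding poly_sum i(2) poly_smult using i by (intro sum.cong) (auto simp: poly_lagrange_node)
    also have "... = poly p x" using i by (simp add: if_distrib sum.delta cong: if_cong)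
    finally show "poly p x = poly ?q x" by simp
  qed
  then have "poly p s = poly ?q s" by simp
  also have "... = (\<Sum>j\<le>k. poly (lagrange k j) s * poly p (real j))"
    unfolding poly_sum poly_smult by (simp only: mult.commute)
  finally show ?thesis .
qed

text \<open>Multivariate polynomials are used through two properties only: the restriction to every line is
  reproduced by Lagrange interpolation at \<open>0, ..., k\<close>, and bounded sets have bounded images. Being linear
  in \<open>P\<close>, the first property survives averaging over a parameter without any discussion of
  coefficients.\<close>

definition poly_deg_le :: "nat \<Rightarrow> ('a::real_normed_vector \<Rightarrow> real) \<Rightarrow> bool" where
  "poly_deg_le k P \<longleftrightarrow>
     (\<forall>a v s. P (a + s *\<^sub>R v) = (\<Sum>j\<le>k. poly (lagrange k j) s * P (a + real j *\<^sub>R v))) \<and>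
     (\<forall>S. bounded S \<longrightarrow> bounded (P ` S))"

lemma poly_deg_le_line:
  "poly_deg_le k P \<Longrightarrow> P (a + s *\<^sub>R v) = (\<Sum>j\<le>k. poly (lagrange k j) s * P (a + real j *\<^sub>R v))"
  unfolding poly_deg_le_def by blast

lemma poly_deg_le_diff:
  assumes "poly_deg_le k P" "poly_deg_le k Q"
  shows "poly_deg_le k (\<lambda>x. P x - Q x)"
  unfolding poly_deg_le_def
proof (intro conjI allI impI)
  fix a v s
  show "P (a + s *\<^sub>R v) - Q (a + s *\<^sub>R v) =
     (\<Sum>j\<le>k. poly (lagrange k j) s * (P (a + real j *\<^sub>R v) - Q (a + real j *\<^sub>R v)))"
    unfolding right_diff_distrib sum_subtractf
    by (simp only: poly_deg_le_line[OF assms(1), of a s v] poly_deg_le_line[OF assms(2), of a s v])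
next
  fix S :: "'a set" assume "bounded S"
  then have "bounded (P ` S)" "bounded (Q ` S)"
    using assms unfolding poly_deg_le_def by blast+
  then show "bounded ((\<lambda>x. P x - Q x) ` S)" by (rule bounded_minus_comp)
qed

lemma poly_abs_bounded:
  fixes p :: "real poly"
  shows "\<exists>C>0. \<forall>s. \<bar>s\<bar> \<le> R \<longrightarrow> \<bar>poly p s\<bar> \<le> C"
proof -
  have "compact (poly p ` {-R..R})"
    by (intro compact_continuous_image continuous_on_poly continuous_on_id) auto
  then have "bounded (poly p ` {-R..R})" by (rule compact_imp_bounded)
  then obtain C where "C > 0" "\<forall>y\<in>poly p ` {-R..R}. norm y \<le> C"
    unfolding bounded_pos by blast
  then show ?thesis by (intro exI[of _ C]) (auto simp: abs_le_iff)
qed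

lemma lagrange_sum_bounded:
  "\<exists>C>0. \<forall>s. \<bar>s\<bar> \<le> R \<longrightarrow> (\<Sum>j\<le>k. \<bar>poly (lagrange k j) s\<bar>) \<le> C"
proof -
  have "\<forall>j. \<exists>C>0. \<forall>s. \<bar>s\<bar> \<le> R \<longrightarrow> \<bar>poly (lagrange k j) s\<bar> \<le> C"
    using poly_abs_bounded by blast
  then obtain C where C: "\<And>j. C j > 0" "\<And>j s. \<bar>s\<bar> \<le> R \<Longrightarrow> \<bar>poly (lagrange k j) s\<bar> \<le> C j"
    by metis
  show ?thesis
    by (rule exI[of _ "\<Sum>j\<le>k. C j"]) (auto intro!: sum_pos sum_mono C)
qed

lemma lagrange_lipschitz:
  "\<exists>C>0. \<forall>s. \<bar>s\<bar> \<le> 1 \<longrightarrow>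
     (\<Sum>j\<le>k. \<bar>poly (lagrange k j) s - poly (lagrange k j) 0\<bar>) \<le> C * \<bar>s\<bar>"
proof -
  have "\<exists>C>0. \<forall>s. \<bar>s\<bar> \<le> 1 \<longrightarrow> \<bar>poly p s - poly p 0\<bar> \<le> C * \<bar>s\<bar>" for p :: "real poly"
  proof -
    obtain c q where p: "p = pCons c q" by (cases p)
    obtain C where "C > 0" "\<And>s. \<bar>s\<bar> \<le> 1 \<Longrightarrow> \<bar>poly q s\<bar> \<le> C"
      using poly_abs_bounded[of 1 q] by blast
    then show ?thesis
      by (intro exI[of _ C]) (auto simp: p abs_mult mult.commute[of C] intro!: mult_left_mono)
  qed
  then have "\<forall>j. \<exists>C>0. \<forall>s. \<bar>s\<bar> \<le> 1 \<longrightarrow> \<bar>poly (lagrange k j) s - poly (lagrange k j) 0\<bar> \<le> C * \<bar>s\<bar>"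
    by blast
  then obtain C where C: "\<And>j. C j > 0"
    "\<And>j s. \<bar>s\<bar> \<le> 1 \<Longrightarrow> \<bar>poly (lagrange k j) s - poly (lagrange k j) 0\<bar> \<le> C j * \<bar>s\<bar>"
    by metis
  show ?thesis
    by (rule exI[of _ "\<Sum>j\<le>k. C j"]) (auto intro!: sum_pos sum_mono C simp: sum_distrib_right)
qed

text \<open>Parametrises the line through \<open>p\<close> and \<open>q\<close> so that the interpolation nodes stay at distance at most \<open>\<rho>\<close>
  from \<open>p\<close>.\<close>

lemma line_through_nodes:
  fixes p q :: "'a::real_normed_vector" and k :: nat
  assumes "\<rho> > 0"
  obtains s v where "q = p + s *\<^sub>R v" "\<bar>s\<bar> = dist q p * (k+1) / \<rho>"
    "\<And>j. j \<le> k \<Longrightarrow> dist (p + real j *\<^sub>R v) p \<le> \<rho>"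
proof -
  define r where "r = dist q p"
  define v where "v = (if r = 0 then 0 else (\<rho> / ((k+1) * r)) *\<^sub>R (q - p))"
  define s where "s = r * (k+1) / \<rho>"
  have nv: "norm v \<le> \<rho> / (k+1)" using assms by (auto simp: v_def r_def dist_norm)
  have "dist (p + real j *\<^sub>R v) p \<le> \<rho>" if "j \<le> k" for j
  proof -
    have "real j * norm v \<le> (k+1) * (\<rho> / (k+1))" using that nv assms by (intro mult_mono) auto
    then show ?thesis by (simp add: dist_norm)
  qed
  moreover have "q = p + s *\<^sub>R v" using assms by (auto simp: v_def s_def r_def)
  moreover have "\<bar>s\<bar> = dist q p * (k+1) / \<rho>" using assms by (simp add: s_def r_def)
  ultimately show ?thesis using that by blast
qed

text \<open>On the line through the centre \<open>b\<close> and \<open>y\<close>, interpolation nodes can be placed inside the ball, at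
  spacing \<open>\<rho> / (k + 1)\<close>; then \<open>y\<close> has a parameter of size at most \<open>R (k + 1)\<close>.\<close>

lemma poly_deg_le_extrapolate:
  "\<exists>C>0. \<forall>P (b::'a::real_normed_vector) \<rho> M y. poly_deg_le k P \<longrightarrow> \<rho> > 0 \<longrightarrow> dist y b \<le> R * \<rho> \<longrightarrow>
      (\<forall>x\<in>cball b \<rho>. \<bar>P x\<bar> \<le> M) \<longrightarrow> \<bar>P y\<bar> \<le> C * M"
proof -
  obtain C where C: "C > 0" "\<And>s. \<bar>s\<bar> \<le> R * (k+1) \<Longrightarrow> (\<Sum>j\<le>k. \<bar>poly (lagrange k j) s\<bar>) \<le> C"
    using lagrange_sum_bounded[where R = "R * (k+1)" and k=k] by auto
  show ?thesis
  proof (rule exI[of _ C], intro conjI allI impI)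
    fix P and b y :: 'a and \<rho> M :: real
    assume P: "poly_deg_le k P" and rho: "\<rho> > 0" and d: "dist y b \<le> R * \<rho>"
      and M: "\<forall>x\<in>cball b \<rho>. \<bar>P x\<bar> \<le> M"
    obtain s v where y: "y = b + s *\<^sub>R v" and s: "\<bar>s\<bar> = dist y b * (k+1) / \<rho>"
      and v: "\<And>j. j \<le> k \<Longrightarrow> dist (b + real j *\<^sub>R v) b \<le> \<rho>"
      by (rule line_through_nodes[OF rho, of y b k], rule that)
    have "dist y b * (k+1) / \<rho> \<le> (R * \<rho>) * (k+1) / \<rho>"
      using d rho by (intro divide_right_mono mult_right_mono) auto
    then have "\<bar>s\<bar> \<le> R * (k+1)" using rho s by simp
    then have sum: "(\<Sum>j\<le>k. \<bar>poly (lagrange k j) s\<bar>) \<le> C" by (rule C)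
    have node: "\<bar>P (b + real j *\<^sub>R v)\<bar> \<le> M" if "j \<le> k" for j
      using M v[OF that] by (auto simp: dist_commute)
    have "\<bar>P y\<bar> = \<bar>\<Sum>j\<le>k. poly (lagrange k j) s * P (b + real j *\<^sub>R v)\<bar>"
      unfolding y by (subst poly_deg_le_line[OF P]) (rule refl)
    also have "... \<le> (\<Sum>j\<le>k. \<bar>poly (lagrange k j) s\<bar> * M)"
      by (rule order.trans[OF sum_abs]) (auto simp: abs_mult intro!: sum_mono mult_left_mono node)
    also have "... \<le> C * M"
      using sum node[of 0] by (auto simp: sum_distrib_right[symmetric] intro!: mult_right_mono)
    finally show "\<bar>P y\<bar> \<le> C * M" .
  qed (use C in auto)
qed

text \<open>A Markov inequality in disguise. Let \<open>M\<close> be the supremum of \<open>P\<close> over the ball. On the doubled ball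
  \<open>P\<close> is \<open>O(M)\<close> by extrapolation, so on a segment of length \<open>\<rho>\<close> starting in the ball \<open>P\<close> has Lipschitz
  constant \<open>O(M / \<rho>)\<close>. Every point of the ball has a point of \<open>X\<close> in the same ball at distance
  at most \<open>2 h\<close>, whence \<open>M \<le> m + O(h / \<rho>) M\<close>, and the last term is at most \<open>M / 2\<close> once \<open>h / \<rho>\<close> is small.\<close>

lemma poly_deg_le_norming_set:
  "\<exists>c>0. c \<le> 1 \<and> (\<forall>P (b::'a::real_normed_vector) \<rho> h X m. poly_deg_le k P \<longrightarrow> 0 < h \<longrightarrow> h \<le> c * \<rho> \<longrightarrow>
      (\<forall>x\<in>cball b \<rho>. \<exists>z\<in>X. dist x z \<le> h) \<longrightarrow> (\<forall>z\<in>X \<inter> cball b \<rho>. \<bar>P z\<bar> \<le> m) \<longrightarrow>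
      (\<forall>x\<in>cball b \<rho>. \<bar>P x\<bar> \<le> 2 * m))"
proof -
  obtain C1 where C1: "C1 > 0" "\<And>P (b::'a) \<rho> M y. poly_deg_le k P \<Longrightarrow> \<rho> > 0 \<Longrightarrow> dist y b \<le> 2 * \<rho> \<Longrightarrow>
      (\<forall>x\<in>cball b \<rho>. \<bar>P x\<bar> \<le> M) \<Longrightarrow> \<bar>P y\<bar> \<le> C1 * M"
    using poly_deg_le_extrapolate[where R=2 and k=k] by blast
  obtain C2 where C2: "C2 > 0" "\<And>s. \<bar>s\<bar> \<le> 1 \<Longrightarrow>
     (\<Sum>j\<le>k. \<bar>poly (lagrange k j) s - poly (lagrange k j) 0\<bar>) \<le> C2 * \<bar>s\<bar>"
    using lagrange_lipschitz[of k] by blast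
  \<comment> \<open>The first bound keeps the interpolation parameter in [0, 1], the second gives the contraction factor 1/2.\<close>
  define c where "c = min (1 / (2 * (k+1))) (1 / (4 * (k+1) * C1 * C2))"
  have c: "c > 0" "c \<le> 1" "2 * (k+1) * c \<le> 1" "C2 * (2 * (k+1) * c) * C1 \<le> 1/2"
  proof -
    show "c > 0" using C1 C2 by (simp add: c_def)
    have "c \<le> 1 / (2 * (k+1))" by (simp add: c_def)
    then show "2 * (k+1) * c \<le> 1" by (simp add: field_simps)
    have "c * 1 \<le> c * (2 * (k+1))" using \<open>c > 0\<close> by (intro mult_left_mono) auto
    then show "c \<le> 1" using \<open>2 * (k+1) * c \<le> 1\<close> by (simp add: mult_ac)
    have "c \<le> 1 / (4 * (k+1) * C1 * C2)" by (simp add: c_def)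
    moreover have "4 * (k+1) * C1 * C2 > 0" using C1 C2 by simp
    ultimately have "c * (4 * (k+1) * C1 * C2) \<le> 1" by (simp only: pos_le_divide_eq)
    then show "C2 * (2 * (k+1) * c) * C1 \<le> 1/2" by (simp add: algebra_simps)
  qed
  show ?thesis
  proof (rule exI[of _ c], intro conjI allI impI c)
    fix P :: "'a \<Rightarrow> real" and b :: 'a and \<rho> h m X
    assume P: "poly_deg_le k P" and h: "0 < h" "h \<le> c * \<rho>"
      and dense: "\<forall>x\<in>cball b \<rho>. \<exists>z\<in>X. dist x z \<le> h"
      and m: "\<forall>z\<in>X \<inter> cball b \<rho>. \<bar>P z\<bar> \<le> m"
    have rho: "\<rho> > 0" using h c(1) by (metis less_le_trans zero_less_mult_pos)
    have hrho: "h \<le> \<rho>" using h c rho by (metis mult_left_le_one_le less_imp_le order.trans)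
    define M where "M = (SUP x\<in>cball b \<rho>. \<bar>P x\<bar>)"
    have "bounded (P ` cball b \<rho>)" using P unfolding poly_deg_le_def by auto
    then have bdd: "bdd_above ((\<lambda>x. \<bar>P x\<bar>) ` cball b \<rho>)"
      unfolding bounded_iff bdd_above_def by auto
    have le_M: "\<bar>P x\<bar> \<le> M" if "x \<in> cball b \<rho>" for x
      unfolding M_def using that bdd by (intro cSUP_upper)
    have M2: "\<bar>P y\<bar> \<le> C1 * M" if "dist y b \<le> 2 * \<rho>" for y
      using C1(2)[OF P rho that] le_M by blast
    have M0: "M \<ge> 0" using le_M[of b] rho by simp
    have key: "\<bar>P x\<bar> \<le> m + M / 2" if x: "x \<in> cball b \<rho>" for x
    proof -
      \<comment> \<open>Moving \<open>x\<close> inwards by \<open>h\<close> first ensures that the nearby point of \<open>X\<close> lies in the ball.\<close>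
      define x' where "x' = b + (1 - h / \<rho>) *\<^sub>R (x - b)"
      have xb: "norm (x - b) \<le> \<rho>" using x by (simp add: dist_norm norm_minus_commute)
      have "norm (x' - b) = (1 - h / \<rho>) * norm (x - b)"
        using hrho rho by (simp add: x'_def)
      also have "... \<le> (1 - h / \<rho>) * \<rho>" using hrho rho xb by (intro mult_left_mono) auto
      also have "... = \<rho> - h" using rho by (simp add: field_simps)
      finally have x'b: "dist x' b \<le> \<rho> - h" by (simp add: dist_norm)
      have "x - x' = (h / \<rho>) *\<^sub>R (x - b)" by (simp add: x'_def algebra_simps)
      then have "norm (x - x') = h / \<rho> * norm (x - b)" using h rho by simp
      also have "... \<le> h / \<rho> * \<rho>" using h rho xb by (intro mult_left_mono) auto
      finally have xx': "dist x x' \<le> h" using rho by (simp add: dist_norm)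
      obtain z where z: "z \<in> X" "dist x' z \<le> h"
        using dense x'b h by (force simp: dist_commute)
      have zb: "z \<in> cball b \<rho>"
        using z x'b dist_triangle[of b z x'] by (simp add: dist_commute)
      have xz: "dist x z \<le> 2 * h" using xx' z dist_triangle[of x z x'] by simp
      obtain s v where xs: "x = z + s *\<^sub>R v" and s0: "\<bar>s\<bar> = dist x z * (k+1) / \<rho>"
        and v: "\<And>j. j \<le> k \<Longrightarrow> dist (z + real j *\<^sub>R v) z \<le> \<rho>"
        by (rule line_through_nodes[OF rho, of x z k], rule that)
      have "dist x z \<le> 2 * (c * \<rho>)" using xz h by simp
      then have "dist x z * (k+1) / \<rho> \<le> 2 * (c * \<rho>) * (k+1) / \<rho>"
        using rho by (intro divide_right_mono mult_right_mono) auto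
      then have "\<bar>s\<bar> \<le> 2 * (k+1) * c" using rho s0 by (simp add: mult_ac)
      then have s: "\<bar>s\<bar> \<le> 2 * (k+1) * c" "\<bar>s\<bar> \<le> 1" using c by auto
      have node: "\<bar>P (z + real j *\<^sub>R v)\<bar> \<le> C1 * M" if "j \<le> k" for j
        using zb v[OF that] dist_triangle[of "z + real j *\<^sub>R v" b z] by (intro M2) (simp add: dist_commute)
      have "P x - P z = P (z + s *\<^sub>R v) - P (z + 0 *\<^sub>R v)" by (simp add: xs)
      also have "... = (\<Sum>j\<le>k. poly (lagrange k j) s * P (z + real j *\<^sub>R v))
                      - (\<Sum>j\<le>k. poly (lagrange k j) 0 * P (z + real j *\<^sub>R v))"
        by (subst poly_deg_le_line[OF P, of z s v], subst poly_deg_le_line[OF P, of z 0 v]) (rule refl)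
      also have "... = (\<Sum>j\<le>k. (poly (lagrange k j) s - poly (lagrange k j) 0) * P (z + real j *\<^sub>R v))"
        by (simp add: left_diff_distrib sum_subtractf)
      finally have "\<bar>P x - P z\<bar> \<le> (\<Sum>j\<le>k. \<bar>poly (lagrange k j) s - poly (lagrange k j) 0\<bar> * (C1 * M))"
        by (simp only:) (rule order.trans[OF sum_abs], auto simp: abs_mult intro!: sum_mono mult_left_mono node)
      also have "... \<le> (C2 * \<bar>s\<bar>) * (C1 * M)"
        unfolding sum_distrib_right[symmetric] using C1 M0 s by (intro mult_right_mono C2) auto
      also have "... \<le> (C2 * (2 * (k+1) * c)) * (C1 * M)"
        using C1 C2 M0 s by (intro mult_right_mono mult_left_mono) auto
      also have "... = (C2 * (2 * (k+1) * c) * C1) * M" by simp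
      also have "... \<le> 1/2 * M" using c M0 by (intro mult_right_mono) auto
      finally have "\<bar>P x - P z\<bar> \<le> 1/2 * M" .
      moreover have "\<bar>P z\<bar> \<le> m" using m z zb by blast
      ultimately show ?thesis by linarith
    qed
    have "M \<le> m + M / 2" unfolding M_def
      by (rule cSUP_least) (use rho key M_def in auto)
    then have "M \<le> 2 * m" by simp
    then show "\<forall>x\<in>cball b \<rho>. \<bar>P x\<bar> \<le> 2 * m" using le_M by force
  qed
qed

section \<open>Balls visible from the points of a Lipschitz domain\<close>

text \<open>The points at which averages over \<open>cball b \<rho>\<close> of Taylor polynomials can be compared with the function: Taylor's
  formula is used on segments inside \<open>\<Omega>\<close> only, and the constants are uniform in \<open>\<rho>\<close>.\<close>

definition star_points :: "(real^'d) set \<Rightarrow> real \<Rightarrow> real^'d \<Rightarrow> real \<Rightarrow> (real^'d) set" where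
  "star_points \<Omega> R b \<rho> = {y. dist y b \<le> R * \<rho> \<and> (\<forall>w\<in>cball b \<rho>. closed_segment y w \<subseteq> \<Omega>)}"

lemma norm_orthogonal_projection_le:
  fixes q e :: "'a::real_inner"
  assumes "norm e = 1" shows "norm (q - (q \<bullet> e) *\<^sub>R e) \<le> norm q"
proof -
  have "e \<bullet> e = 1" using assms by (simp add: norm_eq_1)
  then have "(norm (q - (q \<bullet> e) *\<^sub>R e))\<^sup>2 = (norm q)\<^sup>2 - (q \<bullet> e)\<^sup>2"
    unfolding power2_norm_eq_inner
    by (simp add: inner_diff_left inner_diff_right inner_commute power2_eq_square)
  then have "(norm (q - (q \<bullet> e) *\<^sub>R e))\<^sup>2 \<le> (norm q)\<^sup>2" by simp
  then show ?thesis by (rule power2_le_imp_le) simp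
qed

text \<open>Moving from \<open>y\<close> by \<open>t ((L + 1) \<rho> e + q)\<close> with \<open>|q| \<le> \<rho>\<close> raises the height by at least \<open>t L \<rho>\<close>, and the
  graph rises by at most \<open>L\<close> times the horizontal displacement, which is at most \<open>t \<rho>\<close>.\<close>

lemma epigraph_local_cone:
  fixes \<Omega> :: "'a::real_inner set"
  assumes "r > 0" "norm e = 1" and lip: "L-lipschitz_on {y. y \<bullet> e = 0} \<gamma>"
    and eq: "\<Omega> \<inter> ball p r = {x \<in> ball p r. \<gamma> (x - (x \<bullet> e) *\<^sub>R e) < x \<bullet> e}"
    and y: "y \<in> \<Omega>" "y \<in> ball p (r / 2)" and \<rho>: "0 < \<rho>" "\<rho> \<le> r / (2 * (L + 2))"
    and w: "w \<in> cball (y + ((L + 1) * \<rho>) *\<^sub>R e) \<rho>"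
  shows "closed_segment y w \<subseteq> \<Omega>"
proof
  fix x assume "x \<in> closed_segment y w"
  then obtain t where t: "0 \<le> t" "t \<le> 1" and "x = (1 - t) *\<^sub>R y + t *\<^sub>R w"
    unfolding closed_segment_def by blast
  define q where "q = w - (y + ((L + 1) * \<rho>) *\<^sub>R e)"
  have q: "norm q \<le> \<rho>" using w by (simp add: q_def dist_norm norm_minus_commute)
  have x: "x = y + t *\<^sub>R (((L + 1) * \<rho>) *\<^sub>R e + q)"
    using \<open>x = _\<close> by (simp add: q_def algebra_simps)
  have ee: "e \<bullet> e = 1" using assms by (simp add: norm_eq_1)
  have L: "L \<ge> 0" using lip by (rule lipschitz_on_nonneg)
  have "norm (x - y) = t * norm (((L + 1) * \<rho>) *\<^sub>R e + q)" using t by (simp add: x)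
  also have "... \<le> 1 * ((L + 1) * \<rho> + \<rho>)"
    using t L \<rho> q assms(2) by (intro mult_mono order.trans[OF norm_triangle_ineq] add_mono) auto
  also have "... = \<rho> * (L + 2)" by (simp add: algebra_simps)
  also have "... \<le> r / (2 * (L + 2)) * (L + 2)" using L \<rho> by (intro mult_right_mono) auto
  also have "... = r / 2" using L by (simp add: field_simps)
  finally have "dist x y \<le> r / 2" by (simp add: dist_norm)
  then have xb: "x \<in> ball p r"
    using y(2) dist_triangle[of p x y] by (simp add: dist_commute)
  have yb: "y \<in> ball p r" using y(2) assms(1) by simp
  let ?P = "\<lambda>x. x - (x \<bullet> e) *\<^sub>R e"
  have P0: "?P x \<bullet> e = 0" for x by (simp add: inner_diff_left ee)
  have "?P x - ?P y = t *\<^sub>R (q - (q \<bullet> e) *\<^sub>R e)"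
    unfolding x by (simp add: inner_add_left inner_diff_left ee algebra_simps)
  then have "norm (?P x - ?P y) \<le> t * norm q"
    using t norm_orthogonal_projection_le[OF assms(2), of q] by (simp add: mult_left_mono)
  also have "... \<le> t * \<rho>" using q t by (intro mult_left_mono)
  finally have "dist (?P x) (?P y) \<le> t * \<rho>" by (simp add: dist_norm)
  then have "L * dist (?P x) (?P y) \<le> L * (t * \<rho>)" using L by (intro mult_left_mono)
  then have g: "\<gamma> (?P x) \<le> \<gamma> (?P y) + L * (t * \<rho>)"
    using lipschitz_onD[OF lip, of "?P x" "?P y"] P0 by (simp add: dist_real_def)
  have "\<gamma> (?P y) < y \<bullet> e" using eq y(1) yb by blast
  moreover have "- (q \<bullet> e) \<le> \<rho>"
    using norm_cauchy_schwarz[of "-q" e] q assms(2) by simp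
  then have "t * - (q \<bullet> e) \<le> t * \<rho>" using t by (intro mult_left_mono)
  moreover have "x \<bullet> e = y \<bullet> e + t * ((L + 1) * \<rho>) + t * (q \<bullet> e)"
    by (simp add: x inner_add_left ee algebra_simps)
  ultimately have "\<gamma> (?P x) < x \<bullet> e" using g by (simp add: algebra_simps)
  then show "x \<in> \<Omega>" using eq xb by blast
qed

text \<open>Locally, near a boundary point the ball lies above \<open>y\<close> in the direction of the chart, and near an
  interior point it is centred at \<open>y\<close>; compactness of the closure makes \<open>R\<close> and \<open>\<rho>0\<close> uniform.\<close>

lemma bounded_lipschitz_domain_cone:
  assumes "bounded_lipschitz_domain \<Omega>"
  shows "\<exists>R\<ge>1. \<exists>\<rho>0>0. \<forall>y\<in>\<Omega>. \<forall>\<rho>. 0 < \<rho> \<longrightarrow> \<rho> \<le> \<rho>0 \<longrightarrow>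
    (\<exists>b. dist y b \<le> R * \<rho> \<and> (\<forall>w\<in>cball b \<rho>. closed_segment y w \<subseteq> \<Omega>))"
proof -
  have dom: "open \<Omega>" "\<Omega> \<noteq> {}" "bounded \<Omega>" using assms unfolding bounded_lipschitz_domain_def by auto
  have "\<exists>r>0. \<exists>R\<ge>1. \<exists>\<rho>0>0. \<forall>y\<in>\<Omega> \<inter> ball p r. \<forall>\<rho>. 0 < \<rho> \<longrightarrow> \<rho> \<le> \<rho>0 \<longrightarrow>
    (\<exists>b. dist y b \<le> R * \<rho> \<and> (\<forall>w\<in>cball b \<rho>. closed_segment y w \<subseteq> \<Omega>))" if p: "p \<in> closure \<Omega>" for p
  proof (cases "p \<in> \<Omega>")
    case True
    then obtain r where r: "r > 0" "ball p r \<subseteq> \<Omega>" using dom(1) open_contains_ball by blast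
    show ?thesis
    proof (intro exI conjI ballI allI impI)
      fix y \<rho> assume y: "y \<in> \<Omega> \<inter> ball p (r/2)" and \<rho>: "0 < \<rho>" "\<rho> \<le> r/2"
      show "dist y y \<le> 1 * \<rho>" using \<rho> by simp
      fix w assume w: "w \<in> cball y \<rho>"
      have "cball y \<rho> \<subseteq> ball p r"
      proof
        fix u assume "u \<in> cball y \<rho>"
        then show "u \<in> ball p r" using y \<rho> dist_triangle[of p u y] by simp
      qed
      moreover have "closed_segment y w \<subseteq> cball y \<rho>"
        using \<rho> w by (intro closed_segment_subset) auto
      ultimately show "closed_segment y w \<subseteq> \<Omega>" using r by blast
    qed (use r in auto)
  next
    case False
    then have "p \<in> frontier \<Omega>" using p dom(1) by (simp add: frontier_def interior_open)
    then obtain r e \<gamma> L where 1: "r > 0" "norm e = 1" "L-lipschitz_on {y. y \<bullet> e = 0} \<gamma>"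
        "\<Omega> \<inter> ball p r = {x \<in> ball p r. \<gamma> (x - (x \<bullet> e) *\<^sub>R e) < x \<bullet> e}"
      using assms unfolding bounded_lipschitz_domain_def by blast
    have L: "L \<ge> 0" using 1(3) by (rule lipschitz_on_nonneg)
    show ?thesis
    proof (intro exI conjI ballI allI impI)
      fix y \<rho> assume y: "y \<in> \<Omega> \<inter> ball p (r/2)" and \<rho>: "0 < \<rho>" "\<rho> \<le> r / (2 * (L + 2))"
      show "dist y (y + ((L + 1) * \<rho>) *\<^sub>R e) \<le> (L + 1) * \<rho>"
        using 1(2) \<rho> L by (simp add: dist_norm)
      fix w assume w: "w \<in> cball (y + ((L + 1) * \<rho>) *\<^sub>R e) \<rho>"
      show "closed_segment y w \<subseteq> \<Omega>" using epigraph_local_cone[OF 1 _ _ \<rho> w] y by blast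
    qed (use 1 L in auto)
  qed
  then obtain r R P where rRP: "\<And>p. p \<in> closure \<Omega> \<Longrightarrow> r p > 0" "\<And>p. p \<in> closure \<Omega> \<Longrightarrow> R p \<ge> 1"
    "\<And>p. p \<in> closure \<Omega> \<Longrightarrow> P p > 0"
    "\<And>p y \<rho>. p \<in> closure \<Omega> \<Longrightarrow> y \<in> \<Omega> \<inter> ball p (r p) \<Longrightarrow> 0 < \<rho> \<Longrightarrow> \<rho> \<le> P p \<Longrightarrow>
    (\<exists>b. dist y b \<le> R p * \<rho> \<and> (\<forall>w\<in>cball b \<rho>. closed_segment y w \<subseteq> \<Omega>))" by metis
  have "compact (closure \<Omega>)" using dom(3) by simp
  moreover have "closure \<Omega> \<subseteq> (\<Union>p\<in>closure \<Omega>. ball p (r p))" using rRP(1) by force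
  ultimately obtain D where D: "D \<subseteq> closure \<Omega>" "finite D" "closure \<Omega> \<subseteq> (\<Union>p\<in>D. ball p (r p))"
    by (metis (no_types, lifting) compactE_image open_ball)
  have Dne: "D \<noteq> {}" using D dom(2) closure_subset[of \<Omega>] by auto
  have "Max (R ` D) \<ge> 1" using D Dne rRP(2) by (auto simp: Max_ge_iff)
  moreover have "Min (P ` D) > 0" using D Dne rRP(3) by auto
  moreover have "\<exists>b. dist y b \<le> Max (R ` D) * \<rho> \<and> (\<forall>w\<in>cball b \<rho>. closed_segment y w \<subseteq> \<Omega>)"
    if y: "y \<in> \<Omega>" and \<rho>: "0 < \<rho>" "\<rho> \<le> Min (P ` D)" for y \<rho>
  proof -
    obtain p where p: "p \<in> D" "y \<in> ball p (r p)" using y D closure_subset[of \<Omega>] by blast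
    have "Min (P ` D) \<le> P p" using p D by (intro Min_le) auto
    then have "\<rho> \<le> P p" using \<rho> by simp
    then obtain b where b: "dist y b \<le> R p * \<rho>" "\<forall>w\<in>cball b \<rho>. closed_segment y w \<subseteq> \<Omega>"
      using rRP(4)[of p y \<rho>] p y D \<rho> by blast
    have "R p * \<rho> \<le> Max (R ` D) * \<rho>" using p D \<rho> by (intro mult_right_mono) auto
    then show ?thesis using b order.trans by blast
  qed
  ultimately show ?thesis by blast
qed

lemma bounded_lipschitz_domain_star_points:
  assumes "bounded_lipschitz_domain \<Omega>"
  obtains R \<rho>0 where "R \<ge> 1" "\<rho>0 > 0"
    "\<And>y \<rho>. y \<in> \<Omega> \<Longrightarrow> 0 < \<rho> \<Longrightarrow> \<rho> \<le> \<rho>0 \<Longrightarrow> \<exists>b. y \<in> star_points \<Omega> R b \<rho>"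
proof -
  have "\<exists>R\<ge>1. \<exists>\<rho>0>0. \<forall>y\<in>\<Omega>. \<forall>\<rho>. 0 < \<rho> \<longrightarrow> \<rho> \<le> \<rho>0 \<longrightarrow> (\<exists>b. y \<in> star_points \<Omega> R b \<rho>)"
    using bounded_lipschitz_domain_cone[OF assms] unfolding star_points_def mem_Collect_eq .
  with that show ?thesis by blast
qed

section \<open>Smooth compactly supported functions and mollification\<close>

text \<open>For \<open>p = 1\<close> this is the standard flat function \<open>exp (-1/x)\<close>; the factor \<open>p(1/x)\<close> makes the family
  closed under differentiation.\<close>

definition flat_exp :: "real poly \<Rightarrow> real \<Rightarrow> real" where
  "flat_exp p x = (if x > 0 then poly p (1/x) * exp (- (1/x)) else 0)"

definition flat_deriv :: "real poly \<Rightarrow> real poly" where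
  "flat_deriv p = [:0, 0, 1:] * (p - pderiv p)"

lemma poly_times_exp_tendsto_0:
  "((\<lambda>y. poly p y * exp (- y)) \<longlongrightarrow> (0::real)) at_top"
proof (induction p)
  case (pCons c p)
  have *: "((\<lambda>y::real. y ^ n * exp (- y)) \<longlongrightarrow> 0) at_top" for n
    using tendsto_power_div_exp_0[of n] by (simp add: exp_minus divide_inverse)
  have "((\<lambda>y. \<Sum>i\<le>degree (pCons c p). coeff (pCons c p) i * (y ^ i * exp (- y))) \<longlongrightarrow> (\<Sum>i\<le>degree (pCons c p). coeff (pCons c p) i * 0)) at_top"
    by (intro tendsto_sum tendsto_mult tendsto_const *)
  then show ?case by (simp add: poly_altdef sum_distrib_right mult.assoc)
qed simp

lemma flat_exp_has_derivative: "(flat_exp p has_real_derivative flat_exp (flat_deriv p) x) (at x)"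
proof (cases x "0::real" rule: linorder_cases)
  case greater
  have "((\<lambda>x. poly p (1/x) * exp (- (1/x))) has_real_derivative
      poly (pderiv p) (1/x) * (- 1 / x^2) * exp (- (1/x)) + exp (- (1/x)) * (1/x^2) * poly p (1/x)) (at x)"
    using greater by (auto intro!: derivative_eq_intros simp: power2_eq_square)
  also have "poly (pderiv p) (1/x) * (- 1 / x^2) * exp (- (1/x)) + exp (- (1/x)) * (1/x^2) * poly p (1/x)
     = flat_exp (flat_deriv p) x"
    using greater by (simp add: flat_exp_def flat_deriv_def field_simps power2_eq_square)
  finally show ?thesis
    by (rule has_field_derivative_transform_within_open[of _ _ _ "{0<..}"])
       (use greater in \<open>auto simp: flat_exp_def\<close>)
next
  case less
  have "((\<lambda>x. 0::real) has_real_derivative flat_exp (flat_deriv p) x) (at x)"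
    using less by (simp add: flat_exp_def)
  then show ?thesis
    by (rule has_field_derivative_transform_within_open[of _ _ _ "{..<0}"])
       (use less in \<open>auto simp: flat_exp_def\<close>)
next
  case equal
  have "((\<lambda>h. flat_exp p h / h) \<longlongrightarrow> 0) (at 0)"
  proof -
    have "((\<lambda>h. flat_exp p h / h) \<longlongrightarrow> 0) (at_right 0)"
    proof -
      have "((\<lambda>y. poly ([:0,1:] * p) y * exp (- y)) \<longlongrightarrow> 0) at_top"
        by (rule poly_times_exp_tendsto_0)
      then have "((\<lambda>h. poly ([:0,1:] * p) (inverse h) * exp (- inverse h)) \<longlongrightarrow> (0::real)) (at_right 0)"
        by (rule filterlim_compose) (rule filterlim_inverse_at_top_right)
      then show ?thesis
        by (rule Lim_transform_eventually)
           (auto simp: eventually_at_right_field flat_exp_def field_simps intro!: exI[of _ 1])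
    qed
    moreover have "((\<lambda>h. flat_exp p h / h) \<longlongrightarrow> 0) (at_left 0)"
      by (rule tendsto_eventually) (auto simp: eventually_at_left_field flat_exp_def intro!: exI[of _ "-1"])
    ultimately show ?thesis by (simp add: filterlim_split_at)
  qed
  then show ?thesis
    using equal by (simp add: has_field_derivative_iff flat_exp_def)
qed

text \<open>A set of functions that is closed under differentiation and contains the bump
  \<open>exp (-1/(1+x)) exp (-1/(1-x))\<close>; all of its members vanish outside \<open>(-1, 1)\<close>.\<close>

inductive_set bump_span :: "(real \<Rightarrow> real) set" where
  prod: "(\<lambda>x. c * (flat_exp p (1 + x) * flat_exp q (1 - x))) \<in> bump_span"
| add: "f \<in> bump_span \<Longrightarrow> g \<in> bump_span \<Longrightarrow> (\<lambda>x. f x + g x) \<in> bump_span"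

lemma bump_span_derivative:
  assumes "f \<in> bump_span"
  shows "\<exists>g\<in>bump_span. \<forall>x. (f has_real_derivative g x) (at x)"
  using assms
proof induction
  case (prod c p q)
  have 1: "((\<lambda>x. flat_exp p (1 + x)) has_real_derivative flat_exp (flat_deriv p) (1 + x)) (at x)" for x
  proof -
    have "((\<lambda>x. 1 + x) has_real_derivative 1) (at x)" by (auto intro!: derivative_eq_intros)
    from DERIV_chain2[where f = "flat_exp p", OF flat_exp_has_derivative this] show ?thesis by simp
  qed
  have 2: "((\<lambda>x. flat_exp q (1 - x)) has_real_derivative - flat_exp (flat_deriv q) (1 - x)) (at x)" for x
  proof -
    have "((\<lambda>x. 1 - x) has_real_derivative -1) (at x)" by (auto intro!: derivative_eq_intros)
    from DERIV_chain2[where f = "flat_exp q", OF flat_exp_has_derivative this] show ?thesis by simp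
  qed
  show ?case
  proof (rule bexI)
    show "\<forall>x. ((\<lambda>x. c * (flat_exp p (1 + x) * flat_exp q (1 - x))) has_real_derivative
       c * (flat_exp (flat_deriv p) (1 + x) * flat_exp q (1 - x)) +
       (- c) * (flat_exp p (1 + x) * flat_exp (flat_deriv q) (1 - x))) (at x)"
      by (intro allI DERIV_cong[OF DERIV_cmult[OF DERIV_mult[OF 1 2]]]) (simp add: algebra_simps)
  qed (intro bump_span.intros)
next
  case (add f g)
  then obtain f' g' where "f' \<in> bump_span" "g' \<in> bump_span"
    "\<And>x. (f has_real_derivative f' x) (at x)" "\<And>x. (g has_real_derivative g' x) (at x)" by blast
  then show ?case
    by (intro bexI[of _ "\<lambda>x. f' x + g' x"]) (auto intro!: derivative_eq_intros bump_span.add)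
qed

definition bump :: "nat \<Rightarrow> real \<Rightarrow> real" where
  "bump n = (deriv ^^ n) (\<lambda>x. 1 * (flat_exp 1 (1 + x) * flat_exp 1 (1 - x)))"

lemma bump_span_deriv:
  assumes "f \<in> bump_span" shows "deriv f \<in> bump_span" "(f has_real_derivative deriv f x) (at x)"
proof -
  obtain g where g: "g \<in> bump_span" "\<And>x. (f has_real_derivative g x) (at x)"
    using bump_span_derivative[OF assms] by blast
  then have "deriv f = g" by (auto intro!: DERIV_imp_deriv)
  with g show "deriv f \<in> bump_span" "(f has_real_derivative deriv f x) (at x)" by auto
qed

lemma bump_in_span: "bump n \<in> bump_span"
proof (induction n)
  case 0
  show ?case unfolding bump_def funpow_0 by (rule bump_span.prod)
next
  case (Suc n)
  then show ?case using bump_span_deriv(1) by (simp add: bump_def)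
qed

lemma bump_has_derivative: "(bump n has_real_derivative bump (Suc n) x) (at x)"
  using bump_span_deriv(2)[OF bump_in_span[of n]] by (simp add: bump_def)

lemma bump_outside:
  assumes "\<bar>x\<bar> \<ge> 1" shows "bump n x = 0"
proof -
  have "f x = 0" if "f \<in> bump_span" for f
    using that by induction (use assms in \<open>auto simp: flat_exp_def\<close>)
  then show ?thesis using bump_in_span by blast
qed

lemma bump_0_pos: "\<bar>x\<bar> < 1 \<Longrightarrow> bump 0 x > 0"
  by (simp add: bump_def flat_exp_def)

lemma bump_0_nonneg: "bump 0 x \<ge> 0"
  by (simp add: bump_def flat_exp_def)

lemma isCont_bump: "isCont (bump n) x"
  using bump_has_derivative DERIV_isCont by blast

lemma continuous_on_bump [continuous_intros]:
  "continuous_on S f \<Longrightarrow> continuous_on S (\<lambda>x. bump n (f x))"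
  by (rule continuous_on_compose2[of UNIV "bump n"]) (auto intro!: continuous_at_imp_continuous_on isCont_bump)

lemma bump_bounded: "\<exists>C>0. \<forall>x. \<bar>bump n x\<bar> \<le> C"
proof -
  have "bounded (bump n ` {-1..1})"
    by (intro compact_imp_bounded compact_continuous_image continuous_intros) auto
  then obtain C where "C > 0" "\<forall>y\<in>bump n ` {-1..1}. norm y \<le> C"
    unfolding bounded_pos by blast
  then have "\<bar>bump n x\<bar> \<le> C" for x
    using bump_outside[of x n] by (cases "\<bar>x\<bar> \<le> 1") (auto simp: abs_le_iff)
  with \<open>C > 0\<close> show ?thesis by blast
qed

text \<open>The mixed partial derivative, of order \<open>n i\<close> in the \<open>i\<close>-th coordinate, of the product bump.\<close>

definition tensor_bump :: "('d::finite \<Rightarrow> nat) \<Rightarrow> real^'d \<Rightarrow> real" where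
  "tensor_bump n x = (\<Prod>i\<in>UNIV. bump (n i) (x $ i))"

lemma tensor_bump_bounded: "\<exists>C>0. \<forall>x. \<bar>tensor_bump n x\<bar> \<le> C"
proof -
  obtain C where C: "\<And>m. C m > 0" "\<And>m x. \<bar>bump m x\<bar> \<le> C m"
    using bump_bounded by metis
  show ?thesis
    by (rule exI[of _ "\<Prod>i\<in>UNIV. C (n i)"])
       (auto simp: tensor_bump_def abs_prod intro!: prod_pos prod_mono C)
qed

lemma tensor_bump_outside:
  fixes x :: "real^'d"
  assumes "norm x \<ge> CARD('d)" shows "tensor_bump n x = 0"
proof -
  have "\<exists>i. \<bar>x $ i\<bar> \<ge> 1"
  proof (rule ccontr)
    assume "\<not> (\<exists>i. \<bar>x $ i\<bar> \<ge> 1)"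
    then have "(\<Sum>i\<in>UNIV. \<bar>x $ i\<bar>) < (\<Sum>i\<in>(UNIV::'d set). 1)"
      by (intro sum_strict_mono) (auto simp: not_le)
    with norm_le_l1_cart[of x] assms show False by simp
  qed
  then show ?thesis unfolding tensor_bump_def
    by (intro prod_zero) (auto intro: bump_outside)
qed

lemma continuous_on_tensor_bump [continuous_intros]:
  "continuous_on S f \<Longrightarrow> continuous_on S (\<lambda>x. tensor_bump n (f x))"
  unfolding tensor_bump_def by (intro continuous_intros)

lemma tensor_bump_measurable [measurable]: "tensor_bump n \<in> borel_measurable borel"
  by (intro borel_measurable_continuous_onI continuous_intros)

abbreviation partial_bump :: "('d::finite \<Rightarrow> nat) \<Rightarrow> 'd \<Rightarrow> real^'d \<Rightarrow> real" where
  "partial_bump n i \<equiv> tensor_bump (n(i := Suc (n i)))"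

lemma tensor_bump_has_derivative:
  fixes x :: "real^'d"
  shows "(tensor_bump n has_derivative (\<lambda>e. \<Sum>i\<in>UNIV. e $ i * partial_bump n i x)) (at x)"
proof -
  have 1: "((\<lambda>x. bump (n i) (x $ i)) has_derivative (\<lambda>e. bump (Suc (n i)) (x $ i) * e $ i)) (at x)" for i
  proof -
    have "((\<lambda>x. x $ i) has_derivative (\<lambda>e. e $ i)) (at x)"
      by (rule bounded_linear_imp_has_derivative[OF bounded_linear_vec_nth])
    from has_derivative_compose[OF this, of "bump (n i)", OF bump_has_derivative[unfolded has_field_derivative_def]]
    show ?thesis .
  qed
  have "((\<lambda>x. \<Prod>i\<in>UNIV. bump (n i) (x $ i)) has_derivative
     (\<lambda>e. \<Sum>i\<in>UNIV. (bump (Suc (n i)) (x $ i) * e $ i) * (\<Prod>j\<in>UNIV - {i}. bump (n j) (x $ j)))) (at x)"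
    by (rule has_derivative_prod) (rule 1)
  also have "(\<lambda>e. \<Sum>i\<in>UNIV. (bump (Suc (n i)) (x $ i) * e $ i) * (\<Prod>j\<in>UNIV - {i}. bump (n j) (x $ j)))
     = (\<lambda>e. \<Sum>i\<in>UNIV. e $ i * partial_bump n i x)"
  proof (intro ext sum.cong refl)
    fix e and i :: 'd
    have "partial_bump n i x
       = bump (Suc (n i)) (x $ i) * (\<Prod>j\<in>UNIV - {i}. bump ((n(i := Suc (n i))) j) (x $ j))"
      unfolding tensor_bump_def by (subst prod.remove[of UNIV i]) auto
    also have "(\<Prod>j\<in>UNIV - {i}. bump ((n(i := Suc (n i))) j) (x $ j)) = (\<Prod>j\<in>UNIV - {i}. bump (n j) (x $ j))"
      by (intro prod.cong) auto
    finally show "(bump (Suc (n i)) (x $ i) * e $ i) * (\<Prod>j\<in>UNIV - {i}. bump (n j) (x $ j))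
       = e $ i * partial_bump n i x" by (simp only: mult_ac)
  qed
  finally show ?thesis unfolding tensor_bump_def[abs_def] .
qed

lemma tensor_bump_lipschitz: "\<exists>C>0. \<forall>x y. \<bar>tensor_bump n (x + y) - tensor_bump n (x :: real^'d)\<bar> \<le> C * norm y"
proof -
  obtain B where B: "\<And>m. B m > 0" "\<And>m x. \<bar>tensor_bump m (x::real^'d)\<bar> \<le> B m"
    using tensor_bump_bounded by metis
  let ?C = "\<Sum>i\<in>UNIV. B (n(i := Suc (n i)))"
  have "norm (tensor_bump n (x + y) - tensor_bump n x) \<le> ?C * norm (x + y - x)" for x y :: "real^'d"
  proof (rule differentiable_bound[OF convex_UNIV, of "tensor_bump n"])
    fix z :: "real^'d"
    show "(tensor_bump n has_derivative (\<lambda>e. \<Sum>i\<in>UNIV. e $ i * partial_bump n i z)) (at z)"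
      by (rule tensor_bump_has_derivative)
    show "onorm (\<lambda>e. \<Sum>i\<in>UNIV. e $ i * partial_bump n i z) \<le> ?C"
    proof (rule onorm_bound)
      fix e :: "real^'d"
      have "norm (\<Sum>i\<in>UNIV. e $ i * partial_bump n i z) \<le>
        (\<Sum>i\<in>UNIV. norm e * B (n(i := Suc (n i))))"
        by (rule order.trans[OF norm_sum])
           (auto intro!: sum_mono mult_mono B component_le_norm_cart simp: abs_mult)
      then show "norm (\<Sum>i\<in>UNIV. e $ i * partial_bump n i z) \<le> ?C * norm e"
        by (simp add: sum_distrib_left mult.commute)
    qed (intro sum_nonneg less_imp_le B)
  qed auto
  moreover have "?C > 0" by (rule sum_pos) (use B in auto)
  ultimately show ?thesis by (intro exI[of _ ?C]) auto
qed

text \<open>The error is quadratic uniformly in \<open>x\<close>, which allows convolutions with \<open>tensor_bump\<close> to be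
  differentiated under the integral sign.\<close>

lemma tensor_bump_taylor:
  fixes n :: "'d::finite \<Rightarrow> nat"
  shows "\<exists>C>0. \<forall>x y. \<bar>tensor_bump n (x + y) - tensor_bump n x
     - (\<Sum>i\<in>UNIV. y $ i * partial_bump n i x)\<bar> \<le> C * (norm y)\<^sup>2"
proof -
  obtain L where L: "\<And>m. L m > 0" "\<And>m x y. \<bar>tensor_bump m (x + y) - tensor_bump m (x::real^'d)\<bar> \<le> L m * norm y"
    using tensor_bump_lipschitz by metis
  let ?C = "\<Sum>i\<in>UNIV. L (n(i := Suc (n i)))"
  let ?D = "\<lambda>i. partial_bump n i"
  have "\<bar>tensor_bump n (x + y) - tensor_bump n x - (\<Sum>i\<in>UNIV. y $ i * ?D i x)\<bar> \<le> ?C * (norm y)\<^sup>2" for x y :: "real^'d"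
  proof -
    let ?g = "\<lambda>w. tensor_bump n (x + w) - (\<Sum>i\<in>UNIV. w $ i * ?D i x)"
    have "norm (?g y - ?g 0) \<le> (?C * norm y) * norm (y - 0)"
    proof (rule differentiable_bound[of "cball 0 (norm y)" ?g])
      fix w :: "real^'d" assume w: "w \<in> cball 0 (norm y)"
      have "((\<lambda>w. tensor_bump n (x + w)) has_derivative (\<lambda>e. \<Sum>i\<in>UNIV. e $ i * ?D i (x + w))) (at w)"
      proof -
        have "((\<lambda>w. x + w) has_derivative (\<lambda>e. e)) (at w)"
          by (auto intro!: derivative_eq_intros)
        from has_derivative_compose[OF this, of "tensor_bump n", OF tensor_bump_has_derivative]
        show ?thesis .
      qed
      moreover have "((\<lambda>w. \<Sum>i\<in>UNIV. w $ i * ?D i x) has_derivative (\<lambda>e. \<Sum>i\<in>UNIV. e $ i * ?D i x)) (at w)"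
        by (intro has_derivative_sum has_derivative_mult_left bounded_linear_imp_has_derivative[OF bounded_linear_vec_nth])
      ultimately have "(?g has_derivative (\<lambda>e. (\<Sum>i\<in>UNIV. e $ i * ?D i (x + w)) - (\<Sum>i\<in>UNIV. e $ i * ?D i x))) (at w)"
        by (rule has_derivative_diff)
      then show "(?g has_derivative (\<lambda>e. (\<Sum>i\<in>UNIV. e $ i * ?D i (x + w)) - (\<Sum>i\<in>UNIV. e $ i * ?D i x)))
         (at w within cball 0 (norm y))" by (rule has_derivative_at_withinI)
      show "onorm (\<lambda>e. (\<Sum>i\<in>UNIV. e $ i * ?D i (x + w)) - (\<Sum>i\<in>UNIV. e $ i * ?D i x)) \<le> ?C * norm y"
      proof (rule onorm_bound)
        fix e :: "real^'d"
        have "\<bar>?D i (x + w) - ?D i x\<bar> \<le> L (n(i := Suc (n i))) * norm y" for i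
          by (rule order.trans[OF L(2)]) (use w L(1) in \<open>auto intro!: mult_left_mono simp: less_imp_le\<close>)
        then have "norm (\<Sum>i\<in>UNIV. e $ i * (?D i (x + w) - ?D i x)) \<le>
           (\<Sum>i\<in>UNIV. norm e * (L (n(i := Suc (n i))) * norm y))"
          by (intro order.trans[OF norm_sum] sum_mono)
             (auto intro!: mult_mono component_le_norm_cart simp: abs_mult)
        then show "norm ((\<Sum>i\<in>UNIV. e $ i * ?D i (x + w)) - (\<Sum>i\<in>UNIV. e $ i * ?D i x)) \<le> ?C * norm y * norm e"
          by (simp add: right_diff_distrib sum_subtractf sum_distrib_left sum_distrib_right mult_ac)
      qed (intro sum_nonneg mult_nonneg_nonneg norm_ge_zero less_imp_le L)
    qed auto
    then show ?thesis by (simp add: power2_eq_square mult_ac)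
  qed
  moreover have "?C > 0" by (rule sum_pos) (use L in auto)
  ultimately show ?thesis by blast
qed

lemma integrable_mult_tensor_bump:
  fixes u :: "real^'d \<Rightarrow> real"
  assumes "integrable lborel u"
  shows "integrable lborel (\<lambda>z. u z * tensor_bump n (c *\<^sub>R (a - z)))"
proof -
  obtain C where C: "\<And>x::real^'d. \<bar>tensor_bump n x\<bar> \<le> C" using tensor_bump_bounded by metis
  have "integrable lborel (\<lambda>z. C * u z)" using assms by simp
  then show ?thesis
  proof (rule Bochner_Integration.integrable_bound)
    show "(\<lambda>z. u z * tensor_bump n (c *\<^sub>R (a - z))) \<in> borel_measurable lborel"
      using assms by measurable
    show "AE z in lborel. norm (u z * tensor_bump n (c *\<^sub>R (a - z))) \<le> norm (C * u z)"
      using C order.trans[OF abs_ge_zero C[of 0]]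
      by (intro AE_I2) (auto simp: abs_mult mult.commute[of C] intro!: mult_left_mono)
  qed
qed

lemma convolution_tensor_bump_has_derivative:
  fixes u :: "real^'d \<Rightarrow> real"
  assumes u: "integrable lborel u"
  shows "((\<lambda>a. \<integral>z. u z * tensor_bump n (c *\<^sub>R (a - z)) \<partial>lborel) has_derivative
     (\<lambda>e. \<Sum>i\<in>UNIV. e $ i * (c * (\<integral>z. u z * partial_bump n i (c *\<^sub>R (a - z)) \<partial>lborel)))) (at a)"
proof -
  obtain C where C: "C > 0" "\<And>x y :: real^'d. \<bar>tensor_bump n (x + y) - tensor_bump n x
     - (\<Sum>i\<in>UNIV. y $ i * partial_bump n i x)\<bar> \<le> C * (norm y)\<^sup>2"
    using tensor_bump_taylor by blast
  define K where "K = (C * c\<^sup>2) * (\<integral>z. \<bar>u z\<bar> \<partial>lborel)"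
  let ?U = "\<lambda>n a. \<integral>z. u z * tensor_bump n (c *\<^sub>R (a - z)) \<partial>lborel"
  note int = integrable_mult_tensor_bump[OF u]
  have bd: "\<bar>?U n b - ?U n a - (\<Sum>i\<in>UNIV. (b - a) $ i * (c * ?U (n(i := Suc (n i))) a))\<bar> \<le> K * (norm (b - a))\<^sup>2" for b
  proof -
    have "?U n b - ?U n a - (\<Sum>i\<in>UNIV. (b - a) $ i * (c * ?U (n(i := Suc (n i))) a)) =
      (\<integral>z. u z * tensor_bump n (c *\<^sub>R (b - z)) - u z * tensor_bump n (c *\<^sub>R (a - z)) -
        (\<Sum>i\<in>UNIV. (b - a) $ i * (c * (u z * partial_bump n i (c *\<^sub>R (a - z))))) \<partial>lborel)"
      by (simp add: int)
    also have "\<bar>...\<bar> \<le> (\<integral>z. (C * (norm (c *\<^sub>R (b - a)))\<^sup>2) * \<bar>u z\<bar> \<partial>lborel)"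
      unfolding real_norm_def[symmetric]
    proof (rule order.trans[OF integral_norm_bound integral_mono])
      fix z
      let ?x = "c *\<^sub>R (a - z)" and ?y = "c *\<^sub>R (b - a)"
      have "c *\<^sub>R (b - z) = ?x + ?y" by (simp add: algebra_simps)
      moreover have "(\<Sum>i\<in>UNIV. (b - a) $ i * (c * (u z * partial_bump n i ?x))) =
          u z * (\<Sum>i\<in>UNIV. ?y $ i * partial_bump n i ?x)"
        unfolding sum_distrib_left
        by (intro sum.cong refl) (simp only: vector_scaleR_component real_scaleR_def mult_ac)
      ultimately have "u z * tensor_bump n (c *\<^sub>R (b - z)) - u z * tensor_bump n ?x -
        (\<Sum>i\<in>UNIV. (b - a) $ i * (c * (u z * partial_bump n i ?x))) =
        u z * (tensor_bump n (?x + ?y) - tensor_bump n ?x - (\<Sum>i\<in>UNIV. ?y $ i * partial_bump n i ?x))"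
        by (simp only: right_diff_distrib)
      then show "norm (u z * tensor_bump n (c *\<^sub>R (b - z)) - u z * tensor_bump n ?x -
        (\<Sum>i\<in>UNIV. (b - a) $ i * (c * (u z * partial_bump n i ?x)))) \<le> (C * (norm ?y)\<^sup>2) * norm (u z)"
        using C(2)[of ?x ?y] by (simp add: abs_mult mult.commute[of _ "\<bar>u z\<bar>"] mult_left_mono)
    qed (use u int in \<open>auto intro!: integrable_norm Bochner_Integration.integrable_diff Bochner_Integration.integrable_sum\<close>)
    also have "... = K * (norm (b - a))\<^sup>2" by (simp add: K_def power_mult_distrib)
    finally show ?thesis .
  qed
  show ?thesis
  proof (rule has_derivativeI_sandwich[of 1])
    show "bounded_linear (\<lambda>e. \<Sum>i\<in>UNIV. e $ i * (c * ?U (n(i := Suc (n i))) a))"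
      by (intro bounded_linear_sum bounded_linear_mult_const bounded_linear_vec_nth)
    show "((\<lambda>b. K * norm (b - a)) \<longlongrightarrow> 0) (at a)"
      by (rule tendsto_eq_intros refl)+ simp
    fix b assume "b \<noteq> a"
    then show "norm (?U n b - ?U n a - (\<Sum>i\<in>UNIV. (b - a) $ i * (c * ?U (n(i := Suc (n i))) a))) / norm (b - a)
       \<le> K * norm (b - a)"
      using bd[of b] by (simp add: divide_le_eq power2_eq_square mult_ac)
  qed auto
qed

definition count_index :: "'d list \<Rightarrow> 'd \<Rightarrow> nat" where
  "count_index is = (\<lambda>i. count_list is i)"

lemma count_index_Nil: "count_index [] = (\<lambda>i. 0)"
  by (simp add: count_index_def)

lemma count_index_Cons: "count_index (i # is) = (count_index is)(i := Suc (count_index is i))"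
  by (auto simp: count_index_def)

lemma reflected_tensor_bump_has_derivative:
  fixes a :: "real^'d"
  shows "((\<lambda>z. b * tensor_bump n (c *\<^sub>R (a - z))) has_derivative
     (\<lambda>e. b * (\<Sum>i\<in>UNIV. (- c * e $ i) * partial_bump n i (c *\<^sub>R (a - z))))) (at z)"
proof -
  have "((\<lambda>z. c *\<^sub>R (a - z)) has_derivative (\<lambda>e. - c *\<^sub>R e)) (at z)"
    by (auto intro!: derivative_eq_intros)
  from has_derivative_compose[OF this tensor_bump_has_derivative]
  have "((\<lambda>z. tensor_bump n (c *\<^sub>R (a - z))) has_derivative
     (\<lambda>e. (\<Sum>i\<in>UNIV. (- c * e $ i) * partial_bump n i (c *\<^sub>R (a - z))))) (at z)"
    by simp
  then show ?thesis by (rule has_derivative_mult_right)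
qed

lemma iter_partial_tensor_bump:
  fixes a :: "real^'d"
  shows "iter_partial is (\<lambda>z. b * tensor_bump (\<lambda>i. 0) (c *\<^sub>R (a - z))) =
    (\<lambda>z. (b * (- c) ^ length is) * tensor_bump (count_index is) (c *\<^sub>R (a - z)))"
proof (induction "is")
  case (Cons i "is")
  have "partial_deriv i (\<lambda>z. (b * (- c) ^ length is) * tensor_bump (count_index is) (c *\<^sub>R (a - z))) z =
     (b * (- c) ^ length (i # is)) * tensor_bump (count_index (i # is)) (c *\<^sub>R (a - z))" for z
  proof -
    have "partial_deriv i (\<lambda>z. (b * (- c) ^ length is) * tensor_bump (count_index is) (c *\<^sub>R (a - z))) z
      = (b * (- c) ^ length is) * (\<Sum>j\<in>UNIV. (- c * axis i 1 $ j) *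
          tensor_bump ((count_index is)(j := Suc (count_index is j))) (c *\<^sub>R (a - z)))"
      unfolding partial_deriv_def
      by (subst frechet_derivative_at[OF reflected_tensor_bump_has_derivative, symmetric]) (rule refl)
    also have "(\<Sum>j\<in>UNIV. (- c * axis i 1 $ j) *
          tensor_bump ((count_index is)(j := Suc (count_index is j))) (c *\<^sub>R (a - z)))
      = (\<Sum>j\<in>UNIV. if j = i then - c * tensor_bump (count_index (i # is)) (c *\<^sub>R (a - z)) else 0)"
      by (intro sum.cong) (auto simp: axis_def count_index_Cons)
    finally show ?thesis by simp
  qed
  with Cons show ?case by (simp add: iter_partial_def)
qed (simp add: iter_partial_def count_index_Nil)

lemma tensor_bump_test_function:
  fixes a :: "real^'d" and \<epsilon> :: real
  assumes "\<epsilon> > 0" "cball a (\<epsilon> * CARD('d)) \<subseteq> \<Omega>"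
  shows "(\<lambda>z. b * tensor_bump (\<lambda>i. 0) ((1 / \<epsilon>) *\<^sub>R (a - z))) \<in> test_functions \<Omega>"
proof -
  let ?S = "{z. b * tensor_bump (\<lambda>i. 0) ((1 / \<epsilon>) *\<^sub>R (a - z)) \<noteq> 0}"
  have sub: "?S \<subseteq> cball a (\<epsilon> * CARD('d))"
  proof
    fix z assume "z \<in> ?S"
    then have "norm ((1 / \<epsilon>) *\<^sub>R (a - z)) < CARD('d)"
      using tensor_bump_outside[of "(1 / \<epsilon>) *\<^sub>R (a - z)" "\<lambda>i. 0"] by force
    then show "z \<in> cball a (\<epsilon> * CARD('d))"
      using assms(1) by (simp add: dist_norm divide_simps mult.commute)
  qed
  then have "closure ?S \<subseteq> cball a (\<epsilon> * CARD('d))" by (simp add: closure_minimal)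
  moreover have "compact (closure ?S)"
    using sub bounded_subset[OF bounded_cball] by (simp add: compact_closure)
  moreover have "iter_partial is (\<lambda>z. b * tensor_bump (\<lambda>i. 0) ((1 / \<epsilon>) *\<^sub>R (a - z))) differentiable (at x)" for "is" x
    unfolding iter_partial_tensor_bump differentiable_def
    using reflected_tensor_bump_has_derivative by blast
  ultimately show ?thesis
    using assms(2) unfolding test_functions_def by blast
qed


abbreviation scaled_bump :: "real \<Rightarrow> real^'d \<Rightarrow> real" where
  "scaled_bump \<epsilon> z \<equiv> tensor_bump (\<lambda>i. 0) ((1 / \<epsilon>) *\<^sub>R z)"

text \<open>The derivative \<open>\<partial>\<^sub>i\<^sub>s\<close> of the convolution of \<open>u\<close> with the normalised bump of scale \<open>\<epsilon>\<close>, with all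
  derivatives moved to the bump.\<close>

definition mollified :: "real \<Rightarrow> (real^'d \<Rightarrow> real) \<Rightarrow> 'd list \<Rightarrow> real^'d \<Rightarrow> real" where
  "mollified \<epsilon> u is a =
     (1 / \<epsilon>) ^ length is / (\<integral>z. scaled_bump \<epsilon> (z::real^'d) \<partial>lborel) *
     (\<integral>z. u z * tensor_bump (count_index is) ((1 / \<epsilon>) *\<^sub>R (a - z)) \<partial>lborel)"

definition mollifier_measure :: "real \<Rightarrow> (real^'d) measure" where
  "mollifier_measure \<epsilon> = density lborel (\<lambda>z. ennreal (scaled_bump \<epsilon> z /
     (\<integral>z. scaled_bump \<epsilon> (z::real^'d) \<partial>lborel)))"

lemma mollified_has_derivative:
  fixes u :: "real^'d \<Rightarrow> real"
  assumes "integrable lborel u"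
  shows "(mollified \<epsilon> u is has_derivative (\<lambda>e. \<Sum>i\<in>UNIV. e $ i * mollified \<epsilon> u (i # is) a)) (at a)"
proof -
  let ?Z = "\<integral>z. scaled_bump \<epsilon> (z::real^'d) \<partial>lborel"
  have "((\<lambda>a. (1 / \<epsilon>) ^ length is / ?Z * (\<integral>z. u z * tensor_bump (count_index is) ((1 / \<epsilon>) *\<^sub>R (a - z)) \<partial>lborel))
     has_derivative (\<lambda>e. (1 / \<epsilon>) ^ length is / ?Z * (\<Sum>i\<in>UNIV. e $ i * (1 / \<epsilon> *
        (\<integral>z. u z * tensor_bump ((count_index is)(i := Suc (count_index is i))) ((1 / \<epsilon>) *\<^sub>R (a - z)) \<partial>lborel))))) (at a)"
    by (intro has_derivative_mult_right convolution_tensor_bump_has_derivative assms)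
  also have "(\<lambda>e. (1 / \<epsilon>) ^ length is / ?Z * (\<Sum>i\<in>UNIV. e $ i * (1 / \<epsilon> *
        (\<integral>z. u z * tensor_bump ((count_index is)(i := Suc (count_index is i))) ((1 / \<epsilon>) *\<^sub>R (a - z)) \<partial>lborel))))
     = (\<lambda>e. \<Sum>i\<in>UNIV. e $ i * mollified \<epsilon> u (i # is) a)"
    unfolding mollified_def sum_distrib_left count_index_Cons by (auto intro!: ext sum.cong simp: mult_ac)
  finally show ?thesis unfolding mollified_def[abs_def] .
qed

lemma tensor_bump_0_nonneg: "tensor_bump (\<lambda>i. 0) x \<ge> 0"
  by (auto simp: tensor_bump_def intro!: prod_nonneg bump_0_nonneg)

lemma integrable_scaled_tensor_bump:
  assumes "\<epsilon> > 0"
  shows "integrable lborel (\<lambda>z::real^'d. tensor_bump n ((1 / \<epsilon>) *\<^sub>R z))"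
proof -
  let ?K = "cball (0::real^'d) (\<epsilon> * CARD('d))"
  have "integrable lborel (\<lambda>z. indicator ?K z *\<^sub>R tensor_bump n ((1 / \<epsilon>) *\<^sub>R z))"
    by (rule borel_integrable_compact) (auto intro!: continuous_intros)
  moreover have "indicator ?K z *\<^sub>R tensor_bump n ((1 / \<epsilon>) *\<^sub>R z) = tensor_bump n ((1 / \<epsilon>) *\<^sub>R z)" for z
    using tensor_bump_outside[of "(1 / \<epsilon>) *\<^sub>R z" n] assms by (cases "z \<in> ?K") (auto simp: field_simps)
  ultimately show ?thesis by (simp only:)
qed

lemma integral_scaled_tensor_bump_pos:
  assumes "\<epsilon> > 0"
  shows "0 < (\<integral>z. scaled_bump \<epsilon> (z::real^'d) \<partial>lborel)"
proof -
  let ?f = "\<lambda>z::real^'d. scaled_bump \<epsilon> z"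
  have "(\<integral>z. ?f z \<partial>lborel) \<noteq> 0"
  proof
    assume "(\<integral>z. ?f z \<partial>lborel) = 0"
    then have "AE z in lborel. ?f z = 0"
      by (subst (asm) integral_nonneg_eq_0_iff_AE)
         (auto intro: integrable_scaled_tensor_bump assms tensor_bump_0_nonneg)
    moreover have "?f z \<noteq> 0" if "z \<in> ball 0 \<epsilon>" for z
    proof -
      have "\<bar>z $ i\<bar> < \<epsilon>" for i using that component_le_norm_cart[of z i] by simp
      then show ?thesis using assms
        by (auto simp: tensor_bump_def abs_mult less_imp_neq[OF bump_0_pos] dest!: sym[of _ 0])
    qed
    ultimately have "AE z in lborel. z \<notin> ball (0::real^'d) \<epsilon>" by force
    then have "emeasure lborel (ball (0::real^'d) \<epsilon>) = 0"
      by (subst (asm) AE_iff_measurable[of "ball 0 \<epsilon>"]) auto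
    moreover have "emeasure lborel (ball (0::real^'d) \<epsilon>) > 0"
      using assms by (simp add: emeasure_ball content_ball_pos)
    ultimately show False by simp
  qed
  moreover have "(\<integral>z. ?f z \<partial>lborel) \<ge> 0" by (intro Bochner_Integration.integral_nonneg tensor_bump_0_nonneg)
  ultimately show ?thesis by linarith
qed

lemma lborel_integral_reflect:
  fixes g :: "real^'d \<Rightarrow> real"
  assumes [measurable]: "g \<in> borel_measurable borel"
  shows "(\<integral>z. g (a - z) \<partial>lborel) = (\<integral>z. g z \<partial>lborel)"
proof -
  have "(lborel :: (real^'d) measure) = density (distr lborel borel (\<lambda>x. a + (- 1) *\<^sub>R x)) (\<lambda>_. 1)"
    using lborel_affine[of "-1" a] by simp
  then have "(\<integral>z. g z \<partial>lborel) = (\<integral>z. g z \<partial>distr lborel borel (\<lambda>x. a + (- 1) *\<^sub>R x))"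
    by (simp add: density_1)
  also have "... = (\<integral>z. g (a - z) \<partial>lborel)" by (subst integral_distr) auto
  finally show ?thesis by simp
qed

lemma prob_space_mollifier_measure:
  assumes "\<epsilon> > 0"
  shows "prob_space (mollifier_measure \<epsilon> :: (real^'d) measure)"
proof (rule prob_spaceI)
  let ?f = "\<lambda>z::real^'d. scaled_bump \<epsilon> z"
  let ?Z = "\<integral>z. ?f z \<partial>lborel"
  have "(\<integral>\<^sup>+z. ennreal (?f z / ?Z) \<partial>lborel) = ennreal (\<integral>z. ?f z / ?Z \<partial>lborel)"
    using integral_scaled_tensor_bump_pos[OF assms]
    by (intro nn_integral_eq_integral)
       (auto intro!: integrable_divide_zero integrable_scaled_tensor_bump assms divide_nonneg_pos tensor_bump_0_nonneg)
  also have "... = 1" using integral_scaled_tensor_bump_pos[where 'd='d, OF assms] by simp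
  finally show "emeasure (mollifier_measure \<epsilon> :: (real^'d) measure) (space (mollifier_measure \<epsilon>)) = 1"
    by (simp add: mollifier_measure_def emeasure_density)
qed

lemma sets_mollifier_measure [measurable_cong, simp]: "sets (mollifier_measure \<epsilon>) = sets borel"
  by (simp add: mollifier_measure_def)

lemma space_mollifier_measure [simp]: "space (mollifier_measure \<epsilon>) = UNIV"
  by (simp add: mollifier_measure_def)

lemma AE_mollifier_measure:
  assumes "\<epsilon> > 0"
  shows "AE z::real^'d in mollifier_measure \<epsilon>. norm z \<le> \<epsilon> * CARD('d)"
  unfolding mollifier_measure_def
proof (subst AE_density)
  show "AE z::real^'d in lborel. 0 < ennreal (scaled_bump \<epsilon> z /
     (\<integral>z. scaled_bump \<epsilon> (z::real^'d) \<partial>lborel)) \<longrightarrow> norm z \<le> \<epsilon> * CARD('d)"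
  proof (intro AE_I2 impI)
    fix z :: "real^'d"
    assume "0 < ennreal (scaled_bump \<epsilon> z /
      (\<integral>z. scaled_bump \<epsilon> (z::real^'d) \<partial>lborel))"
    then have "scaled_bump \<epsilon> z \<noteq> 0" by auto
    then have "norm ((1 / \<epsilon>) *\<^sub>R z) < CARD('d)"
      using tensor_bump_outside[of "(1 / \<epsilon>) *\<^sub>R z"] by force
    then show "norm z \<le> \<epsilon> * CARD('d)" using assms by (simp add: field_simps)
  qed
qed measurable

lemma integral_mollifier_measure:
  fixes v :: "real^'d \<Rightarrow> real"
  assumes "\<epsilon> > 0" and [measurable]: "v \<in> borel_measurable borel"
  shows "(\<integral>z. v z * scaled_bump \<epsilon> (a - z) \<partial>lborel)
    / (\<integral>z. scaled_bump \<epsilon> (z::real^'d) \<partial>lborel)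
    = (\<integral>z. v (a - z) \<partial>mollifier_measure \<epsilon>)"
proof -
  let ?f = "\<lambda>z::real^'d. scaled_bump \<epsilon> z"
  let ?Z = "\<integral>z. ?f z \<partial>lborel"
  have "(\<integral>z. v (a - z) \<partial>mollifier_measure \<epsilon>) = (\<integral>z. ?f z / ?Z * v (a - z) \<partial>lborel)"
    unfolding mollifier_measure_def
    using integral_scaled_tensor_bump_pos[OF assms(1)]
    by (subst integral_density) (auto intro!: divide_nonneg_pos tensor_bump_0_nonneg)
  also have "... = (\<integral>z. (\<lambda>y. ?f (a - y) / ?Z * v y) (a - z) \<partial>lborel)" by simp
  also have "... = (\<integral>y. ?f (a - y) / ?Z * v y \<partial>lborel)"
    by (rule lborel_integral_reflect) measurable
  also have "... = (\<integral>y. (v y * ?f (a - y)) / ?Z \<partial>lborel)" by (simp add: mult.commute)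
  finally show ?thesis by simp
qed

lemma integrable_mollifier_measure:
  fixes v :: "real^'d \<Rightarrow> real"
  assumes "\<epsilon> > 0" "integrable lborel v"
  shows "integrable (mollifier_measure \<epsilon>) (\<lambda>z. v (a - z))"
proof -
  let ?f = "\<lambda>z::real^'d. scaled_bump \<epsilon> z"
  let ?Z = "\<integral>z. ?f z \<partial>lborel"
  have [measurable]: "v \<in> borel_measurable borel" using assms(2) by auto
  have "integrable lborel (\<lambda>z. v z * ?f (a - z) / ?Z)"
    by (intro integrable_divide_zero integrable_mult_tensor_bump assms)
  then have "integrable (density (distr lborel borel (\<lambda>x. a + (- 1) *\<^sub>R x)) (\<lambda>_. 1)) (\<lambda>z. v z * ?f (a - z) / ?Z)"
    using lborel_affine[of "-1" a] by simp
  then have "integrable lborel (\<lambda>z. v (a - z) * ?f z / ?Z)"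
    by (simp add: density_1 integrable_distr_eq)
  then show ?thesis unfolding mollifier_measure_def
    using integral_scaled_tensor_bump_pos[OF assms(1)]
    by (subst integrable_density) (auto intro!: divide_nonneg_pos tensor_bump_0_nonneg simp: mult.commute)
qed

lemma integral_vol_on:
  fixes g :: "real^'d \<Rightarrow> real"
  assumes "open \<Omega>"
  shows "(\<integral>z. g z \<partial>vol_on \<Omega>) = (\<integral>z. indicator \<Omega> z * g z \<partial>lborel)"
  using assms by (subst integral_restrict_space) auto

text \<open>Where the mollifier fits into \<open>\<Omega>\<close> it is a test function up to reflection, so the definition of the weak
  derivative moves the derivatives from the bump to \<open>u\<close>. The signs \<open>(-1)\<^bsup>|is|\<^esup>\<close> from the reflection and from
  the integration by parts cancel.\<close>

lemma mollified_weak_deriv: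
  fixes u v :: "real^'d \<Rightarrow> real" and \<epsilon> :: real
  assumes "open \<Omega>" "\<epsilon> > 0" "cball a (\<epsilon> * CARD('d)) \<subseteq> \<Omega>" "has_weak_deriv \<Omega> is u v"
    and [measurable]: "(\<lambda>z. indicator \<Omega> z * v z) \<in> borel_measurable borel"
  shows "mollified \<epsilon> (\<lambda>z. indicator \<Omega> z * u z) is a = (\<integral>z. indicator \<Omega> (a - z) * v (a - z) \<partial>mollifier_measure \<epsilon>)"
proof -
  let ?\<phi> = "\<lambda>z. 1 * scaled_bump \<epsilon> (a - z)"
  let ?Z = "\<integral>z. scaled_bump \<epsilon> (z::real^'d) \<partial>lborel"
  have "integral\<^sup>L (vol_on \<Omega>) (\<lambda>x. u x * iter_partial is ?\<phi> x) =
        (-1) ^ length is * integral\<^sup>L (vol_on \<Omega>) (\<lambda>x. v x * ?\<phi> x)"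
    using assms(4) tensor_bump_test_function[OF assms(2,3), of 1] unfolding has_weak_deriv_def by blast
  then have "(\<integral>z. indicator \<Omega> z * (u z * ((1 * (- (1 / \<epsilon>)) ^ length is) * tensor_bump (count_index is) ((1 / \<epsilon>) *\<^sub>R (a - z)))) \<partial>lborel)
     = (-1) ^ length is * (\<integral>z. indicator \<Omega> z * (v z * ?\<phi> z) \<partial>lborel)"
    by (simp only: integral_vol_on[OF assms(1)] iter_partial_tensor_bump)
  moreover have "(\<lambda>z. indicator \<Omega> z * (u z * ((1 * (- (1 / \<epsilon>)) ^ length is) * tensor_bump (count_index is) ((1 / \<epsilon>) *\<^sub>R (a - z)))))
     = (\<lambda>z. ((-1) ^ length is * (1 / \<epsilon>) ^ length is) * (indicator \<Omega> z * u z * tensor_bump (count_index is) ((1 / \<epsilon>) *\<^sub>R (a - z))))"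
    unfolding power_minus[of "1 / \<epsilon>" "length is"] by (simp only: mult_1_left mult_ac)
  ultimately have "(-1) ^ length is * ((1 / \<epsilon>) ^ length is * (\<integral>z. (indicator \<Omega> z * u z * tensor_bump (count_index is) ((1 / \<epsilon>) *\<^sub>R (a - z))) \<partial>lborel))
     = (-1) ^ length is * (\<integral>z. indicator \<Omega> z * (v z * ?\<phi> z) \<partial>lborel)"
    by (simp only: integral_mult_right_zero mult.assoc)
  then have "(1 / \<epsilon>) ^ length is * (\<integral>z. (indicator \<Omega> z * u z * tensor_bump (count_index is) ((1 / \<epsilon>) *\<^sub>R (a - z))) \<partial>lborel)
     = (\<integral>z. (indicator \<Omega> z * v z) * scaled_bump \<epsilon> (a - z) \<partial>lborel)"
    by (simp add: mult.assoc)
  then have "mollified \<epsilon> (\<lambda>z. indicator \<Omega> z * u z) is a =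
     (\<integral>z. (indicator \<Omega> z * v z) * scaled_bump \<epsilon> (a - z) \<partial>lborel) / ?Z"
    unfolding mollified_def times_divide_eq_left by (rule arg_cong)
  also have "... = (\<integral>z. indicator \<Omega> (a - z) * v (a - z) \<partial>mollifier_measure \<epsilon>)"
    using integral_mollifier_measure[OF assms(2,5)] .
  finally show ?thesis .
qed

section \<open>Averaged Taylor polynomials\<close>

text \<open>A smooth function \<open>f []\<close> together with its partial derivatives of all orders, indexed by lists of
  coordinates.\<close>

definition jet :: "('d::finite list \<Rightarrow> real^'d \<Rightarrow> real) \<Rightarrow> bool" where
  "jet f \<longleftrightarrow> (\<forall>is a. (f is has_derivative (\<lambda>e. \<Sum>i\<in>UNIV. e $ i * f (i # is) a)) (at a))"

definition monomial :: "'d list \<Rightarrow> real^'d \<Rightarrow> real" where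
  "monomial is e = (\<Prod>i\<leftarrow>is. e $ i)"

text \<open>The \<open>m\<close>-th derivative at \<open>a\<close> in the direction \<open>e\<close>.\<close>

definition dir_deriv :: "('d::finite list \<Rightarrow> real^'d \<Rightarrow> real) \<Rightarrow> nat \<Rightarrow> real^'d \<Rightarrow> real^'d \<Rightarrow> real" where
  "dir_deriv f m e a = (\<Sum>is | length is = m. monomial is e * f is a)"

lemma finite_lists_of_length [simp]: "finite {is :: 'd::finite list. length is = m}"
  using finite_lists_length_eq[of "UNIV :: 'd set" m] by simp

lemma finite_lists_of_length_le [simp]: "finite {is :: 'd::finite list. length is \<le> m}"
  using finite_lists_length_le[of "UNIV :: 'd set" m] by simp

lemma sum_lists_Suc:
  "(\<Sum>is | length is = Suc m. g is) = (\<Sum>is | length is = m. \<Sum>i\<in>(UNIV::'d::finite set). g (i # is))"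
proof -
  have "{is :: 'd list. length is = Suc m} = (\<lambda>(is, i). i # is) ` ({is. length is = m} \<times> UNIV)"
    by (auto simp: length_Suc_conv image_iff)
  then have "(\<Sum>is | length is = Suc m. g is) = (\<Sum>(is, i)\<in>{is. length is = m} \<times> (UNIV :: 'd set). g (i # is))"
    by (simp add: sum.reindex inj_on_def split_def)
  then show ?thesis by (simp add: sum.cartesian_product)
qed

lemma continuous_on_monomial [continuous_intros]:
  "continuous_on S g \<Longrightarrow> continuous_on S (\<lambda>x. monomial is (g x))"
  by (induction "is") (auto simp: monomial_def intro!: continuous_intros)

lemma abs_monomial_le:
  assumes "norm e \<le> Q" shows "\<bar>monomial is e\<bar> \<le> Q ^ length is"
proof (induction "is")
  case (Cons i "is")
  have "\<bar>e $ i\<bar> \<le> Q" using component_le_norm_cart[of e i] assms by linarith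
  then show ?case
    using Cons by (auto simp: monomial_def abs_mult intro!: mult_mono)
qed (simp add: monomial_def)

lemma jet_continuous_on:
  assumes "jet f" "continuous_on S g" shows "continuous_on S (\<lambda>x. f is (g x))"
proof (rule continuous_on_compose2[of UNIV "f is"])
  have "f is differentiable (at a)" for a using assms(1) unfolding jet_def differentiable_def by blast
  then show "continuous_on UNIV (f is)"
    by (intro continuous_at_imp_continuous_on) (auto intro: differentiable_imp_continuous_within)
qed (use assms in auto)

lemma dir_deriv_has_derivative:
  assumes "jet f"
  shows "((\<lambda>r. dir_deriv f m e (x + r *\<^sub>R e)) has_real_derivative dir_deriv f (Suc m) e (x + r *\<^sub>R e)) (at r)"
proof -
  have 1: "((\<lambda>r. f is (x + r *\<^sub>R e)) has_real_derivative (\<Sum>i\<in>UNIV. e $ i * f (i # is) (x + r *\<^sub>R e))) (at r)" for "is"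
  proof -
    have "((\<lambda>r. x + r *\<^sub>R e) has_derivative (\<lambda>h. h *\<^sub>R e)) (at r)"
      by (auto intro!: derivative_eq_intros)
    from has_derivative_compose[OF this, of "f is", OF assms[unfolded jet_def, rule_format]]
    have "((\<lambda>r. f is (x + r *\<^sub>R e)) has_derivative (\<lambda>h. \<Sum>i\<in>UNIV. (h *\<^sub>R e) $ i * f (i # is) (x + r *\<^sub>R e))) (at r)" .
    also have "(\<lambda>h. \<Sum>i\<in>UNIV. (h *\<^sub>R e) $ i * f (i # is) (x + r *\<^sub>R e)) =
      (*) (\<Sum>i\<in>UNIV. e $ i * f (i # is) (x + r *\<^sub>R e))"
      by (auto simp: sum_distrib_right sum_distrib_left mult_ac)
    finally show ?thesis by (simp add: has_field_derivative_def)
  qed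
  have "dir_deriv f (Suc m) e a = (\<Sum>is | length is = m. monomial is e * (\<Sum>i\<in>UNIV. e $ i * f (i # is) a))" for a
    unfolding dir_deriv_def sum_lists_Suc by (simp add: monomial_def sum_distrib_left mult_ac)
  then show ?thesis
    unfolding dir_deriv_def[of f m] by (auto intro!: DERIV_sum DERIV_cmult 1)
qed

text \<open>The derivative telescopes: only the term of top order survives.\<close>

lemma taylor_sum_has_derivative:
  assumes "\<And>m r. (g m has_real_derivative g (Suc m) r) (at r)"
  shows "((\<lambda>r. \<Sum>m<Suc k. (- r) ^ m / fact m * g m r) has_real_derivative (- r) ^ k / fact k * g (Suc k) r) (at r)"
proof (induction k)
  case 0
  then show ?case using assms[of 0 r] by simp
next
  case (Suc k)
  have "((\<lambda>r. (- r) ^ Suc k / fact (Suc k)) has_real_derivative (- ((- r) ^ k / fact k))) (at r)"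
    by (rule derivative_eq_intros refl | simp)+ (simp add: field_simps del: fact_Suc, simp add: field_simps)?
  from DERIV_add[OF Suc DERIV_mult[OF this assms[of "Suc k" r]]]
  show ?case by (simp add: algebra_simps)
qed

text \<open>\<open>T r\<close> is the Taylor polynomial at \<open>r\<close> evaluated at \<open>0\<close>. Its change from \<open>t/2\<close> to \<open>t\<close> is the integral of the
  derivative of order \<open>k\<close> against \<open>(- r)\<^bsup>k - 1\<^esup> / (k - 1)!\<close>, plus the change of the term of order \<open>k\<close>. Both
  together vanish for polynomials of degree \<open>k\<close>, so that a constant \<open>c\<close> can be subtracted from \<open>g k\<close>.
  For \<open>k = 0\<close> only the second part is present, and the integral is an additional nonnegative term.\<close>

lemma taylor_step:
  fixes g :: "nat \<Rightarrow> real \<Rightarrow> real" and k :: nat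
  assumes g: "\<And>m r. (g m has_real_derivative g (Suc m) r) (at r)" and t: "0 < t" "t \<le> 1"
  defines "T \<equiv> (\<lambda>r. \<Sum>m\<le>k. (- r) ^ m / fact m * g m r)"
  shows "ennreal \<bar>T t - T (t/2)\<bar> \<le> ennreal (t ^ k) * (ennreal \<bar>g k t - c\<bar> + ennreal \<bar>g k (t/2) - c\<bar>)
     + ennreal (t ^ (k - 1)) * (\<integral>\<^sup>+r. indicator {t/2..t} r * ennreal \<bar>g k r - c\<bar> \<partial>lborel)"
proof -
  let ?J = "ennreal (t ^ (k - 1)) * (\<integral>\<^sup>+r. indicator {t/2..t} r * ennreal \<bar>g k r - c\<bar> \<partial>lborel)"
  \<comment> \<open>The Taylor value with its term of order \<open>k\<close> replaced by that of the constant \<open>c\<close>.\<close>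
  define D where "D = (\<lambda>r. (\<Sum>m<k. (- r) ^ m / fact m * g m r) + c * ((- r) ^ k / fact k))"
  have TD: "T r = D r + (- r) ^ k / fact k * (g k r - c)" for r
    by (simp add: T_def D_def lessThan_Suc_atMost[symmetric] algebra_simps diff_divide_distrib)
  have cont: "continuous_on S (g m)" for S m
    using g by (intro DERIV_continuous_on) (auto intro: has_field_derivative_at_within)
  have Dbd: "ennreal \<bar>D t - D (t/2)\<bar> \<le> ?J"
  proof (cases k)
    case 0
    then show ?thesis by (simp add: D_def)
  next
    case (Suc k')
    let ?D' = "\<lambda>r. (- r) ^ k' / fact k' * (g k r - c)"
    have "((\<lambda>r. (- r) ^ Suc k' / fact (Suc k')) has_real_derivative (- ((- r) ^ k' / fact k'))) (at r)" for r :: real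
      by (rule derivative_eq_intros refl | simp)+ (simp add: field_simps del: fact_Suc, simp add: field_simps)?
    note DERIV_add[OF taylor_sum_has_derivative[where g = g and k = k', OF g] DERIV_cmult[OF this, of c]]
    then have D': "(D has_real_derivative ?D' r) (at r)" for r
      unfolding D_def Suc by (rule DERIV_cong) (simp add: right_diff_distrib)
    have ftc: "(\<integral>r. indicator {t/2..t} r *\<^sub>R ?D' r \<partial>lborel) = D t - D (t/2)"
    proof (rule integral_FTC_atLeastAtMost)
      show "(D has_vector_derivative ?D' r) (at r within {t/2..t})" for r
        using D' by (auto simp: has_real_derivative_iff_has_vector_derivative[symmetric] intro: has_field_derivative_at_within)
      show "continuous_on {t/2..t} ?D'" by (intro continuous_intros cont) simp
    qed (use t in auto)
    have int: "integrable lborel (\<lambda>r. indicator {t/2..t} r *\<^sub>R ?D' r)"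
      by (rule borel_integrable_compact) (auto intro!: continuous_intros cont)
    have "ennreal \<bar>D t - D (t/2)\<bar> = ennreal (norm (\<integral>r. indicator {t/2..t} r *\<^sub>R ?D' r \<partial>lborel))"
      by (simp only: ftc real_norm_def)
    also have "... \<le> (\<integral>\<^sup>+r. ennreal (norm (indicator {t/2..t} r *\<^sub>R ?D' r)) \<partial>lborel)"
      by (rule integral_norm_bound_ennreal[OF int])
    also have "... \<le> (\<integral>\<^sup>+r. ennreal (t ^ (k - 1)) * (indicator {t/2..t} r * ennreal \<bar>g k r - c\<bar>) \<partial>lborel)"
    proof (intro nn_integral_mono)
      fix r :: real
      show "ennreal (norm (indicator {t/2..t} r *\<^sub>R ?D' r)) \<le>
        ennreal (t ^ (k - 1)) * (indicator {t/2..t} r * ennreal \<bar>g k r - c\<bar>)"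
      proof (cases "r \<in> {t/2..t}")
        case True
        have "\<bar>(- r) ^ k' / fact k'\<bar> = r ^ k' / fact k'" using True t by (simp add: power_abs abs_divide)
        also have "... \<le> t ^ k' / 1" using True t by (intro frac_le power_mono) (auto simp: fact_ge_1)
        finally have "\<bar>?D' r\<bar> \<le> t ^ k' * \<bar>g k r - c\<bar>" unfolding abs_mult by (intro mult_right_mono) auto
        then show ?thesis using True t Suc by (simp add: ennreal_mult'[symmetric] ennreal_leI)
      qed simp
    qed
    also have "... = ?J"
    proof (rule nn_integral_cmult)
      have "g k \<in> borel_measurable borel" by (intro borel_measurable_continuous_onI cont)
      then show "(\<lambda>r. indicator {t/2..t} r * ennreal \<bar>g k r - c\<bar>) \<in> borel_measurable lborel" by measurable
    qed
    finally show ?thesis .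
  qed
  have top: "\<bar>(- r) ^ k / fact k * (g k r - c)\<bar> \<le> t ^ k * \<bar>g k r - c\<bar>" if "0 \<le> r" "r \<le> t" for r
  proof -
    have "\<bar>(- r) ^ k / fact k\<bar> = r ^ k / fact k" using that by (simp add: power_abs abs_divide)
    also have "... \<le> t ^ k / 1" using that by (intro frac_le power_mono) (auto simp: fact_ge_1)
    finally show ?thesis unfolding abs_mult by (intro mult_right_mono) auto
  qed
  have "\<bar>T t - T (t/2)\<bar> \<le> \<bar>D t - D (t/2)\<bar> + t ^ k * (\<bar>g k t - c\<bar> + \<bar>g k (t/2) - c\<bar>)"
    using top[of t] top[of "t/2"] t unfolding TD distrib_left by linarith
  then have "ennreal \<bar>T t - T (t/2)\<bar> \<le> ennreal \<bar>D t - D (t/2)\<bar> + ennreal (t ^ k) * (ennreal \<bar>g k t - c\<bar> + ennreal \<bar>g k (t/2) - c\<bar>)"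
    using t by (simp add: ennreal_plus[symmetric] ennreal_mult'[symmetric] ennreal_leI del: ennreal_plus)
  also have "... \<le> ?J
     + ennreal (t ^ k) * (ennreal \<bar>g k t - c\<bar> + ennreal \<bar>g k (t/2) - c\<bar>)"
    by (intro add_right_mono Dbd)
  finally show ?thesis by (simp add: add.commute)
qed


text \<open>The Taylor polynomial of degree \<open>k\<close> at the point \<open>x + r (z - x)\<close>, evaluated at \<open>x\<close>.\<close>

definition taylor_at :: "('d::finite list \<Rightarrow> real^'d \<Rightarrow> real) \<Rightarrow> nat \<Rightarrow> real^'d \<Rightarrow> real^'d \<Rightarrow> real \<Rightarrow> real" where
  "taylor_at f k x z r = (\<Sum>m\<le>k. (- r) ^ m / fact m * dir_deriv f m (z - x) (x + r *\<^sub>R (z - x)))"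

lemma continuous_on_taylor_at:
  assumes "jet f" "continuous_on S X" "continuous_on S Z" "continuous_on S R"
  shows "continuous_on S (\<lambda>w. taylor_at f k (X w) (Z w) (R w))"
  unfolding taylor_at_def dir_deriv_def
  by (intro continuous_intros jet_continuous_on[OF assms(1)] assms) auto

lemma taylor_at_0: "taylor_at f k x z 0 = f [] x"
proof -
  have "{is :: 'd list. length is = 0} = {[]}" by auto
  then have "dir_deriv f 0 (z - x) x = f [] x" by (simp add: dir_deriv_def monomial_def)
  moreover have "taylor_at f k x z 0 = (\<Sum>m\<le>k. if m = 0 then dir_deriv f 0 (z - x) x else 0)"
    unfolding taylor_at_def by (intro sum.cong) auto
  ultimately show ?thesis by simp
qed

lemma integrable_continuous_compact_support:
  fixes h :: "'a::euclidean_space \<Rightarrow> real"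
  assumes "prob_space \<nu>" and [measurable_cong]: "sets \<nu> = sets borel"
    and "compact K" "AE z in \<nu>. z \<in> K" "continuous_on UNIV h"
  shows "integrable \<nu> h"
proof -
  interpret prob_space \<nu> by fact
  have "bounded (h ` K)"
    by (intro compact_imp_bounded compact_continuous_image continuous_on_subset[OF assms(5)] assms) auto
  then obtain C where C: "\<And>z. z \<in> K \<Longrightarrow> norm (h z) \<le> C" unfolding bounded_iff by blast
  have [measurable]: "h \<in> borel_measurable borel" by (rule borel_measurable_continuous_onI) fact
  show ?thesis
    by (rule integrable_const_bound[of _ C]) (use assms(4) C in \<open>auto elim!: eventually_mono\<close>)
qed

text \<open>\<open>taylor_step\<close> on the segment from \<open>x\<close> to each \<open>z\<close>, averaged over \<open>z\<close>. After exchanging the order of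
  integration, all that is needed is that for each fixed \<open>r \<in> [t/2, t]\<close> the derivatives of order \<open>k\<close> are on
  average close to constants.\<close>

lemma taylor_at_step:
  fixes f :: "'d::finite list \<Rightarrow> real^'d \<Rightarrow> real" and E Q t :: real
  assumes "jet f" "prob_space \<nu>" and sets[measurable_cong]: "sets \<nu> = sets borel"
    and K: "compact K" "AE z in \<nu>. z \<in> K" and Q: "\<And>z. z \<in> K \<Longrightarrow> norm (z - x) \<le> Q"
    and t: "0 < t" "t \<le> 1"
    and E: "\<And>is r. length is = k \<Longrightarrow> t/2 \<le> r \<Longrightarrow> r \<le> t \<Longrightarrow>
       (\<integral>\<^sup>+z. ennreal \<bar>f is (x + r *\<^sub>R (z - x)) - c is\<bar> \<partial>\<nu>) \<le> ennreal E"
    and E0: "E \<ge> 0" and Q0: "Q \<ge> 0"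
  shows "\<bar>(\<integral>z. taylor_at f k x z t \<partial>\<nu>) - (\<integral>z. taylor_at f k x z (t/2) \<partial>\<nu>)\<bar>
     \<le> 3 * real (card {is :: 'd list. length is = k}) * Q ^ k * E * t ^ k"
proof -
  interpret prob_space \<nu> by fact
  interpret pair_sigma_finite lborel \<nu> ..
  have fm[measurable]: "f is \<in> borel_measurable borel" for "is"
    using jet_continuous_on[OF assms(1) continuous_on_id, of UNIV "is"] by (intro borel_measurable_continuous_onI) simp
  let ?N = "real (card {is :: 'd list. length is = k})"
  let ?g = "\<lambda>z m r. dir_deriv f m (z - x) (x + r *\<^sub>R (z - x))"
  let ?c = "\<lambda>z. \<Sum>is | length is = k. monomial is (z - x) * c is"
  have gm0: "(\<lambda>p. ?g (snd p) k (fst p)) \<in> borel_measurable borel"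
    unfolding dir_deriv_def
    by (intro borel_measurable_continuous_onI continuous_intros jet_continuous_on[OF assms(1)])
  have gm[measurable]: "(\<lambda>p. ?g (snd p) k (fst p)) \<in> borel_measurable (lborel \<Otimes>\<^sub>M \<nu>)"
  proof -
    have "sets (lborel \<Otimes>\<^sub>M \<nu>) = sets (borel \<Otimes>\<^sub>M (borel :: (real^'d) measure))"
      by (intro sets_pair_measure_cong sets) auto
    then have eq: "sets (lborel \<Otimes>\<^sub>M \<nu>) = sets (borel :: (real \<times> (real^'d)) measure)" by (simp only: borel_prod)
    show ?thesis unfolding measurable_cong_sets[OF eq refl] by (rule gm0)
  qed
  have gm2[measurable]: "(\<lambda>z. ?g z k r) \<in> borel_measurable \<nu>" for r
    unfolding dir_deriv_def measurable_cong_sets[OF sets refl]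
    by (intro borel_measurable_continuous_onI continuous_intros jet_continuous_on[OF assms(1)])
  have cm[measurable]: "?c \<in> borel_measurable \<nu>"
    unfolding measurable_cong_sets[OF sets refl]
    by (intro borel_measurable_continuous_onI continuous_intros)
  have gm'[measurable]: "(\<lambda>p. ?g (fst p) k (snd p)) \<in> borel_measurable (\<nu> \<Otimes>\<^sub>M lborel)"
    using measurable_compose[OF measurable_pair_swap' gm] by (simp add: split_beta')
  have inner[measurable]: "(\<lambda>z. \<integral>\<^sup>+r. indicator {t/2..t} r * ennreal \<bar>?g z k r - ?c z\<bar> \<partial>lborel) \<in> borel_measurable \<nu>"
    by (rule lborel.borel_measurable_nn_integral) (simp add: split_beta', measurable)
  let ?e = "\<lambda>z r. ennreal \<bar>?g z k r - ?c z\<bar>"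
  define G where "G = (\<lambda>r. \<integral>\<^sup>+z. ?e z r \<partial>\<nu>)"
  have G: "G r \<le> ennreal (?N * Q ^ k * E)" if "t/2 \<le> r" "r \<le> t" for r
  proof -
    have "G r \<le> (\<integral>\<^sup>+z. (\<Sum>is | length is = k. ennreal (Q ^ k) * ennreal \<bar>f is (x + r *\<^sub>R (z - x)) - c is\<bar>) \<partial>\<nu>)"
      unfolding G_def
    proof (rule nn_integral_mono_AE, use K(2) in eventually_elim)
      fix z assume z: "z \<in> K"
      have "?g z k r - ?c z = (\<Sum>is | length is = k. monomial is (z - x) * (f is (x + r *\<^sub>R (z - x)) - c is))"
        by (simp add: dir_deriv_def right_diff_distrib sum_subtractf)
      also have "\<bar>...\<bar> \<le> (\<Sum>is | length is = k. Q ^ k * \<bar>f is (x + r *\<^sub>R (z - x)) - c is\<bar>)"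
        by (rule order.trans[OF sum_abs])
           (auto simp: abs_mult intro!: sum_mono mult_right_mono abs_monomial_le[OF Q[OF z]])
      finally show "?e z r \<le> (\<Sum>is | length is = k. ennreal (Q ^ k) * ennreal \<bar>f is (x + r *\<^sub>R (z - x)) - c is\<bar>)"
        using Q0 by (simp add: ennreal_mult'[symmetric] ennreal_leI)
    qed
    also have "... = (\<Sum>is | length is = k. ennreal (Q ^ k) * (\<integral>\<^sup>+z. ennreal \<bar>f is (x + r *\<^sub>R (z - x)) - c is\<bar> \<partial>\<nu>))"
      by (subst nn_integral_sum) (auto intro!: sum.cong nn_integral_cmult)
    also have "... \<le> (\<Sum>is\<in>{is :: 'd list. length is = k}. ennreal (Q ^ k) * ennreal E)"
      by (intro sum_mono mult_left_mono E that) auto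
    also have "... = ennreal (?N * Q ^ k * E)"
      using E0 Q0 by (simp add: ennreal_mult ennreal_of_nat_eq_real_of_nat mult.assoc)
    finally show ?thesis .
  qed
  have int: "integrable \<nu> (\<lambda>z. taylor_at f k x z r)" for r
    by (intro integrable_continuous_compact_support[OF assms(2) sets K] continuous_on_taylor_at assms(1) continuous_intros)
  have "ennreal \<bar>(\<integral>z. taylor_at f k x z t \<partial>\<nu>) - (\<integral>z. taylor_at f k x z (t/2) \<partial>\<nu>)\<bar>
     = ennreal (norm (\<integral>z. taylor_at f k x z t - taylor_at f k x z (t/2) \<partial>\<nu>))"
    by (simp add: int)
  also have "... \<le> (\<integral>\<^sup>+z. ennreal (norm (taylor_at f k x z t - taylor_at f k x z (t/2))) \<partial>\<nu>)"
    by (rule integral_norm_bound_ennreal) (simp add: int)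
  also have "... \<le> (\<integral>\<^sup>+z. ennreal (t ^ k) * (?e z t + ?e z (t/2))
     + ennreal (t ^ (k - 1)) * (\<integral>\<^sup>+r. indicator {t/2..t} r * ?e z r \<partial>lborel) \<partial>\<nu>)"
    unfolding taylor_at_def real_norm_def
    by (intro nn_integral_mono taylor_step[of "\<lambda>m r. dir_deriv f m (_ - x) (x + r *\<^sub>R (_ - x))"]
          dir_deriv_has_derivative assms(1) t)
  also have "... = ennreal (t ^ k) * (G t + G (t/2))
     + ennreal (t ^ (k - 1)) * (\<integral>\<^sup>+z. (\<integral>\<^sup>+r. indicator {t/2..t} r * ?e z r \<partial>lborel) \<partial>\<nu>)"
    unfolding G_def using inner gm2 cm by (subst nn_integral_add, measurable) (simp add: nn_integral_add nn_integral_cmult)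
  also have "(\<integral>\<^sup>+z. (\<integral>\<^sup>+r. indicator {t/2..t} r * ?e z r \<partial>lborel) \<partial>\<nu>)
     = (\<integral>\<^sup>+r. (\<integral>\<^sup>+z. indicator {t/2..t} r * ?e z r \<partial>\<nu>) \<partial>lborel)"
    by (rule Fubini'[of "\<lambda>r z. indicator {t/2..t} r * ?e z r"]) (simp add: split_beta')
  also have "... = (\<integral>\<^sup>+r. indicator {t/2..t} r * G r \<partial>lborel)"
    unfolding G_def by (simp add: nn_integral_cmult)
  also have "... \<le> (\<integral>\<^sup>+r. ennreal (?N * Q ^ k * E) * indicator {t/2..t} r \<partial>lborel)"
    by (intro nn_integral_mono) (auto simp: indicator_def intro: G)
  also have "... = ennreal (?N * Q ^ k * E) * ennreal (t/2)"
    using t by (simp add: nn_integral_cmult_indicator)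
  finally have "ennreal \<bar>(\<integral>z. taylor_at f k x z t \<partial>\<nu>) - (\<integral>z. taylor_at f k x z (t/2) \<partial>\<nu>)\<bar>
     \<le> ennreal (t ^ k) * (G t + G (t/2)) + ennreal (t ^ (k - 1)) * (ennreal (?N * Q ^ k * E) * ennreal (t/2))"
    by (simp add: add_left_mono mult_left_mono)
  also have "... \<le> ennreal (t ^ k) * (ennreal (?N * Q ^ k * E) + ennreal (?N * Q ^ k * E))
      + ennreal (t ^ (k - 1)) * (ennreal (?N * Q ^ k * E) * ennreal (t/2))"
    using t by (intro add_right_mono mult_left_mono add_mono G) auto
  also have "... = ennreal (t ^ k * (2 * (?N * Q ^ k * E)) + t ^ (k - 1) * (t/2) * (?N * Q ^ k * E))"
    using t E0 Q0 by (simp add: ennreal_plus[symmetric] ennreal_mult'[symmetric] mult_ac del: ennreal_plus)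
  finally have "\<bar>(\<integral>z. taylor_at f k x z t \<partial>\<nu>) - (\<integral>z. taylor_at f k x z (t/2) \<partial>\<nu>)\<bar>
     \<le> t ^ k * (2 * (?N * Q ^ k * E)) + t ^ (k - 1) * (t/2) * (?N * Q ^ k * E)"
    using t E0 Q0 by (subst (asm) ennreal_le_iff) auto
  also have "t ^ (k - 1) * (t/2) * (?N * Q ^ k * E) \<le> t ^ k * (?N * Q ^ k * E)"
    using t E0 Q0 by (intro mult_right_mono) (cases k, auto)
  finally show ?thesis by (simp add: algebra_simps)
qed

lemma geometric_telescope:
  fixes a :: "nat \<Rightarrow> real"
  assumes "\<And>j. \<bar>a (Suc j) - a j\<bar> \<le> K * q ^ j" "0 \<le> q" "q < 1" "a \<longlonglongrightarrow> L" "K \<ge> 0"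
  shows "\<bar>L - a 0\<bar> \<le> K / (1 - q)"
proof -
  have "\<bar>a n - a 0\<bar> \<le> K / (1 - q)" for n
  proof -
    have "\<bar>a n - a 0\<bar> = \<bar>\<Sum>j<n. a (Suc j) - a j\<bar>" by (simp add: sum_lessThan_telescope)
    also have "... \<le> (\<Sum>j<n. K * q ^ j)" by (rule order.trans[OF sum_abs sum_mono]) (rule assms)
    also have "... = K * ((1 - q ^ n) / (1 - q))"
      using assms by (simp add: sum_distrib_left[symmetric] sum_gp_strict)
    also have "... \<le> K * (1 / (1 - q))"
      using assms by (intro mult_left_mono divide_right_mono) auto
    finally show ?thesis by simp
  qed
  moreover have "(\<lambda>n. \<bar>a n - a 0\<bar>) \<longlonglongrightarrow> \<bar>L - a 0\<bar>" by (intro tendsto_intros assms)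
  ultimately show ?thesis by (intro LIMSEQ_le_const2) auto
qed

text \<open>Telescoping over \<open>t = 2\<^bsup>-j\<^esup>\<close>. The \<open>j\<close>-th difference is \<open>O(2\<^bsup>-j(k + \<gamma>)\<^esup>)\<close>, and the averages tend to \<open>f [] x\<close> by
  continuity. In the application \<open>k + \<gamma> = \<tau> - d/2\<close>.\<close>

lemma averaged_taylor_approx:
  fixes f :: "'d::finite list \<Rightarrow> real^'d \<Rightarrow> real" and E Q \<gamma> :: real
  assumes "jet f" "prob_space \<nu>" and sets[measurable_cong]: "sets \<nu> = sets borel"
    and K: "compact K" "AE z in \<nu>. z \<in> K" and Q: "\<And>z. z \<in> K \<Longrightarrow> norm (z - x) \<le> Q"
    and E: "\<And>t is r. 0 < t \<Longrightarrow> t \<le> 1 \<Longrightarrow> length is = k \<Longrightarrow> t/2 \<le> r \<Longrightarrow> r \<le> t \<Longrightarrow>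
       (\<integral>\<^sup>+z. ennreal \<bar>f is (x + r *\<^sub>R (z - x)) - c t is\<bar> \<partial>\<nu>) \<le> ennreal (E * t powr \<gamma>)"
    and E0: "E \<ge> 0" and Q0: "Q \<ge> 0" and \<theta>: "real k + \<gamma> > 0"
  shows "\<bar>f [] x - (\<integral>z. taylor_at f k x z 1 \<partial>\<nu>)\<bar>
     \<le> 3 * real (card {is :: 'd list. length is = k}) * Q ^ k * E / (1 - (1/2) powr (real k + \<gamma>))"
proof -
  interpret prob_space \<nu> by fact
  define a where "a = (\<lambda>j::nat. \<integral>z. taylor_at f k x z ((1/2) ^ j) \<partial>\<nu>)"
  define C where "C = 3 * real (card {is :: 'd list. length is = k}) * Q ^ k * E"
  have "\<bar>f [] x - a 0\<bar> \<le> C / (1 - (1/2) powr (real k + \<gamma>))"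
  proof (rule geometric_telescope)
    fix j
    let ?t = "(1/2::real) ^ j"
    have "\<bar>(\<integral>z. taylor_at f k x z ?t \<partial>\<nu>) - (\<integral>z. taylor_at f k x z (?t/2) \<partial>\<nu>)\<bar>
      \<le> 3 * real (card {is :: 'd list. length is = k}) * Q ^ k * (E * ?t powr \<gamma>) * ?t ^ k"
      by (rule taylor_at_step[OF assms(1,2) sets K Q, where c = "c ?t"])
         (use E0 Q0 in \<open>auto intro!: E power_le_one\<close>)
    also have "... = C * (?t powr \<gamma> * ?t powr real k)"
      by (simp add: C_def powr_realpow)
    also have "?t powr \<gamma> * ?t powr real k = ?t powr (real k + \<gamma>)"
      by (simp add: powr_add mult.commute)
    also have "?t powr (real k + \<gamma>) = ((1/2) powr (real k + \<gamma>)) ^ j"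
      by (simp add: powr_powr powr_realpow[symmetric] mult.commute)
    finally show "\<bar>a (Suc j) - a j\<bar> \<le> C * ((1/2) powr (real k + \<gamma>)) ^ j"
      by (simp add: a_def abs_minus_commute)
  next
    show "(1/2::real) powr (real k + \<gamma>) < 1" using powr01_less_one[of "1/2" "real k + \<gamma>"] \<theta> by simp
    show "C \<ge> 0" using E0 Q0 by (simp add: C_def)
    let ?h = "\<lambda>w. taylor_at f k x (fst w) (snd w)"
    have "continuous_on (K \<times> {0..1}) ?h"
      by (intro continuous_on_taylor_at assms(1) continuous_intros)
    then have "bounded (?h ` (K \<times> {0..1}))"
      by (intro compact_imp_bounded compact_continuous_image compact_Times K) auto
    then obtain B where B: "\<And>z r. z \<in> K \<Longrightarrow> 0 \<le> r \<Longrightarrow> r \<le> 1 \<Longrightarrow> \<bar>taylor_at f k x z r\<bar> \<le> B"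
      unfolding bounded_iff by fastforce
    have "a \<longlonglongrightarrow> (\<integral>z. f [] x \<partial>\<nu>)" unfolding a_def
    proof (rule integral_dominated_convergence[where w = "\<lambda>_. B"])
      show "(\<lambda>z. taylor_at f k x z ((1/2) ^ j)) \<in> borel_measurable \<nu>" for j :: nat
        unfolding measurable_cong_sets[OF sets refl]
        by (intro borel_measurable_continuous_onI continuous_on_taylor_at assms(1) continuous_intros)
      show "AE z in \<nu>. norm (taylor_at f k x z ((1/2) ^ j)) \<le> B" for j :: nat
        using K(2) by eventually_elim (auto intro!: B power_le_one)
      show "AE z in \<nu>. (\<lambda>j. taylor_at f k x z ((1/2) ^ j)) \<longlonglongrightarrow> f [] x"
      proof (intro AE_I2)
        fix z
        have "continuous_on UNIV (\<lambda>r. taylor_at f k x z r)"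
          by (intro continuous_on_taylor_at assms(1) continuous_intros)
        then have "isCont (\<lambda>r. taylor_at f k x z r) 0" by (simp add: continuous_on_eq_continuous_at)
        moreover have "(\<lambda>j. (1/2::real) ^ j) \<longlonglongrightarrow> 0" by (intro LIMSEQ_power_zero) auto
        ultimately show "(\<lambda>j. taylor_at f k x z ((1/2) ^ j)) \<longlonglongrightarrow> f [] x"
          using isCont_tendsto_compose taylor_at_0 by metis
      qed
    qed auto
    then show "a \<longlonglongrightarrow> f [] x" by (simp add: prob_space)
  qed auto
  then show ?thesis by (simp add: a_def C_def)
qed

lemma monomial_line:
  "\<exists>p. degree p \<le> length is \<and> (\<forall>s. monomial is (z - (a + s *\<^sub>R v)) = poly p s)"
proof (induction "is")
  case Nil
  then show ?case by (intro exI[of _ 1]) (auto simp: monomial_def)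
next
  case (Cons i "is")
  then obtain p where p: "degree p \<le> length is" "\<And>s. monomial is (z - (a + s *\<^sub>R v)) = poly p s" by blast
  let ?q = "[:(z - a) $ i, - v $ i:]"
  have "degree (?q * p) \<le> 1 + length is"
    using p(1) by (intro order.trans[OF degree_mult_le] add_mono) auto
  moreover have "monomial (i # is) (z - (a + s *\<^sub>R v)) = poly (?q * p) s" for s
  proof -
    have "monomial (i # is) (z - (a + s *\<^sub>R v)) = (z - (a + s *\<^sub>R v)) $ i * monomial is (z - (a + s *\<^sub>R v))"
      by (simp add: monomial_def)
    then show ?thesis unfolding p(2) by (simp add: algebra_simps)
  qed
  ultimately show ?case by (intro exI[of _ "?q * p"]) auto
qed

lemma poly_deg_le_averaged_taylor:
  fixes f :: "'d::finite list \<Rightarrow> real^'d \<Rightarrow> real"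
  assumes "jet f" "prob_space \<nu>" and sets[measurable_cong]: "sets \<nu> = sets borel"
    and K: "compact K" "AE z in \<nu>. z \<in> K"
  shows "poly_deg_le k (\<lambda>x. \<integral>z. taylor_at f k x z 1 \<partial>\<nu>)"
  unfolding poly_deg_le_def
proof (intro conjI allI impI)
  interpret prob_space \<nu> by fact
  have int: "integrable \<nu> (\<lambda>z. taylor_at f k x z 1)" for x
    by (intro integrable_continuous_compact_support[OF assms(2) sets K] continuous_on_taylor_at assms(1) continuous_intros)
  fix a v :: "real^'d" and s :: real
  have "taylor_at f k (a + s *\<^sub>R v) z 1 = (\<Sum>j\<le>k. poly (lagrange k j) s * taylor_at f k (a + real j *\<^sub>R v) z 1)" for z
  proof -
    have "\<forall>is. \<exists>p. degree p \<le> length is \<and> (\<forall>s. monomial is (z - (a + s *\<^sub>R v)) = poly p s)"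
      using monomial_line by blast
    then obtain p where p: "\<And>is. degree (p is) \<le> length is" "\<And>is s. monomial is (z - (a + s *\<^sub>R v)) = poly (p is) s"
      by metis
    let ?q = "\<Sum>m\<le>k. smult ((- 1) ^ m / fact m) (\<Sum>is | length is = m. smult (f is z) (p is))"
    have q: "taylor_at f k (a + s *\<^sub>R v) z 1 = poly ?q s" for s
      by (simp add: taylor_at_def dir_deriv_def p(2) poly_sum mult.commute)
    have "degree ?q \<le> k"
      using p(1) by (intro degree_sum_le order.trans[OF degree_smult_le]) (auto intro: order.trans)
    then show ?thesis unfolding q by (rule lagrange_interpolation)
  qed
  then show "(\<integral>z. taylor_at f k (a + s *\<^sub>R v) z 1 \<partial>\<nu>) =
     (\<Sum>j\<le>k. poly (lagrange k j) s * (\<integral>z. taylor_at f k (a + real j *\<^sub>R v) z 1 \<partial>\<nu>))"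
    by (simp add: int)
next
  interpret prob_space \<nu> by fact
  have int: "integrable \<nu> (\<lambda>z. taylor_at f k x z 1)" for x
    by (intro integrable_continuous_compact_support[OF assms(2) sets K] continuous_on_taylor_at assms(1) continuous_intros)
  fix S :: "(real^'d) set" assume "bounded S"
  let ?h = "\<lambda>w. taylor_at f k (fst w) (snd w) 1"
  have "continuous_on (closure S \<times> K) ?h"
    by (intro continuous_on_taylor_at assms(1) continuous_intros)
  then have "bounded (?h ` (closure S \<times> K))"
    by (intro compact_imp_bounded compact_continuous_image compact_Times K) (use \<open>bounded S\<close> in auto)
  then obtain B where B: "\<And>x z. x \<in> closure S \<Longrightarrow> z \<in> K \<Longrightarrow> \<bar>taylor_at f k x z 1\<bar> \<le> B"
    unfolding bounded_iff by fastforce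
  have "norm (\<integral>z. taylor_at f k x z 1 \<partial>\<nu>) \<le> B" if "x \<in> S" for x
  proof -
    have "\<bar>\<integral>z. taylor_at f k x z 1 \<partial>\<nu>\<bar> \<le> (\<integral>z. \<bar>taylor_at f k x z 1\<bar> \<partial>\<nu>)"
      using integral_norm_bound[of \<nu> "\<lambda>z. taylor_at f k x z 1"] by simp
    also have "... \<le> B"
      using K(2) that int[of x] closure_subset[of S]
      by (intro integral_le_const) (auto elim!: eventually_mono intro!: B)
    finally show ?thesis by simp
  qed
  then show "bounded ((\<lambda>x. \<integral>z. taylor_at f k x z 1 \<partial>\<nu>) ` S)"
    unfolding bounded_iff by blast
qed

section \<open>Averages of a mollified function over balls\<close>

lemma ennreal_le_sqrt:
  assumes "X\<^sup>2 \<le> ennreal V" "V \<ge> 0" shows "X \<le> ennreal (sqrt V)"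
proof (cases X)
  case (real x)
  then have "ennreal (x\<^sup>2) \<le> ennreal V" using assms by (simp add: ennreal_power)
  then have "x\<^sup>2 \<le> V" using assms by simp
  then have "x \<le> sqrt V" by (rule real_le_rsqrt)
  then show ?thesis using real by (simp add: ennreal_leI)
next
  case top
  then show ?thesis using assms by (simp add: top_unique)
qed

context prob_space
begin

lemma nn_integral_power2_le:
  assumes [measurable]: "g \<in> borel_measurable M"
  shows "(\<integral>\<^sup>+x. g x \<partial>M)\<^sup>2 \<le> (\<integral>\<^sup>+x. (g x)\<^sup>2 \<partial>M)"
  using Cauchy_Schwarz_nn_integral[of g M "\<lambda>_. 1"] by (simp add: emeasure_space_1)

lemma integral_power2_le:
  fixes g :: "'a \<Rightarrow> real"
  assumes g[measurable]: "integrable M g"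
  shows "ennreal ((\<integral>x. g x \<partial>M)\<^sup>2) \<le> (\<integral>\<^sup>+x. ennreal ((g x)\<^sup>2) \<partial>M)"
proof -
  have "ennreal ((\<integral>x. g x \<partial>M)\<^sup>2) = (ennreal (norm (\<integral>x. g x \<partial>M)))\<^sup>2" by (simp add: ennreal_power)
  also have "... \<le> (\<integral>\<^sup>+x. ennreal (norm (g x)) \<partial>M)\<^sup>2"
    by (intro power_mono integral_norm_bound_ennreal g) auto
  also have "... \<le> (\<integral>\<^sup>+x. (ennreal (norm (g x)))\<^sup>2 \<partial>M)"
    by (rule nn_integral_power2_le) (use g in measurable)
  finally show ?thesis by (simp add: ennreal_power)
qed

end

text \<open>The contraction towards \<open>x\<close>, followed by the translation by \<open>- q\<close>, maps \<open>B\<close> into \<open>\<Omega>\<close>, and the image of the uniform measure has density at most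
  \<open>1 / (r\<^sup>d |B|)\<close>.\<close>

lemma nn_integral_uniform_contraction_le:
  fixes g :: "real^'d \<Rightarrow> ennreal"
  assumes [measurable]: "g \<in> borel_measurable borel" "B \<in> sets borel" "\<Omega> \<in> sets borel"
    and r: "r > 0" and sub: "\<And>z. z \<in> B \<Longrightarrow> x + r *\<^sub>R (z - x) - q \<in> \<Omega>"
    and B: "0 < measure lborel B" "emeasure lborel B \<noteq> \<infinity>"
  shows "(\<integral>\<^sup>+z. g (x + r *\<^sub>R (z - x) - q) \<partial>uniform_measure lborel B)
     \<le> ennreal (1 / (r ^ CARD('d) * measure lborel B)) * (\<integral>\<^sup>+y. g y * indicator \<Omega> y \<partial>lborel)"
proof -
  define a where "a = x - r *\<^sub>R x - q"
  have a: "x + r *\<^sub>R (z - x) - q = a + r *\<^sub>R z" for z by (simp add: a_def algebra_simps)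
  note sub = sub[unfolded a]
  have "(\<integral>\<^sup>+y. g y * indicator \<Omega> y \<partial>lborel)
     = (\<integral>\<^sup>+y. g y * indicator \<Omega> y \<partial>density (distr lborel borel (\<lambda>x. a + r *\<^sub>R x)) (\<lambda>_. \<bar>r\<bar> ^ DIM(real^'d)))"
    using r by (subst lborel_affine[of r a]) auto
  also have "... = ennreal (r ^ CARD('d)) * (\<integral>\<^sup>+z. g (a + r *\<^sub>R z) * indicator \<Omega> (a + r *\<^sub>R z) \<partial>lborel)"
    using r by (simp add: nn_integral_density nn_integral_distr nn_integral_cmult)
  finally have eq: "(\<integral>\<^sup>+y. g y * indicator \<Omega> y \<partial>lborel)
     = ennreal (r ^ CARD('d)) * (\<integral>\<^sup>+z. g (a + r *\<^sub>R z) * indicator \<Omega> (a + r *\<^sub>R z) \<partial>lborel)" .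
  have "(\<integral>\<^sup>+z. g (a + r *\<^sub>R z) \<partial>uniform_measure lborel B)
     = (\<integral>\<^sup>+z. g (a + r *\<^sub>R z) * indicator B z \<partial>lborel) / emeasure lborel B"
    by (rule nn_integral_uniform_measure) auto
  also have "... \<le> (\<integral>\<^sup>+z. g (a + r *\<^sub>R z) * indicator \<Omega> (a + r *\<^sub>R z) \<partial>lborel) / emeasure lborel B"
    by (intro divide_right_mono_ennreal nn_integral_mono) (auto simp: indicator_def sub)
  also have "... = ennreal (1 / measure lborel B) * (\<integral>\<^sup>+z. g (a + r *\<^sub>R z) * indicator \<Omega> (a + r *\<^sub>R z) \<partial>lborel)"
    using B by (simp add: emeasure_eq_ennreal_measure divide_ennreal_def inverse_ennreal inverse_eq_divide mult.commute)
  also have "... = ennreal (1 / (r ^ CARD('d) * measure lborel B)) * (\<integral>\<^sup>+y. g y * indicator \<Omega> y \<partial>lborel)"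
    unfolding eq mult.assoc[symmetric] using r B
    by (simp add: ennreal_mult'[symmetric])
  finally show ?thesis unfolding a .
qed

text \<open>Jensen's inequality for the average over \<open>B\<close> and for the average over \<open>\<mu>\<close> brings the square inside. For
  fixed \<open>q\<close> the remaining average of \<open>v\<^sup>2\<close> is at most \<open>V\<close> divided by the volume of the contracted ball. The
  bound does not depend on the mollifier \<open>\<mu>\<close>.\<close>

lemma averaged_convolution_L2:
  fixes v :: "real^'d \<Rightarrow> real" and \<mu> :: "(real^'d) measure"
  assumes "prob_space \<mu>" and [measurable_cong]: "sets \<mu> = sets borel"
    and vm[measurable]: "v \<in> borel_measurable borel" and vint: "\<And>a. integrable \<mu> (\<lambda>q. v (a - q))"
    and Bm[measurable]: "B \<in> sets borel" and B: "0 < measure lborel B" "emeasure lborel B \<noteq> \<infinity>"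
    and r: "r > 0" and V: "(\<integral>\<^sup>+y. ennreal ((v y)\<^sup>2) \<partial>lborel) \<le> ennreal V" "V \<ge> 0"
  shows "(\<integral>\<^sup>+z. ennreal \<bar>\<integral>q. v (x + r *\<^sub>R (z - x) - q) \<partial>\<mu>\<bar> \<partial>uniform_measure lborel B)
      \<le> ennreal (sqrt (1 / (r ^ CARD('d) * measure lborel B) * V))"
proof (rule ennreal_le_sqrt)
  interpret \<mu>: prob_space \<mu> by fact
  let ?\<nu> = "uniform_measure lborel B"
  interpret \<nu>: prob_space ?\<nu> by (rule prob_space_uniform_measure) (use B in \<open>auto simp: measure_def\<close>)
  interpret pair_sigma_finite \<mu> ?\<nu> ..
  let ?a = "\<lambda>z. x + r *\<^sub>R (z - x)"
  let ?\<kappa> = "1 / (r ^ CARD('d) * measure lborel B)"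
  have [measurable]: "(\<lambda>z. \<integral>q. v (?a z - q) \<partial>\<mu>) \<in> borel_measurable ?\<nu>"
    by (rule \<mu>.borel_measurable_lebesgue_integral) measurable
  have "(\<integral>\<^sup>+z. ennreal \<bar>\<integral>q. v (?a z - q) \<partial>\<mu>\<bar> \<partial>?\<nu>)\<^sup>2 \<le> (\<integral>\<^sup>+z. (ennreal \<bar>\<integral>q. v (?a z - q) \<partial>\<mu>\<bar>)\<^sup>2 \<partial>?\<nu>)"
    by (rule \<nu>.nn_integral_power2_le) measurable
  also have "... \<le> (\<integral>\<^sup>+z. (\<integral>\<^sup>+q. ennreal ((v (?a z - q))\<^sup>2) \<partial>\<mu>) \<partial>?\<nu>)"
    using \<mu>.integral_power2_le[OF vint] by (intro nn_integral_mono) (simp add: ennreal_power)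
  also have "... = (\<integral>\<^sup>+q. (\<integral>\<^sup>+z. ennreal ((v (?a z - q))\<^sup>2) \<partial>?\<nu>) \<partial>\<mu>)"
    by (rule Fubini'[of "\<lambda>q z. ennreal ((v (?a z - q))\<^sup>2)"]) measurable
  also have "... \<le> (\<integral>\<^sup>+q. ennreal (?\<kappa> * V) \<partial>\<mu>)"
  proof (intro nn_integral_mono)
    fix q
    have "(\<integral>\<^sup>+z. ennreal ((v (?a z - q))\<^sup>2) \<partial>?\<nu>) \<le> ennreal ?\<kappa> * (\<integral>\<^sup>+y. ennreal ((v y)\<^sup>2) * indicator UNIV y \<partial>lborel)"
      by (rule nn_integral_uniform_contraction_le) (use r B in auto)
    also have "... \<le> ennreal ?\<kappa> * ennreal V" using V by (intro mult_left_mono) auto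
    also have "... = ennreal (?\<kappa> * V)" using r B V by (intro ennreal_mult[symmetric]) auto
    finally show "(\<integral>\<^sup>+z. ennreal ((v (?a z - q))\<^sup>2) \<partial>?\<nu>) \<le> ennreal (?\<kappa> * V)" .
  qed
  also have "... = ennreal (?\<kappa> * V)" by (simp add: \<mu>.emeasure_space_1)
  finally show "(\<integral>\<^sup>+z. ennreal \<bar>\<integral>q. v (?a z - q) \<partial>\<mu>\<bar> \<partial>?\<nu>)\<^sup>2 \<le> ennreal (?\<kappa> * V)" .
  show "0 \<le> ?\<kappa> * V" using r B V by auto
qed

text \<open>The same argument for the deviation from the mean over the ball contracted by \<open>t\<close>. Jensen's inequality
  leads to squares of differences of \<open>v\<close> at two points at distance at most \<open>2 t Q\<close>, which are dominated by
  \<open>(2 t Q)\<^sup>p\<close> times the Slobodeckij integrand; the hypothesis on \<open>\<mu>\<close> keeps both points in \<open>\<Omega>\<close>.\<close>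

lemma averaged_convolution_slobodeckij:
  fixes v :: "real^'d \<Rightarrow> real" and \<mu> :: "(real^'d) measure"
  assumes "prob_space \<mu>" and [measurable_cong]: "sets \<mu> = sets borel"
    and vm[measurable]: "v \<in> borel_measurable borel" and vint: "\<And>a. integrable \<mu> (\<lambda>q. v (a - q))"
    and Bm[measurable]: "B \<in> sets borel" and B: "0 < measure lborel B" "emeasure lborel B \<noteq> \<infinity>"
    and int: "\<And>r. integrable (uniform_measure lborel B) (\<lambda>z. \<integral>q. v (x + r *\<^sub>R (z - x) - q) \<partial>\<mu>)"
    and r: "0 < r" "r \<le> t" and \<Omega>[measurable]: "\<Omega> \<in> sets borel"
    and sub: "AE q in \<mu>. \<forall>z\<in>B. x + r *\<^sub>R (z - x) - q \<in> \<Omega> \<and> x + t *\<^sub>R (z - x) - q \<in> \<Omega>"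
    and Q: "\<And>z. z \<in> B \<Longrightarrow> norm (z - x) \<le> Q" and p: "p \<ge> 0" and Q0: "Q \<ge> 0"
    and S: "(\<integral>\<^sup>+a. indicator \<Omega> a * (\<integral>\<^sup>+b. indicator \<Omega> b * ennreal ((v a - v b)\<^sup>2 / dist a b powr p) \<partial>lborel) \<partial>lborel) \<le> ennreal S" "S \<ge> 0"
  shows "(\<integral>\<^sup>+z. ennreal \<bar>(\<integral>q. v (x + r *\<^sub>R (z - x) - q) \<partial>\<mu>) -
        (\<integral>w. (\<integral>q. v (x + t *\<^sub>R (w - x) - q) \<partial>\<mu>) \<partial>uniform_measure lborel B)\<bar> \<partial>uniform_measure lborel B)
      \<le> ennreal (sqrt (1 / (r ^ CARD('d) * measure lborel B) * (1 / (t ^ CARD('d) * measure lborel B)) * ((2 * t * Q) powr p * S)))"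
proof (rule ennreal_le_sqrt)
  interpret \<mu>: prob_space \<mu> by fact
  let ?\<nu> = "uniform_measure lborel B"
  interpret \<nu>: prob_space ?\<nu> by (rule prob_space_uniform_measure) (use B in \<open>auto simp: measure_def\<close>)
  interpret pair_sigma_finite \<mu> ?\<nu> ..
  let ?a = "\<lambda>r z. x + r *\<^sub>R (z - x)"
  let ?\<kappa> = "\<lambda>r. 1 / (r ^ CARD('d) * measure lborel B)"
  let ?\<phi> = "\<lambda>a. \<integral>q. v (a - q) \<partial>\<mu>"
  let ?\<Delta> = "\<lambda>q z w. ennreal ((v (?a r z - q) - v (?a t w - q))\<^sup>2)"
  have t: "t > 0" using r by simp
  have \<phi>m[measurable]: "?\<phi> \<in> borel_measurable borel"
    by (rule \<mu>.borel_measurable_lebesgue_integral) measurable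
  let ?c = "\<integral>w. ?\<phi> (?a t w) \<partial>?\<nu>"
  have "(\<integral>\<^sup>+z. ennreal \<bar>?\<phi> (?a r z) - ?c\<bar> \<partial>?\<nu>)\<^sup>2 \<le> (\<integral>\<^sup>+z. (ennreal \<bar>?\<phi> (?a r z) - ?c\<bar>)\<^sup>2 \<partial>?\<nu>)"
    by (rule \<nu>.nn_integral_power2_le) measurable
  also have "... \<le> (\<integral>\<^sup>+z. (\<integral>\<^sup>+w. ennreal ((?\<phi> (?a r z) - ?\<phi> (?a t w))\<^sup>2) \<partial>?\<nu>) \<partial>?\<nu>)"
  proof (intro nn_integral_mono)
    fix z
    have "?\<phi> (?a r z) - ?c = (\<integral>w. ?\<phi> (?a r z) - ?\<phi> (?a t w) \<partial>?\<nu>)"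
      using int \<nu>.prob_space by simp
    moreover have "(ennreal \<bar>?\<phi> (?a r z) - ?c\<bar>)\<^sup>2 = ennreal ((?\<phi> (?a r z) - ?c)\<^sup>2)"
      by (simp only: ennreal_power abs_ge_zero power2_abs)
    moreover have "ennreal ((\<integral>w. ?\<phi> (?a r z) - ?\<phi> (?a t w) \<partial>?\<nu>)\<^sup>2) \<le> (\<integral>\<^sup>+w. ennreal ((?\<phi> (?a r z) - ?\<phi> (?a t w))\<^sup>2) \<partial>?\<nu>)"
      by (rule \<nu>.integral_power2_le) (use int in auto)
    ultimately show "(ennreal \<bar>?\<phi> (?a r z) - ?c\<bar>)\<^sup>2 \<le> (\<integral>\<^sup>+w. ennreal ((?\<phi> (?a r z) - ?\<phi> (?a t w))\<^sup>2) \<partial>?\<nu>)"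
      by (simp only:)
  qed
  also have "... \<le> (\<integral>\<^sup>+z. (\<integral>\<^sup>+w. (\<integral>\<^sup>+q. ?\<Delta> q z w \<partial>\<mu>) \<partial>?\<nu>) \<partial>?\<nu>)"
  proof (intro nn_integral_mono)
    fix z w
    have "?\<phi> (?a r z) - ?\<phi> (?a t w) = (\<integral>q. v (?a r z - q) - v (?a t w - q) \<partial>\<mu>)"
      using vint by simp
    then show "ennreal ((?\<phi> (?a r z) - ?\<phi> (?a t w))\<^sup>2) \<le> (\<integral>\<^sup>+q. ?\<Delta> q z w \<partial>\<mu>)"
      using \<mu>.integral_power2_le[of "\<lambda>q. v (?a r z - q) - v (?a t w - q)"] vint by simp
  qed
  also have "... = (\<integral>\<^sup>+z. (\<integral>\<^sup>+q. (\<integral>\<^sup>+w. ?\<Delta> q z w \<partial>?\<nu>) \<partial>\<mu>) \<partial>?\<nu>)"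
    by (intro nn_integral_cong Fubini'[of "\<lambda>q w. ?\<Delta> q _ w"]) measurable
  also have "... = (\<integral>\<^sup>+q. (\<integral>\<^sup>+z. (\<integral>\<^sup>+w. ?\<Delta> q z w \<partial>?\<nu>) \<partial>?\<nu>) \<partial>\<mu>)"
    by (rule Fubini'[of "\<lambda>q z. \<integral>\<^sup>+w. ?\<Delta> q z w \<partial>?\<nu>"])
       (simp add: split_beta', measurable)
  also have "... \<le> (\<integral>\<^sup>+q. ennreal (?\<kappa> r * ?\<kappa> t * ((2 * t * Q) powr p * S)) \<partial>\<mu>)"
  proof (rule nn_integral_mono_AE, use sub in eventually_elim)
    fix q assume z: "\<forall>z\<in>B. ?a r z - q \<in> \<Omega> \<and> ?a t z - q \<in> \<Omega>"
    let ?D = "(2 * t * Q) powr p"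
    let ?s = "\<lambda>a b. ennreal ((v a - v b)\<^sup>2 / dist a b powr p)"
    have AEB: "AE z in ?\<nu>. z \<in> B"
      by (rule AE_uniform_measureI) auto
    have pt: "?\<Delta> q z w \<le> ennreal ?D * ?s (?a r z - q) (?a t w - q)"
      if "z \<in> B" "w \<in> B" for z w
    proof (cases "?a r z - q = ?a t w - q")
      case True
      then show ?thesis by simp
    next
      case False
      let ?d = "dist (?a r z - q) (?a t w - q)"
      have "?d = norm (r *\<^sub>R (z - x) - t *\<^sub>R (w - x))" by (simp add: dist_norm)
      also have "... \<le> r * norm (z - x) + t * norm (w - x)"
        using r t by (intro order.trans[OF norm_triangle_ineq4]) simp
      also have "... \<le> t * Q + t * Q" using r t Q that by (intro add_mono mult_mono) auto
      finally have "?d \<le> 2 * t * Q" by (simp add: mult_ac)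
      then have le: "?d powr p \<le> ?D" using p by (intro powr_mono2) auto
      have pos: "?d powr p > 0" using False by simp
      have "(v (?a r z - q) - v (?a t w - q))\<^sup>2 = ?d powr p * ((v (?a r z - q) - v (?a t w - q))\<^sup>2 / ?d powr p)"
        using pos by simp
      also have "... \<le> ?D * ((v (?a r z - q) - v (?a t w - q))\<^sup>2 / ?d powr p)"
        using le by (intro mult_right_mono) auto
      finally show ?thesis by (simp add: ennreal_mult'[symmetric] ennreal_leI)
    qed
    have "(\<integral>\<^sup>+z. (\<integral>\<^sup>+w. ?\<Delta> q z w \<partial>?\<nu>) \<partial>?\<nu>)
       \<le> (\<integral>\<^sup>+z. (\<integral>\<^sup>+w. ennreal ?D * ?s (?a r z - q) (?a t w - q) \<partial>?\<nu>) \<partial>?\<nu>)"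
    proof (rule nn_integral_mono_AE, use AEB in eventually_elim)
      fix z assume zB: "z \<in> B"
      show "(\<integral>\<^sup>+w. ?\<Delta> q z w \<partial>?\<nu>)
        \<le> (\<integral>\<^sup>+w. ennreal ?D * ?s (?a r z - q) (?a t w - q) \<partial>?\<nu>)"
        by (rule nn_integral_mono_AE, use AEB in eventually_elim) (rule pt[OF zB])
    qed
    also have "... = ennreal ?D * (\<integral>\<^sup>+z. (\<integral>\<^sup>+w. ?s (?a r z - q) (?a t w - q) \<partial>?\<nu>) \<partial>?\<nu>)"
      by (simp add: nn_integral_cmult)
    also have "(\<integral>\<^sup>+z. (\<integral>\<^sup>+w. ?s (?a r z - q) (?a t w - q) \<partial>?\<nu>) \<partial>?\<nu>)
       \<le> (\<integral>\<^sup>+z. ennreal (?\<kappa> t) * (\<integral>\<^sup>+b. ?s (?a r z - q) b * indicator \<Omega> b \<partial>lborel) \<partial>?\<nu>)"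
      by (intro nn_integral_mono nn_integral_uniform_contraction_le) (use t B z in auto)
    also have "... = ennreal (?\<kappa> t) * (\<integral>\<^sup>+z. (\<integral>\<^sup>+b. ?s (?a r z - q) b * indicator \<Omega> b \<partial>lborel) \<partial>?\<nu>)"
      by (rule nn_integral_cmult) (rule lborel.borel_measurable_nn_integral, simp add: split_beta', measurable)
    also have "(\<integral>\<^sup>+z. (\<integral>\<^sup>+b. ?s (?a r z - q) b * indicator \<Omega> b \<partial>lborel) \<partial>?\<nu>)
       \<le> ennreal (?\<kappa> r) * (\<integral>\<^sup>+a. (\<integral>\<^sup>+b. ?s a b * indicator \<Omega> b \<partial>lborel) * indicator \<Omega> a \<partial>lborel)"
    proof (rule nn_integral_uniform_contraction_le[where g = "\<lambda>a. \<integral>\<^sup>+b. ?s a b * indicator \<Omega> b \<partial>lborel"])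
      show "(\<lambda>a. \<integral>\<^sup>+b. ?s a b * indicator \<Omega> b \<partial>lborel) \<in> borel_measurable borel"
        by (rule lborel.borel_measurable_nn_integral) (simp add: split_beta', measurable)
    qed (use r B z in auto)
    also have "(\<integral>\<^sup>+a. (\<integral>\<^sup>+b. ?s a b * indicator \<Omega> b \<partial>lborel) * indicator \<Omega> a \<partial>lborel) \<le> ennreal S"
      using S(1) by (simp only: mult.commute)
    finally have "(\<integral>\<^sup>+z. (\<integral>\<^sup>+w. ?\<Delta> q z w \<partial>?\<nu>) \<partial>?\<nu>)
       \<le> ennreal ?D * (ennreal (?\<kappa> t) * (ennreal (?\<kappa> r) * ennreal S))"
      by (simp add: mult_left_mono)
    also have "... = ennreal (?D * (?\<kappa> t * (?\<kappa> r * S)))"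
      using r t B S(2) by (simp only: ennreal_mult mult_nonneg_nonneg powr_ge_zero zero_le_divide_1_iff zero_le_power less_imp_le measure_nonneg)
    also have "?D * (?\<kappa> t * (?\<kappa> r * S)) = ?\<kappa> r * ?\<kappa> t * (?D * S)" by simp
    finally show "(\<integral>\<^sup>+z. (\<integral>\<^sup>+w. ?\<Delta> q z w \<partial>?\<nu>) \<partial>?\<nu>)
       \<le> ennreal (?\<kappa> r * ?\<kappa> t * (?D * S))" .
  qed
  also have "... = ennreal (?\<kappa> r * ?\<kappa> t * ((2 * t * Q) powr p * S))" by (simp add: \<mu>.emeasure_space_1)
  finally show "(\<integral>\<^sup>+z. ennreal \<bar>?\<phi> (?a r z) - ?c\<bar> \<partial>?\<nu>)\<^sup>2 \<le> ennreal (?\<kappa> r * ?\<kappa> t * ((2 * t * Q) powr p * S))" .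
  show "0 \<le> ?\<kappa> r * ?\<kappa> t * ((2 * t * Q) powr p * S)" using r t B S(2) by auto
qed

section \<open>Sobolev norms\<close>

abbreviation sobolev_norm :: "real \<Rightarrow> (real^'d) set \<Rightarrow> (real^'d \<Rightarrow> real) \<Rightarrow> real" where
  "sobolev_norm \<sigma> \<Omega> \<equiv> ip_norm (sobolev_inner \<sigma> \<Omega>)"

text \<open>Extension by zero makes translations and convolutions available for functions that are measurable on
  \<open>\<Omega>\<close> only.\<close>

definition zero_ext :: "'a set \<Rightarrow> ('a \<Rightarrow> real) \<Rightarrow> 'a \<Rightarrow> real" where
  "zero_ext \<Omega> v = (\<lambda>z. indicator \<Omega> z * v z)"

lemma sobolev_weak_deriv:
  assumes "u \<in> sobolev \<sigma> \<Omega>" "length is \<le> sob_int \<sigma>"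
  shows "weak_deriv \<Omega> is u \<in> L2_on \<Omega>" "has_weak_deriv \<Omega> is u (weak_deriv \<Omega> is u)"
proof -
  have "\<exists>v. v \<in> L2_on \<Omega> \<and> has_weak_deriv \<Omega> is u v"
    using assms unfolding sobolev_def sobolev_classes_def by blast
  from someI_ex[OF this] show "weak_deriv \<Omega> is u \<in> L2_on \<Omega>" "has_weak_deriv \<Omega> is u (weak_deriv \<Omega> is u)"
    unfolding weak_deriv_def by auto
qed

lemma L2_on_zero_ext:
  fixes v :: "real^'d \<Rightarrow> real"
  assumes "open \<Omega>" "bounded \<Omega>" "v \<in> L2_on \<Omega>"
  shows "zero_ext \<Omega> v \<in> borel_measurable borel"
    and "integrable lborel (zero_ext \<Omega> v)"
    and "(\<integral>\<^sup>+z. ennreal ((zero_ext \<Omega> v z)\<^sup>2) \<partial>lborel) = ennreal (\<integral>x. v x * v x \<partial>vol_on \<Omega>)"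
proof -
  have m: "v \<in> borel_measurable (vol_on \<Omega>)" and i: "integrable (vol_on \<Omega>) (\<lambda>x. (v x)\<^sup>2)"
    using assms(3) unfolding L2_on_def by auto
  have "(\<lambda>z. indicator \<Omega> z *\<^sub>R v z) \<in> borel_measurable lborel"
    using m assms(1) by (subst (asm) borel_measurable_restrict_space_iff) auto
  then show [measurable]: "zero_ext \<Omega> v \<in> borel_measurable borel"
    by (simp add: zero_ext_def)
  have eq: "(zero_ext \<Omega> v z)\<^sup>2 = indicator \<Omega> z *\<^sub>R (v z)\<^sup>2" for z
    by (auto simp: zero_ext_def indicator_def)
  have i2: "integrable lborel (\<lambda>z. (zero_ext \<Omega> v z)\<^sup>2)"
    unfolding eq using i assms(1) by (subst (asm) integrable_restrict_space) auto
  have "integrable lborel (\<lambda>z. indicator \<Omega> z + (zero_ext \<Omega> v z)\<^sup>2)"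
    using assms by (intro Bochner_Integration.integrable_add i2 integrable_real_indicator emeasure_bounded_finite) auto
  then show "integrable lborel (zero_ext \<Omega> v)"
  proof (rule Bochner_Integration.integrable_bound)
    have "\<bar>y\<bar> \<le> 1 + y\<^sup>2" for y :: real
      using zero_le_power2[of "\<bar>y\<bar> - 1"] by (auto simp: power2_eq_square algebra_simps)
    then show "AE z in lborel. norm (zero_ext \<Omega> v z) \<le> norm (indicator \<Omega> z + (zero_ext \<Omega> v z)\<^sup>2)"
      by (auto simp: zero_ext_def indicator_def)
  qed simp
  have "(\<integral>\<^sup>+z. ennreal ((zero_ext \<Omega> v z)\<^sup>2) \<partial>lborel) = ennreal (\<integral>z. (zero_ext \<Omega> v z)\<^sup>2 \<partial>lborel)"
    by (rule nn_integral_eq_integral[OF i2]) auto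
  also have "(\<integral>z. (zero_ext \<Omega> v z)\<^sup>2 \<partial>lborel) = (\<integral>x. v x * v x \<partial>vol_on \<Omega>)"
    unfolding eq using assms(1) by (simp add: integral_restrict_space power2_eq_square)
  finally show "(\<integral>\<^sup>+z. ennreal ((zero_ext \<Omega> v z)\<^sup>2) \<partial>lborel) = ennreal (\<integral>x. v x * v x \<partial>vol_on \<Omega>)" .
qed

lemma slobodeckij_integrand_nonneg: "slobodeckij_integrand s v v w \<ge> 0"
  by (simp add: slobodeckij_integrand_def split_beta)

lemma sobolev_inner_self:
  fixes u :: "real^'d \<Rightarrow> real"
  shows "sobolev_norm \<sigma> \<Omega> u \<ge> 0" "(sobolev_norm \<sigma> \<Omega> u)\<^sup>2 = sobolev_inner \<sigma> \<Omega> u u"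
    "length is \<le> sob_int \<sigma> \<Longrightarrow>
      (\<integral>x. weak_deriv \<Omega> is u x * weak_deriv \<Omega> is u x \<partial>vol_on \<Omega>) \<le> (sobolev_norm \<sigma> \<Omega> u)\<^sup>2"
    "length is = sob_int \<sigma> \<Longrightarrow> sob_frac \<sigma> > 0 \<Longrightarrow>
      (\<integral>p. slobodeckij_integrand (sob_frac \<sigma>) (weak_deriv \<Omega> is u) (weak_deriv \<Omega> is u) p \<partial>(vol_on \<Omega> \<Otimes>\<^sub>M vol_on \<Omega>))
        \<le> (sobolev_norm \<sigma> \<Omega> u)\<^sup>2"
proof -
  let ?a = "\<lambda>is. \<integral>x. weak_deriv \<Omega> is u x * weak_deriv \<Omega> is u x \<partial>vol_on \<Omega>"
  let ?b = "\<lambda>is. \<integral>p. slobodeckij_integrand (sob_frac \<sigma>) (weak_deriv \<Omega> is u) (weak_deriv \<Omega> is u) p \<partial>(vol_on \<Omega> \<Otimes>\<^sub>M vol_on \<Omega>)"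
  have a: "?a is \<ge> 0" for "is" by (intro Bochner_Integration.integral_nonneg) auto
  have b: "?b is \<ge> 0" for "is" by (intro Bochner_Integration.integral_nonneg slobodeckij_integrand_nonneg)
  have A: "?a is \<le> (\<Sum>is | length is \<le> sob_int \<sigma>. ?a is)" if "length is \<le> sob_int \<sigma>" for "is"
    by (rule member_le_sum[of "is" _ ?a]) (use that a in auto)
  have B: "?b is \<le> (\<Sum>is | length is = sob_int \<sigma>. ?b is)" if "length is = sob_int \<sigma>" for "is"
    by (rule member_le_sum[of "is" _ ?b]) (use that b in auto)
  have A0: "(\<Sum>is | length is \<le> sob_int \<sigma>. ?a is) \<ge> 0" by (intro sum_nonneg a)
  have B0: "(\<Sum>is | length is = sob_int \<sigma>. ?b is) \<ge> 0" by (intro sum_nonneg b)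
  have nn: "sobolev_inner \<sigma> \<Omega> u u \<ge> 0" using A0 B0 unfolding sobolev_inner_def by auto
  then show "sobolev_norm \<sigma> \<Omega> u \<ge> 0" and sq: "(sobolev_norm \<sigma> \<Omega> u)\<^sup>2 = sobolev_inner \<sigma> \<Omega> u u"
    by (auto simp: ip_norm_def)
  show "?a is \<le> (sobolev_norm \<sigma> \<Omega> u)\<^sup>2" if "length is \<le> sob_int \<sigma>"
    unfolding sq sobolev_inner_def using A[OF that] B0 by auto
  show "?b is \<le> (sobolev_norm \<sigma> \<Omega> u)\<^sup>2" if "length is = sob_int \<sigma>" "sob_frac \<sigma> > 0"
    unfolding sq sobolev_inner_def using B[OF that(1)] A0 that(2) by auto
qed

lemma sobolev_slobodeckij_bound:
  fixes u :: "real^'d \<Rightarrow> real"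
  assumes "open \<Omega>" "bounded \<Omega>" "u \<in> sobolev \<sigma> \<Omega>" "length is = sob_int \<sigma>" "sob_frac \<sigma> > 0"
  defines "v \<equiv> zero_ext \<Omega> (weak_deriv \<Omega> is u)"
  shows "(\<integral>\<^sup>+a. indicator \<Omega> a * (\<integral>\<^sup>+b. indicator \<Omega> b *
      ennreal ((v a - v b)\<^sup>2 / dist a b powr (real CARD('d) + 2 * sob_frac \<sigma>)) \<partial>lborel) \<partial>lborel)
    \<le> ennreal ((sobolev_norm \<sigma> \<Omega> u)\<^sup>2)"
proof -
  let ?V = "vol_on \<Omega>"
  let ?w = "weak_deriv \<Omega> is u"
  let ?s = "slobodeckij_integrand (sob_frac \<sigma>) ?w ?w"
  interpret finite_measure ?V
    using assms(1,2) emeasure_bounded_finite[of \<Omega>]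
    by (intro finite_measureI) (auto simp: emeasure_restrict_space space_restrict_space)
  have int: "integrable (?V \<Otimes>\<^sub>M ?V) ?s"
    using assms(3-5) unfolding sobolev_def sobolev_classes_def by auto
  have "(\<integral>\<^sup>+a. indicator \<Omega> a * (\<integral>\<^sup>+b. indicator \<Omega> b *
      ennreal ((v a - v b)\<^sup>2 / dist a b powr (real CARD('d) + 2 * sob_frac \<sigma>)) \<partial>lborel) \<partial>lborel)
    = (\<integral>\<^sup>+a. (\<integral>\<^sup>+b. ennreal ((v a - v b)\<^sup>2 / dist a b powr (real CARD('d) + 2 * sob_frac \<sigma>)) \<partial>?V) \<partial>?V)"
    using assms(1) by (simp add: nn_integral_restrict_space mult.commute)
  also have "... = (\<integral>\<^sup>+a. (\<integral>\<^sup>+b. ennreal (?s (a, b)) \<partial>?V) \<partial>?V)"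
    by (intro nn_integral_cong)
       (auto simp: v_def zero_ext_def space_restrict_space slobodeckij_integrand_def power2_eq_square)
  also have "... = (\<integral>\<^sup>+p. ennreal (?s p) \<partial>(?V \<Otimes>\<^sub>M ?V))"
    by (rule nn_integral_fst) (use int in measurable)
  also have "... = ennreal (\<integral>p. ?s p \<partial>(?V \<Otimes>\<^sub>M ?V))"
    by (rule nn_integral_eq_integral[OF int]) (auto intro: slobodeckij_integrand_nonneg)
  also have "... \<le> ennreal ((sobolev_norm \<sigma> \<Omega> u)\<^sup>2)"
    by (intro ennreal_leI sobolev_inner_self(4) assms)
  finally show ?thesis .
qed

text \<open>The properties of a sufficiently fine mollification \<open>f\<close> of \<open>u\<close> that are needed near a compact set \<open>H\<close>: its
  derivatives are averages of translates of the weak derivatives of \<open>u\<close>, and at finitely many points it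
  is close to \<open>u\<close> because \<open>u\<close> is continuous.\<close>

lemma sobolev_mollification:
  fixes u :: "real^'d \<Rightarrow> real"
  assumes \<Omega>: "open \<Omega>" "bounded \<Omega>" and u: "u \<in> sobolev \<sigma> \<Omega>"
    and H: "compact H" "H \<subseteq> \<Omega>" and Y: "finite Y" "Y \<subseteq> H" and "\<delta> > 0"
  defines "v \<equiv> \<lambda>is. zero_ext \<Omega> (weak_deriv \<Omega> is u)"
  shows "\<exists>f \<mu>. jet f \<and> prob_space \<mu> \<and> sets \<mu> = sets borel \<and>
    (AE q in \<mu>. \<forall>a\<in>H. a - q \<in> \<Omega>) \<and>
    (\<forall>is. length is \<le> sob_int \<sigma> \<longrightarrow> (\<forall>a\<in>H. f is a = (\<integral>q. v is (a - q) \<partial>\<mu>))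
        \<and> (\<forall>a. integrable \<mu> (\<lambda>q. v is (a - q)))
        \<and> continuous_on UNIV (\<lambda>a. \<integral>q. v is (a - q) \<partial>\<mu>)) \<and>
    (\<forall>y\<in>Y. \<bar>f [] y - u y\<bar> \<le> \<delta>)"
proof -
  obtain \<epsilon>0 where \<epsilon>0: "\<epsilon>0 > 0" "(\<Union>a\<in>H. cball a \<epsilon>0) \<subseteq> \<Omega>"
    using compact_subset_open_imp_cball_epsilon_subset[OF H(1) \<Omega>(1) H(2)] by blast
  have ucont: "continuous_on \<Omega> u" and uL2: "u \<in> L2_on \<Omega>"
    using u unfolding sobolev_def sobolev_classes_def by auto
  have "\<exists>\<eta>>0. \<forall>a. dist a y \<le> \<eta> \<longrightarrow> \<bar>u a - u y\<bar> \<le> \<delta>" if "y \<in> Y" for y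
  proof -
    have "isCont u y" using ucont \<Omega>(1) that Y H continuous_on_eq_continuous_at by blast
    then obtain d where d: "d > 0" "\<And>a. dist a y < d \<Longrightarrow> dist (u a) (u y) < \<delta>"
      using \<open>\<delta> > 0\<close> unfolding continuous_at_eps_delta by blast
    show ?thesis
    proof (intro exI[of _ "d/2"] conjI allI impI)
      fix a assume "dist a y \<le> d/2"
      then have "dist (u a) (u y) < \<delta>" using d by simp
      then show "\<bar>u a - u y\<bar> \<le> \<delta>" by (simp add: dist_real_def)
    qed (use d in simp)
  qed
  then obtain \<eta> where \<eta>: "\<And>y. y \<in> Y \<Longrightarrow> \<eta> y > 0" "\<And>y a. y \<in> Y \<Longrightarrow> dist a y \<le> \<eta> y \<Longrightarrow> \<bar>u a - u y\<bar> \<le> \<delta>"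
    by metis
  define \<epsilon>1 where "\<epsilon>1 = Min (insert \<epsilon>0 (\<eta> ` Y))"
  have \<epsilon>1: "\<epsilon>1 > 0" "\<epsilon>1 \<le> \<epsilon>0" "\<And>y. y \<in> Y \<Longrightarrow> \<epsilon>1 \<le> \<eta> y"
    using Y \<eta> \<epsilon>0 by (auto simp: \<epsilon>1_def)
  define \<epsilon> where "\<epsilon> = \<epsilon>1 / CARD('d)"
  have \<epsilon>: "\<epsilon> > 0" "\<epsilon> * CARD('d) = \<epsilon>1" using \<epsilon>1 by (auto simp: \<epsilon>_def)
  have sub: "cball a (\<epsilon> * CARD('d)) \<subseteq> \<Omega>" if "a \<in> H" for a
    using \<epsilon>0 \<epsilon>1 \<epsilon> that by force
  define f where "f = mollified \<epsilon> (zero_ext \<Omega> u)"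
  let ?\<mu> = "mollifier_measure \<epsilon> :: (real^'d) measure"
  interpret \<mu>: prob_space ?\<mu> by (rule prob_space_mollifier_measure) (rule \<epsilon>)
  have jet: "jet f"
    unfolding jet_def f_def by (intro allI mollified_has_derivative L2_on_zero_ext \<Omega> uL2)
  have near: "AE q in ?\<mu>. \<forall>a\<in>H. a - q \<in> \<Omega>"
    using AE_mollifier_measure[OF \<epsilon>(1), where 'd = 'd]
  proof eventually_elim
    case (elim q)
    then have "a - q \<in> cball a (\<epsilon> * CARD('d))" for a by (simp add: dist_norm)
    then show ?case using sub by blast
  qed
  have vL2: "weak_deriv \<Omega> is u \<in> L2_on \<Omega>" if "length is \<le> sob_int \<sigma>" for "is"
    using sobolev_weak_deriv(1)[OF u that] .
  have fv: "f is a = (\<integral>q. v is (a - q) \<partial>?\<mu>)" if "length is \<le> sob_int \<sigma>" "a \<in> H" for "is" a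
    using mollified_weak_deriv[OF \<Omega>(1) \<epsilon>(1) sub[OF that(2)] sobolev_weak_deriv(2)[OF u that(1)]]
      L2_on_zero_ext(1)[OF \<Omega> vL2[OF that(1)]]
    by (simp add: f_def v_def zero_ext_def)
  have vint: "integrable ?\<mu> (\<lambda>q. v is (a - q))" if "length is \<le> sob_int \<sigma>" for "is" a
    unfolding v_def by (intro integrable_mollifier_measure \<epsilon> L2_on_zero_ext(2)[OF \<Omega>] vL2 that)
  have vcont: "continuous_on UNIV (\<lambda>a. \<integral>q. v is (a - q) \<partial>?\<mu>)" if "length is \<le> sob_int \<sigma>" for "is"
  proof -
    have v: "v is \<in> borel_measurable borel" "integrable lborel (v is)"
      unfolding v_def by (intro L2_on_zero_ext(1,2)[OF \<Omega>] vL2 that)+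
    have eq: "(\<integral>q. v is (a - q) \<partial>?\<mu>) = mollified \<epsilon> (v is) [] a" for a
      unfolding integral_mollifier_measure[OF \<epsilon>(1) v(1), symmetric] mollified_def count_index_Nil by simp
    have "jet (mollified \<epsilon> (v is))" unfolding jet_def by (intro allI mollified_has_derivative v)
    then show ?thesis unfolding eq by (rule jet_continuous_on) (rule continuous_on_id)
  qed
  have fu: "\<bar>f [] y - u y\<bar> \<le> \<delta>" if y: "y \<in> Y" for y
  proof -
    have yH: "y \<in> H" using y Y by blast
    have "has_weak_deriv \<Omega> [] u u" by (simp add: has_weak_deriv_def iter_partial_def)
    from mollified_weak_deriv[OF \<Omega>(1) \<epsilon>(1) sub[OF yH] this]
    have eq: "f [] y = (\<integral>q. zero_ext \<Omega> u (y - q) \<partial>?\<mu>)"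
      using L2_on_zero_ext(1)[OF \<Omega> uL2] by (simp add: f_def zero_ext_def)
    have int: "integrable ?\<mu> (\<lambda>q. zero_ext \<Omega> u (y - q))"
      by (intro integrable_mollifier_measure \<epsilon> L2_on_zero_ext(2)[OF \<Omega>] uL2)
    have "f [] y - u y = (\<integral>q. zero_ext \<Omega> u (y - q) - u y \<partial>?\<mu>)"
      unfolding eq using int \<mu>.prob_space by simp
    also have "\<bar>...\<bar> \<le> (\<integral>q. \<bar>zero_ext \<Omega> u (y - q) - u y\<bar> \<partial>?\<mu>)"
      using integral_norm_bound[of ?\<mu> "\<lambda>q. zero_ext \<Omega> u (y - q) - u y"] by simp
    also have "... \<le> \<delta>"
    proof (rule \<mu>.integral_le_const)
      show "AE q in ?\<mu>. \<bar>zero_ext \<Omega> u (y - q) - u y\<bar> \<le> \<delta>"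
        using AE_mollifier_measure[OF \<epsilon>(1), where 'd = 'd] near
      proof eventually_elim
        case (elim q)
        have "dist (y - q) y \<le> \<eta> y" using elim(1) \<epsilon>(2) \<epsilon>1(3)[OF y] by (simp add: dist_norm)
        then have "\<bar>u (y - q) - u y\<bar> \<le> \<delta>" by (rule \<eta>(2)[OF y])
        then show ?case using elim(2) yH by (simp add: zero_ext_def)
      qed
    qed (use int in simp)
    finally show ?thesis .
  qed
  show ?thesis
    by (rule exI[of _ f], rule exI[of _ ?\<mu>])
       (use jet near fv vint vcont fu \<mu>.prob_space_axioms in auto)
qed

section \<open>Local polynomial approximation\<close>

lemma powr_neg_half_power2:
  fixes x :: real
  assumes "x > 0"
  shows "(x powr (- (real d / 2)))\<^sup>2 = 1 / x ^ d"
proof -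
  have "(x powr (- (real d / 2)))\<^sup>2 = x powr (- (real d / 2) + - (real d / 2))"
    by (simp only: power2_eq_square powr_add)
  also have "- (real d / 2) + - (real d / 2) = - real d" by simp
  also have "x powr (- real d) = 1 / x ^ d"
    using assms by (simp only: powr_minus powr_realpow inverse_eq_divide)
  finally show ?thesis .
qed

text \<open>The constant of \<open>averaged_convolution_L2\<close> for a ball of radius \<open>\<rho>\<close> and volume \<open>\<omega> \<rho>\<^sup>d\<close>, up to a factor that
  depends on \<open>d\<close> only.\<close>

lemma L2_mean_constant:
  fixes r t \<rho> \<omega> N :: real
  assumes "0 < t" "t / 2 \<le> r" "0 < \<rho>" "0 < \<omega>" "N \<ge> 0"
  shows "sqrt (1 / (r ^ d * (\<omega> * \<rho> ^ d)) * N\<^sup>2) \<le> sqrt (2 ^ d / \<omega>) * N * (t * \<rho>) powr (- (real d / 2))"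
proof -
  let ?h = "(t * \<rho>) powr (- (real d / 2))"
  have "(t / 2) ^ d \<le> r ^ d" using assms by (intro power_mono) auto
  then have "(t / 2) ^ d * (\<omega> * \<rho> ^ d) \<le> r ^ d * (\<omega> * \<rho> ^ d)" using assms by (intro mult_right_mono) auto
  then have "1 / (r ^ d * (\<omega> * \<rho> ^ d)) \<le> 1 / ((t / 2) ^ d * (\<omega> * \<rho> ^ d))"
    using assms by (intro divide_left_mono) auto
  also have "... = 2 ^ d / \<omega> * (1 / (t * \<rho>) ^ d)"
    using assms by (simp add: power_divide power_mult_distrib)
  also have "1 / (t * \<rho>) ^ d = (?h)\<^sup>2"
    using assms by (simp only: powr_neg_half_power2 mult_pos_pos)
  finally have "1 / (r ^ d * (\<omega> * \<rho> ^ d)) * N\<^sup>2 \<le> (2 ^ d / \<omega> * (?h)\<^sup>2) * N\<^sup>2"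
    by (intro mult_right_mono) auto
  then have "sqrt (1 / (r ^ d * (\<omega> * \<rho> ^ d)) * N\<^sup>2) \<le> sqrt ((2 ^ d / \<omega> * (?h)\<^sup>2) * N\<^sup>2)"
    by (rule real_sqrt_le_mono)
  also have "... = sqrt (2 ^ d / \<omega>) * ?h * N"
    using assms by (simp add: real_sqrt_mult real_sqrt_divide)
  finally show ?thesis by (simp add: mult_ac)
qed

text \<open>The constant of \<open>averaged_convolution_slobodeckij\<close>: two inverse volumes contribute \<open>(t \<rho>)\<^bsup>-2d\<^esup>\<close> and
  the distance contributes \<open>(t \<rho>)\<^bsup>d + 2s\<^esup>\<close>.\<close>

lemma slobodeckij_mean_constant:
  fixes r t \<rho> \<omega> N R s :: real
  assumes "0 < t" "t / 2 \<le> r" "0 < \<rho>" "0 < \<omega>" "N \<ge> 0" "R \<ge> 0"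
  shows "sqrt (1 / (r ^ d * (\<omega> * \<rho> ^ d)) * (1 / (t ^ d * (\<omega> * \<rho> ^ d))) * ((2 * t * (R * \<rho>)) powr (real d + 2 * s) * N\<^sup>2))
     \<le> sqrt (2 ^ d / \<omega>) * sqrt (1 / \<omega>) * ((2 * R) powr ((real d + 2 * s) / 2)) * N * (t * \<rho>) powr (s - real d / 2)"
proof -
  let ?h = "(t * \<rho>) powr (- (real d / 2))"
  let ?D = "(2 * R) powr ((real d + 2 * s) / 2) * (t * \<rho>) powr ((real d + 2 * s) / 2)"
  have D: "(2 * t * (R * \<rho>)) powr (real d + 2 * s) = ?D\<^sup>2"
  proof -
    have "2 * t * (R * \<rho>) = (2 * R) * (t * \<rho>)" by simp
    then have "(2 * t * (R * \<rho>)) powr (real d + 2 * s) = (2 * R) powr (real d + 2 * s) * (t * \<rho>) powr (real d + 2 * s)"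
      using assms by (simp only: powr_mult mult_nonneg_nonneg)
    moreover have "(x powr ((real d + 2 * s) / 2))\<^sup>2 = x powr (real d + 2 * s)" for x :: real
      unfolding power2_eq_square powr_add[symmetric] field_sum_of_halves ..
    ultimately show ?thesis by (simp only: power_mult_distrib)
  qed
  have T: "1 / (t ^ d * (\<omega> * \<rho> ^ d)) = (sqrt (1 / \<omega>) * ?h)\<^sup>2"
    using assms by (simp add: power_mult_distrib powr_neg_half_power2 mult_ac)
  let ?N = "sqrt (1 / \<omega>) * ?h * ?D * N"
  have "sqrt (1 / (r ^ d * (\<omega> * \<rho> ^ d)) * (1 / (t ^ d * (\<omega> * \<rho> ^ d))) * ((2 * t * (R * \<rho>)) powr (real d + 2 * s) * N\<^sup>2))
     = sqrt (1 / (r ^ d * (\<omega> * \<rho> ^ d)) * ?N\<^sup>2)"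
    unfolding D T by (simp add: power_mult_distrib mult.assoc)
  also have "... \<le> sqrt (2 ^ d / \<omega>) * ?N * ?h"
    using assms by (intro L2_mean_constant) auto
  also have "... = sqrt (2 ^ d / \<omega>) * sqrt (1 / \<omega>) * (2 * R) powr ((real d + 2 * s) / 2) * N *
      (?h * (t * \<rho>) powr ((real d + 2 * s) / 2) * ?h)"
    by simp
  also have "?h * (t * \<rho>) powr ((real d + 2 * s) / 2) * ?h
     = (t * \<rho>) powr (s - real d / 2)"
    unfolding powr_add[symmetric] by (rule arg_cong) (simp add: field_simps)
  finally show ?thesis .
qed

lemma sob_int_frac:
  assumes "\<sigma> > 0"
  shows "real (sob_int \<sigma>) + sob_frac \<sigma> = \<sigma>" "sob_frac \<sigma> \<ge> 0"
  using assms by (auto simp: sob_frac_def sob_int_def)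

text \<open>One polynomial serves all points of \<open>Y\<close>. The tolerance \<open>\<delta>\<close> absorbs the error of the mollification and is
  independent of \<open>C\<close>. The last conclusion serves the Sobolev embedding, where \<open>\<rho>\<close> is fixed.\<close>

definition local_approx_constant :: "real \<Rightarrow> (real^'d) set \<Rightarrow> real \<Rightarrow> real \<Rightarrow> bool" where
  "local_approx_constant \<sigma> \<Omega> R C \<longleftrightarrow> (\<forall>u\<in>sobolev \<sigma> \<Omega>. \<forall>b \<rho> Y \<delta>. finite Y \<longrightarrow> Y \<noteq> {} \<longrightarrow> 0 < \<rho> \<longrightarrow> Y \<subseteq> star_points \<Omega> R b \<rho> \<longrightarrow> 0 < \<delta> \<longrightarrow>
    (\<exists>P. poly_deg_le (sob_int \<sigma>) P \<and>
      (\<forall>y\<in>Y. \<bar>u y - P y\<bar> \<le> C * \<rho> powr (\<sigma> - real CARD('d) / 2) * sobolev_norm \<sigma> \<Omega> u + \<delta>) \<and>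
      (\<forall>y\<in>Y. \<bar>P y\<bar> \<le> C * (1 + \<rho>) ^ sob_int \<sigma> * \<rho> powr (- (real CARD('d) / 2)) * sobolev_norm \<sigma> \<Omega> u)))"

text \<open>The polynomial is the averaged Taylor polynomial of a mollification of \<open>u\<close> that is within \<open>\<delta>\<close> of \<open>u\<close> at
  the points of \<open>Y\<close>. Its values are bounded by the means of all derivatives up to order \<open>k\<close>, to which the
  \<open>L\<^sub>2\<close> estimate applies as well.\<close>

lemma local_polynomial_approximation:
  fixes \<Omega> :: "(real^'d) set"
  assumes \<Omega>: "open \<Omega>" "bounded \<Omega>" and \<sigma>: "\<sigma> > real CARD('d) / 2" and R: "R \<ge> 0"
  shows "\<exists>C>0. local_approx_constant \<sigma> \<Omega> R C"
proof -
  define d where "d = CARD('d)"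
  define k where "k = sob_int \<sigma>"
  define s where "s = sob_frac \<sigma>"
  define \<gamma> where "\<gamma> = s - real d / 2"
  define \<omega> where "\<omega> = unit_ball_vol (real d)"
  define A where "A = (if s > 0 then sqrt (2 ^ d / \<omega>) * sqrt (1 / \<omega>) * ((2 * (R + 1)) powr ((real d + 2 * s) / 2))
     else sqrt (2 ^ d / \<omega>))"
  define C1 where "C1 = 3 * real (card {is :: 'd list. length is = k}) * (R + 1) ^ k * A / (1 - (1/2) powr (real k + \<gamma>))"
  define C2 where "C2 = (\<Sum>m\<le>k. real (card {is :: 'd list. length is = m})) * (R + 1) ^ k * sqrt (2 ^ d / \<omega>)"
  define C where "C = \<bar>C1\<bar> + \<bar>C2\<bar> + 1"
  have d0: "d > 0" by (simp add: d_def)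
  have \<sigma>0: "\<sigma> > 0" using \<sigma> by (rule order.strict_trans1[rotated]) simp
  have ks: "real k + s = \<sigma>" "s \<ge> 0" using sob_int_frac[OF \<sigma>0] by (auto simp: k_def s_def)
  have \<theta>: "real k + \<gamma> = \<sigma> - real d / 2" "real k + \<gamma> > 0" using ks \<sigma> by (auto simp: \<gamma>_def d_def)
  have \<omega>: "\<omega> > 0" by (simp add: \<omega>_def)
  have A0: "A \<ge> 0" using \<omega> by (auto simp: A_def)
  show ?thesis unfolding local_approx_constant_def
  proof (rule exI[of _ C], intro conjI ballI allI impI)
    show "C > 0" by (simp add: C_def)
    fix u b \<rho> Y \<delta>
    assume u: "u \<in> sobolev \<sigma> \<Omega>" and Y: "finite Y" "Y \<noteq> {}" "Y \<subseteq> star_points \<Omega> R b \<rho>" and \<rho>: "0 < \<rho>" and \<delta>: "0 < (\<delta>::real)"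
    define N where "N = sobolev_norm \<sigma> \<Omega> u"
    \<comment> \<open>\<open>Q\<close> bounds the distance between points of \<open>Y\<close> and of the ball; \<open>H\<close> is the union of the segments between them.\<close>
    define Q where "Q = (R + 1) * \<rho>"
    define B where "B = cball b \<rho>"
    define H where "H = (\<Union>y\<in>Y. (\<lambda>(w, r). y + r *\<^sub>R (w - y)) ` (B \<times> {0..1}))"
    define \<nu> where "\<nu> = uniform_measure lborel B"
    let ?v = "\<lambda>is. zero_ext \<Omega> (weak_deriv \<Omega> is u)"
    have N0: "N \<ge> 0" unfolding N_def by (rule sobolev_inner_self(1))
    have Q0: "Q \<ge> 0" using R \<rho> by (simp add: Q_def)
    have comp: "compact H" unfolding H_def B_def split_beta
      using Y by (intro compact_UN compact_continuous_image compact_Times continuous_intros) auto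
    have segH: "x + r *\<^sub>R (z - x) \<in> H" if "x \<in> Y" "z \<in> B" "0 \<le> r" "r \<le> 1" for x z r
      using that by (force simp: H_def)
    have "H \<subseteq> \<Omega>"
    proof
      fix a assume "a \<in> H"
      then obtain y w r where a: "y \<in> Y" "w \<in> B" "0 \<le> r" "r \<le> 1" "a = y + r *\<^sub>R (w - y)" by (auto simp: H_def)
      then have "a \<in> closed_segment y w" unfolding closed_segment_def
        by (auto simp: algebra_simps intro!: exI[of _ r])
      then show "a \<in> \<Omega>" using a Y unfolding star_points_def B_def by blast
    qed
    have YH: "Y \<subseteq> H" using segH[of _ b 0] \<rho> by (auto simp: B_def)
    have BH: "B \<subseteq> H" using segH[of _ _ 1] Y(2) by force
    have bm: "measure lborel B = \<omega> * \<rho> ^ d" using \<rho> by (simp add: B_def \<omega>_def d_def content_cball)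
    have Bp: "0 < measure lborel B" "emeasure lborel B \<noteq> \<infinity>" and Bs[measurable]: "B \<in> sets borel"
      using bm \<omega> \<rho> emeasure_bounded_finite[of B] by (auto simp: B_def)
    have \<nu>: "prob_space \<nu>" "sets \<nu> = sets borel" and AEB: "AE z in \<nu>. z \<in> B" and Bc: "compact B"
      unfolding \<nu>_def using Bp by (auto intro!: prob_space_uniform_measure AE_uniform_measureI simp: measure_def B_def)
    interpret \<nu>: prob_space \<nu> by fact
    note [measurable_cong] = \<nu>(2)
    have dYB: "norm (z - y) \<le> Q" if "y \<in> Y" "z \<in> B" for y z
    proof -
      have "dist y b \<le> R * \<rho>" using that Y unfolding star_points_def by blast
      moreover have "dist z b \<le> \<rho>" using that by (simp add: B_def dist_commute)
      ultimately show ?thesis using dist_triangle2[of z y b] by (simp add: dist_norm Q_def algebra_simps)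
    qed
    obtain f \<mu> where jet: "jet f" and \<mu>: "prob_space \<mu>" "sets \<mu> = sets borel"
      and near: "AE q in \<mu>. \<forall>a\<in>H. a - q \<in> \<Omega>"
      and fv: "\<And>is a. length is \<le> k \<Longrightarrow> a \<in> H \<Longrightarrow> f is a = (\<integral>q. ?v is (a - q) \<partial>\<mu>)"
      and vint: "\<And>is a. length is \<le> k \<Longrightarrow> integrable \<mu> (\<lambda>q. ?v is (a - q))"
      and vcont: "\<And>is. length is \<le> k \<Longrightarrow> continuous_on UNIV (\<lambda>a. \<integral>q. ?v is (a - q) \<partial>\<mu>)"
      and fu: "\<And>y. y \<in> Y \<Longrightarrow> \<bar>f [] y - u y\<bar> \<le> \<delta>"
      using sobolev_mollification[OF \<Omega> u comp \<open>H \<subseteq> \<Omega>\<close> Y(1) YH \<delta>] unfolding k_def by blast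
    have vL2: "weak_deriv \<Omega> is u \<in> L2_on \<Omega>" if "length is \<le> k" for "is"
      using sobolev_weak_deriv(1)[OF u] that unfolding k_def by blast
    have vm: "?v is \<in> borel_measurable borel" if "length is \<le> k" for "is"
      by (rule L2_on_zero_ext(1)[OF \<Omega> vL2[OF that]])
    have vN: "(\<integral>\<^sup>+y. ennreal ((?v is y)\<^sup>2) \<partial>lborel) \<le> ennreal (N\<^sup>2)" if "length is \<le> k" for "is"
      unfolding L2_on_zero_ext(3)[OF \<Omega> vL2[OF that]] N_def
      using that by (intro ennreal_leI sobolev_inner_self(3)) (simp add: k_def)
    have L2: "(\<integral>\<^sup>+z. ennreal \<bar>f is (x + r *\<^sub>R (z - x))\<bar> \<partial>\<nu>) \<le> ennreal (sqrt (2 ^ d / \<omega>) * N * (t * \<rho>) powr (- (real d / 2)))"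
      if x: "x \<in> Y" and "is": "length is \<le> k" and t: "0 < t" "t \<le> 1" "t/2 \<le> r" "r \<le> t"
      for x "is" and t r :: real
    proof -
      have "(\<integral>\<^sup>+z. ennreal \<bar>f is (x + r *\<^sub>R (z - x))\<bar> \<partial>\<nu>)
         = (\<integral>\<^sup>+z. ennreal \<bar>\<integral>q. ?v is (x + r *\<^sub>R (z - x) - q) \<partial>\<mu>\<bar> \<partial>\<nu>)"
        by (rule nn_integral_cong_AE, use AEB in eventually_elim) (use t in \<open>simp add: fv[OF "is" segH[OF x]]\<close>)
      also have "... \<le> ennreal (sqrt (1 / (r ^ CARD('d) * measure lborel B) * N\<^sup>2))"
        unfolding \<nu>_def by (rule averaged_convolution_L2[OF \<mu> vm vint Bs Bp]) (use t vN "is" in auto)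
      also have "... \<le> ennreal (sqrt (2 ^ d / \<omega>) * N * (t * \<rho>) powr (- (real d / 2)))"
        unfolding bm d_def[symmetric] by (intro ennreal_leI L2_mean_constant t \<rho> \<omega> N0)
      finally show ?thesis .
    qed
    \<comment> \<open>For integer \<open>\<sigma>\<close> the constant is \<open>0\<close>; otherwise it is the mean over the ball contracted by \<open>t\<close>.\<close>
    have osc: "\<exists>c. \<forall>is r. length is = k \<longrightarrow> t/2 \<le> r \<longrightarrow> r \<le> t \<longrightarrow>
        (\<integral>\<^sup>+z. ennreal \<bar>f is (x + r *\<^sub>R (z - x)) - c is\<bar> \<partial>\<nu>) \<le> ennreal (A * N * (t * \<rho>) powr \<gamma>)"
      if x: "x \<in> Y" and t: "0 < t" "t \<le> 1" for x and t :: real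
    proof (cases "s > 0")
      case False
      then have "\<gamma> = - (real d / 2)" using ks by (simp add: \<gamma>_def)
      then show ?thesis using L2[OF x _ t] False by (intro exI[of _ "\<lambda>_. 0"]) (auto simp: A_def)
    next
      case True
      let ?\<phi> = "\<lambda>is a. \<integral>q. ?v is (a - q) \<partial>\<mu>"
      show ?thesis
      proof (intro exI[of _ "\<lambda>is. \<integral>w. ?\<phi> is (x + t *\<^sub>R (w - x)) \<partial>\<nu>"] allI impI)
        fix "is" :: "'d list" and r assume "is": "length is = k" and r: "t/2 \<le> r" "r \<le> t"
        have "is'": "length is \<le> k" using "is" by simp
        have S: "(\<integral>\<^sup>+a. indicator \<Omega> a * (\<integral>\<^sup>+b. indicator \<Omega> b *
           ennreal ((?v is a - ?v is b)\<^sup>2 / dist a b powr (real CARD('d) + 2 * s)) \<partial>lborel) \<partial>lborel) \<le> ennreal (N\<^sup>2)"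
          unfolding N_def s_def by (rule sobolev_slobodeckij_bound[OF \<Omega> u]) (use "is" True in \<open>auto simp: k_def s_def\<close>)
        have "(\<integral>\<^sup>+z. ennreal \<bar>f is (x + r *\<^sub>R (z - x)) - (\<integral>w. ?\<phi> is (x + t *\<^sub>R (w - x)) \<partial>\<nu>)\<bar> \<partial>\<nu>)
          = (\<integral>\<^sup>+z. ennreal \<bar>?\<phi> is (x + r *\<^sub>R (z - x)) - (\<integral>w. ?\<phi> is (x + t *\<^sub>R (w - x)) \<partial>\<nu>)\<bar> \<partial>\<nu>)"
          by (rule nn_integral_cong_AE, use AEB in eventually_elim) (use t r in \<open>simp add: fv[OF "is'" segH[OF x]]\<close>)
        also have "... \<le> ennreal (sqrt (1 / (r ^ CARD('d) * measure lborel B) * (1 / (t ^ CARD('d) * measure lborel B)) *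
            ((2 * t * Q) powr (real CARD('d) + 2 * s) * N\<^sup>2)))"
          unfolding \<nu>_def
        proof (rule averaged_convolution_slobodeckij[OF \<mu> vm[OF "is'"] vint[OF "is'"] Bs Bp, where \<Omega> = \<Omega>])
          show "integrable (uniform_measure lborel B) (\<lambda>z. ?\<phi> is (x + r *\<^sub>R (z - x)))" for r
            unfolding \<nu>_def[symmetric]
            by (rule integrable_continuous_compact_support[OF \<nu> Bc AEB])
               (intro continuous_on_compose2[OF vcont[OF "is'"]] continuous_intros, auto)
          show "AE q in \<mu>. \<forall>z\<in>B. x + r *\<^sub>R (z - x) - q \<in> \<Omega> \<and> x + t *\<^sub>R (z - x) - q \<in> \<Omega>"
            using near by eventually_elim (use t r segH[OF x] in auto)
        qed (use t r dYB[OF x] ks Q0 S \<Omega> in auto)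
        also have "... \<le> ennreal (A * N * (t * \<rho>) powr \<gamma>)"
          unfolding bm d_def[symmetric] Q_def \<gamma>_def A_def if_P[OF True]
          by (intro ennreal_leI slobodeckij_mean_constant t r \<rho> \<omega> N0) (use R in simp)
        finally show "(\<integral>\<^sup>+z. ennreal \<bar>f is (x + r *\<^sub>R (z - x)) - (\<integral>w. ?\<phi> is (x + t *\<^sub>R (w - x)) \<partial>\<nu>)\<bar> \<partial>\<nu>)
           \<le> ennreal (A * N * (t * \<rho>) powr \<gamma>)" .
      qed
    qed
    define P where "P = (\<lambda>x. \<integral>z. taylor_at f k x z 1 \<partial>\<nu>)"
    show "\<exists>P. poly_deg_le (sob_int \<sigma>) P \<and>
      (\<forall>y\<in>Y. \<bar>u y - P y\<bar> \<le> C * \<rho> powr (\<sigma> - real CARD('d) / 2) * sobolev_norm \<sigma> \<Omega> u + \<delta>) \<and>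
      (\<forall>y\<in>Y. \<bar>P y\<bar> \<le> C * (1 + \<rho>) ^ sob_int \<sigma> * \<rho> powr (- (real CARD('d) / 2)) * sobolev_norm \<sigma> \<Omega> u)"
      unfolding N_def[symmetric] k_def[symmetric] d_def[symmetric]
    proof (intro exI[of _ P] conjI ballI)
      show "poly_deg_le k P"
        unfolding P_def by (rule poly_deg_le_averaged_taylor[OF jet \<nu> Bc AEB])
    next
      fix y assume y: "y \<in> Y"
      obtain c :: "real \<Rightarrow> 'd list \<Rightarrow> real" where c: "\<And>t is r. 0 < t \<Longrightarrow> t \<le> 1 \<Longrightarrow> length is = k \<Longrightarrow> t/2 \<le> r \<Longrightarrow> r \<le> t \<Longrightarrow>
        (\<integral>\<^sup>+z. ennreal \<bar>f is (y + r *\<^sub>R (z - y)) - c t is\<bar> \<partial>\<nu>) \<le> ennreal (A * N * (t * \<rho>) powr \<gamma>)"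
        using osc[OF y] by metis
      have "\<bar>f [] y - P y\<bar> \<le> 3 * real (card {is :: 'd list. length is = k}) * Q ^ k * (A * N * \<rho> powr \<gamma>) / (1 - (1/2) powr (real k + \<gamma>))"
        unfolding P_def
      proof (rule averaged_taylor_approx[OF jet \<nu> Bc AEB dYB[OF y], where c = c])
        fix t r :: real and "is" :: "'d list" assume t: "0 < t" "t \<le> 1" "length is = k" "t/2 \<le> r" "r \<le> t"
        have eq: "A * N * (t * \<rho>) powr \<gamma> = A * N * \<rho> powr \<gamma> * t powr \<gamma>"
          using t \<rho> by (simp add: powr_mult)
        show "(\<integral>\<^sup>+z. ennreal \<bar>f is (y + r *\<^sub>R (z - y)) - c t is\<bar> \<partial>\<nu>) \<le> ennreal (A * N * \<rho> powr \<gamma> * t powr \<gamma>)"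
          by (rule c[OF t, unfolded eq])
      qed (use A0 N0 Q0 \<theta> in auto)
      also have "... = C1 * (\<rho> ^ k * \<rho> powr \<gamma>) * N"
        by (simp add: C1_def Q_def power_mult_distrib mult_ac)
      also have "\<rho> ^ k * \<rho> powr \<gamma> = \<rho> powr (\<sigma> - real d / 2)"
        using \<rho> by (simp add: \<theta>(1)[symmetric] powr_add powr_realpow)
      also have "C1 * \<rho> powr (\<sigma> - real d / 2) * N \<le> C * \<rho> powr (\<sigma> - real d / 2) * N"
        using N0 by (intro mult_right_mono) (auto simp: C_def)
      finally show "\<bar>u y - P y\<bar> \<le> C * \<rho> powr (\<sigma> - real d / 2) * N + \<delta>"
        using fu[OF y] by linarith
    next
      fix y assume y: "y \<in> Y"
      let ?K = "sqrt (2 ^ d / \<omega>) * N * (1 * \<rho>) powr (- (real d / 2))"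
      have K0: "?K \<ge> 0" using N0 \<omega> by simp
      have fcont: "continuous_on UNIV (f is)" for "is"
        using jet_continuous_on[OF jet continuous_on_id] by simp
      have [measurable]: "f is \<in> borel_measurable borel" for "is"
        by (rule borel_measurable_continuous_onI) (rule fcont)
      have fN: "(\<integral>\<^sup>+z. ennreal \<bar>f is z\<bar> \<partial>\<nu>) \<le> ennreal ?K" if "length is \<le> k" for "is"
        using L2[OF y that, of 1 1] by simp
      have "ennreal \<bar>P y\<bar> \<le> (\<integral>\<^sup>+z. ennreal \<bar>taylor_at f k y z 1\<bar> \<partial>\<nu>)"
        unfolding P_def real_norm_def[symmetric]
        by (intro integral_norm_bound_ennreal integrable_continuous_compact_support[OF \<nu> Bc AEB]
              continuous_on_taylor_at jet continuous_intros)
      also have "... \<le> (\<integral>\<^sup>+z. (\<Sum>m\<le>k. \<Sum>is | length is = m. ennreal ((1 + Q) ^ k) * ennreal \<bar>f is z\<bar>) \<partial>\<nu>)"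
      proof (rule nn_integral_mono_AE, use AEB in eventually_elim)
        fix z assume z: "z \<in> B"
        have "\<bar>taylor_at f k y z 1\<bar> \<le> (\<Sum>m\<le>k. \<Sum>is | length is = m. (1 + Q) ^ k * \<bar>f is z\<bar>)"
          unfolding taylor_at_def
        proof (rule order.trans[OF sum_abs sum_mono])
          fix m assume m: "m \<in> {..k}"
          have "\<bar>(- 1) ^ m / fact m * dir_deriv f m (z - y) (y + 1 *\<^sub>R (z - y))\<bar> \<le> 1 * \<bar>dir_deriv f m (z - y) z\<bar>"
            unfolding abs_mult by (intro mult_mono) (auto simp: abs_divide power_abs divide_le_eq fact_ge_1)
          also have "\<bar>dir_deriv f m (z - y) z\<bar> \<le> (\<Sum>is | length is = m. (1 + Q) ^ k * \<bar>f is z\<bar>)"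
            unfolding dir_deriv_def
          proof (rule order.trans[OF sum_abs sum_mono])
            fix "is" :: "'d list" assume "is": "is \<in> {is. length is = m}"
            have "\<bar>monomial is (z - y)\<bar> \<le> Q ^ length is" by (rule abs_monomial_le) (rule dYB[OF y z])
            also have "... \<le> (1 + Q) ^ length is" using Q0 by (intro power_mono) auto
            also have "... \<le> (1 + Q) ^ k" using Q0 m "is" by (intro power_increasing) auto
            finally show "\<bar>monomial is (z - y) * f is z\<bar> \<le> (1 + Q) ^ k * \<bar>f is z\<bar>"
              unfolding abs_mult by (intro mult_right_mono) auto
          qed
          finally show "\<bar>(- 1) ^ m / fact m * dir_deriv f m (z - y) (y + 1 *\<^sub>R (z - y))\<bar>
            \<le> (\<Sum>is | length is = m. (1 + Q) ^ k * \<bar>f is z\<bar>)" by simp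
        qed
        then show "ennreal \<bar>taylor_at f k y z 1\<bar> \<le> (\<Sum>m\<le>k. \<Sum>is | length is = m. ennreal ((1 + Q) ^ k) * ennreal \<bar>f is z\<bar>)"
          using Q0 by (simp add: ennreal_mult'[symmetric] ennreal_leI sum_nonneg)
      qed
      also have "... = (\<Sum>m\<le>k. \<Sum>is | length is = m. ennreal ((1 + Q) ^ k) * (\<integral>\<^sup>+z. ennreal \<bar>f is z\<bar> \<partial>\<nu>))"
        by (subst nn_integral_sum, simp, intro sum.cong refl, subst nn_integral_sum, simp, intro sum.cong refl nn_integral_cmult, simp)
      also have "... \<le> (\<Sum>m\<le>k. \<Sum>is\<in>{is :: 'd list. length is = m}. ennreal ((1 + Q) ^ k) * ennreal ?K)"
        by (intro sum_mono mult_left_mono fN) auto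
      also have "... = ennreal (\<Sum>m\<le>k. \<Sum>is\<in>{is :: 'd list. length is = m}. (1 + Q) ^ k * ?K)"
        using Q0 K0 by (simp add: ennreal_mult'[symmetric] sum_nonneg del: sum_constant)
      finally have "\<bar>P y\<bar> \<le> (\<Sum>m\<le>k. \<Sum>is\<in>{is :: 'd list. length is = m}. (1 + Q) ^ k * ?K)"
        using Q0 K0 by (subst (asm) ennreal_le_iff) (auto intro!: sum_nonneg)
      also have "... = (\<Sum>m\<le>k. real (card {is :: 'd list. length is = m})) * ((1 + Q) ^ k * ?K)"
        by (simp add: sum_distrib_right)
      also have "... \<le> (\<Sum>m\<le>k. real (card {is :: 'd list. length is = m})) * (((R + 1) * (1 + \<rho>)) ^ k * ?K)"
        using R \<rho> K0 Q0 by (intro mult_left_mono mult_right_mono power_mono sum_nonneg) (auto simp: Q_def algebra_simps)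
      also have "... = C2 * (1 + \<rho>) ^ k * \<rho> powr (- (real d / 2)) * N"
        by (simp add: C2_def power_mult_distrib mult_ac)
      also have "... \<le> C * (1 + \<rho>) ^ k * \<rho> powr (- (real d / 2)) * N"
        using N0 \<rho> by (intro mult_right_mono) (auto simp: C_def)
      finally show "\<bar>P y\<bar> \<le> C * (1 + \<rho>) ^ k * \<rho> powr (- (real d / 2)) * N" .
    qed
  qed
qed

section \<open>Sobolev embedding and the sampling inequality\<close>

text \<open>The approximating polynomial on a visible ball of fixed radius is itself bounded by the norm.\<close>

lemma sobolev_embedding:
  fixes \<Omega> :: "(real^'d) set"
  assumes dom: "bounded_lipschitz_domain \<Omega>" and \<tau>: "\<tau> > real CARD('d) / 2"
  shows "\<exists>C>0. \<forall>u\<in>sobolev \<tau> \<Omega>. \<forall>y\<in>\<Omega>. \<bar>u y\<bar> \<le> C * sobolev_norm \<tau> \<Omega> u"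
proof -
  have \<Omega>: "open \<Omega>" "bounded \<Omega>" using dom unfolding bounded_lipschitz_domain_def by auto
  obtain R \<rho> where R: "R \<ge> 1" and \<rho>: "\<rho> > 0"
    and cone: "\<And>y. y \<in> \<Omega> \<Longrightarrow> \<exists>b. y \<in> star_points \<Omega> R b \<rho>"
    by (rule bounded_lipschitz_domain_star_points[OF dom]) auto
  have "R \<ge> 0" using R by simp
  obtain CL where CL: "CL > 0" "local_approx_constant \<tau> \<Omega> R CL"
    using local_polynomial_approximation[OF \<Omega> \<tau> \<open>R \<ge> 0\<close>] by blast
  define C where "C = CL * \<rho> powr (\<tau> - real CARD('d) / 2) + CL * (1 + \<rho>) ^ sob_int \<tau> * \<rho> powr (- (real CARD('d) / 2))"
  have "C > 0" using CL \<rho> by (simp add: C_def add_pos_pos)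
  moreover have "\<bar>u y\<bar> \<le> C * sobolev_norm \<tau> \<Omega> u" if u: "u \<in> sobolev \<tau> \<Omega>" and y: "y \<in> \<Omega>" for u y
  proof (rule field_le_epsilon)
    fix \<delta> :: real assume \<delta>: "\<delta> > 0"
    obtain b where "y \<in> star_points \<Omega> R b \<rho>" using cone[OF y] by blast
    then obtain P where "\<bar>u y - P y\<bar> \<le> CL * \<rho> powr (\<tau> - real CARD('d) / 2) * sobolev_norm \<tau> \<Omega> u + \<delta>"
      "\<bar>P y\<bar> \<le> CL * (1 + \<rho>) ^ sob_int \<tau> * \<rho> powr (- (real CARD('d) / 2)) * sobolev_norm \<tau> \<Omega> u"
      using CL(2)[unfolded local_approx_constant_def, rule_format, OF u, of "{y}" \<rho> b \<delta>] \<rho> \<delta> by auto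
    then show "\<bar>u y\<bar> \<le> C * sobolev_norm \<tau> \<Omega> u + \<delta>"
      unfolding C_def distrib_right by linarith
  qed
  ultimately show ?thesis by blast
qed

text \<open>For small \<open>h\<close>, on a visible ball of radius \<open>\<rho> = h / c\<close> both functions are close to polynomials of degree
  \<open>k\<close>. The difference of these polynomials is small at the points of \<open>X\<close>, which form a norming set for the
  ball, hence small on the ball and at \<open>y\<close>. For \<open>h > h0\<close> the power of \<open>h\<close> is bounded below and the Sobolev
  embedding suffices.\<close>

lemma sobolev_sampling:
  fixes \<Omega> :: "(real^'d) set"
  assumes dom: "bounded_lipschitz_domain \<Omega>" and \<tau>: "\<tau> > real CARD('d) / 2"
  shows "\<exists>C>0. \<forall>u1\<in>sobolev \<tau> \<Omega>. \<forall>u2\<in>sobolev \<tau> \<Omega>. \<forall>X h. finite X \<longrightarrow> 0 < h \<longrightarrow>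
     (\<forall>x\<in>\<Omega>. \<exists>z\<in>X. dist x z \<le> h) \<longrightarrow> (\<forall>z\<in>X. u1 z = u2 z) \<longrightarrow>
     (\<forall>y\<in>\<Omega>. \<bar>u1 y - u2 y\<bar> \<le> C * h powr (\<tau> - real CARD('d) / 2) * (sobolev_norm \<tau> \<Omega> u1 + sobolev_norm \<tau> \<Omega> u2))"
proof -
  let ?n = "sobolev_norm \<tau> \<Omega>"
  let ?\<theta> = "\<tau> - real CARD('d) / 2"
  obtain Ce where Ce: "Ce > 0" "\<And>u y. u \<in> sobolev \<tau> \<Omega> \<Longrightarrow> y \<in> \<Omega> \<Longrightarrow> \<bar>u y\<bar> \<le> Ce * ?n u"
    using sobolev_embedding[OF assms] by blast
  have \<Omega>: "open \<Omega>" "bounded \<Omega>" using dom unfolding bounded_lipschitz_domain_def by auto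
  obtain R \<rho>0 where R: "R \<ge> 1" and \<rho>0: "\<rho>0 > 0"
    and cone: "\<And>y \<rho>. y \<in> \<Omega> \<Longrightarrow> 0 < \<rho> \<Longrightarrow> \<rho> \<le> \<rho>0 \<Longrightarrow> \<exists>b. y \<in> star_points \<Omega> R b \<rho>"
    by (rule bounded_lipschitz_domain_star_points[OF dom], rule that)
  have "R \<ge> 0" using R by simp
  obtain CL where CL: "CL > 0" "local_approx_constant \<tau> \<Omega> R CL"
    using local_polynomial_approximation[OF \<Omega> \<tau> \<open>R \<ge> 0\<close>] by blast
  obtain c where c: "c > 0" "c \<le> 1" and norming: "\<And>P (b::real^'d) \<rho> h X m. poly_deg_le (sob_int \<tau>) P \<Longrightarrow> 0 < h \<Longrightarrow> h \<le> c * \<rho> \<Longrightarrow>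
      (\<forall>x\<in>cball b \<rho>. \<exists>z\<in>X. dist x z \<le> h) \<Longrightarrow> (\<forall>z\<in>X \<inter> cball b \<rho>. \<bar>P z\<bar> \<le> m) \<Longrightarrow>
      (\<forall>x\<in>cball b \<rho>. \<bar>P x\<bar> \<le> 2 * m)"
    using poly_deg_le_norming_set[where k = "sob_int \<tau>"] by blast
  obtain C1 where C1: "C1 > 0" "\<And>P (b::real^'d) \<rho> M y. poly_deg_le (sob_int \<tau>) P \<Longrightarrow> \<rho> > 0 \<Longrightarrow> dist y b \<le> R * \<rho> \<Longrightarrow>
      (\<forall>x\<in>cball b \<rho>. \<bar>P x\<bar> \<le> M) \<Longrightarrow> \<bar>P y\<bar> \<le> C1 * M"
    using poly_deg_le_extrapolate[where R = R and k = "sob_int \<tau>"] by blast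
  define Cf where "Cf = (1 + 2 * C1) * CL * (1 / c) powr ?\<theta>"
  have fine: "\<bar>u1 y - u2 y\<bar> \<le> Cf * h powr ?\<theta> * (?n u1 + ?n u2)"
    if u: "u1 \<in> sobolev \<tau> \<Omega>" "u2 \<in> sobolev \<tau> \<Omega>" and X: "finite X" and h: "0 < h" "h \<le> c * \<rho>0"
      and dense: "\<forall>x\<in>\<Omega>. \<exists>z\<in>X. dist x z \<le> h" and eq: "\<forall>z\<in>X. u1 z = u2 z" and y: "y \<in> \<Omega>"
    for u1 u2 X h y
  proof -
    define \<rho> where "\<rho> = h / c"
    have \<rho>: "0 < \<rho>" "\<rho> \<le> \<rho>0" "h \<le> c * \<rho>" using h c by (auto simp: \<rho>_def field_simps)
    obtain b where b: "y \<in> star_points \<Omega> R b \<rho>" using cone[OF y \<rho>(1,2)] by blast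
    have sub: "cball b \<rho> \<subseteq> \<Omega>"
    proof
      fix w assume "w \<in> cball b \<rho>"
      then have "closed_segment y w \<subseteq> \<Omega>" using b unfolding star_points_def by blast
      then show "w \<in> \<Omega>" by auto
    qed
    let ?Y = "insert y (X \<inter> cball b \<rho>)"
    have "x \<in> star_points \<Omega> R b \<rho>" if "x \<in> cball b \<rho>" for x
    proof -
      have "\<rho> * 1 \<le> \<rho> * R" using R \<rho> by (intro mult_left_mono) auto
      then have "dist x b \<le> R * \<rho>" using that by (simp add: dist_commute mult.commute)
      moreover have "closed_segment x w \<subseteq> \<Omega>" if "w \<in> cball b \<rho>" for w
        using closed_segment_subset[of x "cball b \<rho>" w] \<open>x \<in> cball b \<rho>\<close> that sub by auto
      ultimately show ?thesis unfolding star_points_def by blast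
    qed
    then have Y: "finite ?Y" "?Y \<noteq> {}" "?Y \<subseteq> star_points \<Omega> R b \<rho>" using b X by auto
    let ?E = "CL * \<rho> powr ?\<theta> * (?n u1 + ?n u2)"
    have "\<bar>u1 y - u2 y\<bar> \<le> (1 + 2 * C1) * ?E"
    proof (rule field_le_epsilon)
      fix e :: real assume e: "e > 0"
      define \<delta> where "\<delta> = e / (2 * (1 + 2 * C1))"
      have \<delta>: "\<delta> > 0" "(1 + 2 * C1) * (2 * \<delta>) = e" using e C1 by (auto simp: \<delta>_def field_simps)
      obtain P1 where P1: "poly_deg_le (sob_int \<tau>) P1"
        "\<And>y. y \<in> ?Y \<Longrightarrow> \<bar>u1 y - P1 y\<bar> \<le> CL * \<rho> powr ?\<theta> * ?n u1 + \<delta>"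
        using CL(2)[unfolded local_approx_constant_def, rule_format, OF u(1) Y(1,2) \<rho>(1) Y(3) \<delta>(1)] by blast
      obtain P2 where P2: "poly_deg_le (sob_int \<tau>) P2"
        "\<And>y. y \<in> ?Y \<Longrightarrow> \<bar>u2 y - P2 y\<bar> \<le> CL * \<rho> powr ?\<theta> * ?n u2 + \<delta>"
        using CL(2)[unfolded local_approx_constant_def, rule_format, OF u(2) Y(1,2) \<rho>(1) Y(3) \<delta>(1)] by blast
      let ?P = "\<lambda>x. P1 x - P2 x"
      have P: "poly_deg_le (sob_int \<tau>) ?P" by (rule poly_deg_le_diff) (rule P1 P2)+
      define m where "m = ?E + 2 * \<delta>"
      have near: "\<bar>(u1 x - u2 x) - ?P x\<bar> \<le> m" if "x \<in> ?Y" for x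
        using P1(2)[OF that] P2(2)[OF that] unfolding m_def distrib_left by linarith
      have "\<bar>?P z\<bar> \<le> m" if "z \<in> X \<inter> cball b \<rho>" for z
        using near[of z] eq that by force
      then have "\<forall>x\<in>cball b \<rho>. \<bar>?P x\<bar> \<le> 2 * m"
        using norming[OF P h(1) \<rho>(3), of b X m] dense sub by blast
      moreover have "dist y b \<le> R * \<rho>" using b unfolding star_points_def by blast
      ultimately have "\<bar>?P y\<bar> \<le> C1 * (2 * m)" using C1(2)[OF P \<rho>(1)] by blast
      then have "\<bar>u1 y - u2 y\<bar> \<le> m + C1 * (2 * m)" using near[of y] by simp
      also have "... = (1 + 2 * C1) * ?E + (1 + 2 * C1) * (2 * \<delta>)" by (simp add: m_def algebra_simps)
      finally show "\<bar>u1 y - u2 y\<bar> \<le> (1 + 2 * C1) * ?E + e" unfolding \<delta>(2) .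
    qed
    also have "\<rho> powr ?\<theta> = (1 / c) powr ?\<theta> * h powr ?\<theta>"
      using h c by (simp add: \<rho>_def powr_divide)
    finally show ?thesis by (simp add: Cf_def mult_ac)
  qed
  have Cf: "Cf > 0" using C1 CL c by (simp add: Cf_def)
  define h0 where "h0 = c * \<rho>0"
  have h0: "h0 > 0" using c \<rho>0 by (simp add: h0_def)
  define C where "C = Cf + Ce / h0 powr ?\<theta>"
  have "C > 0" using Ce Cf h0 by (simp add: C_def add_pos_pos)
  moreover have "\<bar>u1 y - u2 y\<bar> \<le> C * h powr ?\<theta> * (?n u1 + ?n u2)"
    if u: "u1 \<in> sobolev \<tau> \<Omega>" "u2 \<in> sobolev \<tau> \<Omega>" and X: "finite X" and h: "0 < h"
      and dense: "\<forall>x\<in>\<Omega>. \<exists>z\<in>X. dist x z \<le> h" and eq: "\<forall>z\<in>X. u1 z = u2 z" and y: "y \<in> \<Omega>"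
    for u1 u2 X h y
  proof -
    let ?N = "?n u1 + ?n u2"
    have N0: "?N \<ge> 0" by (intro add_nonneg_nonneg sobolev_inner_self(1))
    have "\<bar>u1 y - u2 y\<bar> \<le> (Cf * h powr ?\<theta> + Ce / h0 powr ?\<theta> * h powr ?\<theta>) * ?N"
    proof (cases "h \<le> h0")
      case True
      have "\<bar>u1 y - u2 y\<bar> \<le> Cf * h powr ?\<theta> * ?N" by (rule fine[OF u X h True[unfolded h0_def] dense eq y])
      also have "... \<le> (Cf * h powr ?\<theta> + Ce / h0 powr ?\<theta> * h powr ?\<theta>) * ?N"
        using N0 Ce by (intro mult_right_mono) auto
      finally show ?thesis .
    next
      case False
      then have "h0 powr ?\<theta> \<le> h powr ?\<theta>" using h0 \<tau> by (intro powr_mono2) auto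
      then have "1 \<le> h powr ?\<theta> / h0 powr ?\<theta>" using h0 by simp
      then have "Ce * 1 \<le> Ce * (h powr ?\<theta> / h0 powr ?\<theta>)" using Ce by (intro mult_left_mono) auto
      then have "Ce \<le> Cf * h powr ?\<theta> + Ce / h0 powr ?\<theta> * h powr ?\<theta>"
        using Cf by (simp add: add_increasing)
      then have "Ce * ?N \<le> (Cf * h powr ?\<theta> + Ce / h0 powr ?\<theta> * h powr ?\<theta>) * ?N"
        using N0 by (rule mult_right_mono)
      moreover have "\<bar>u1 y - u2 y\<bar> \<le> Ce * ?N"
        using Ce(2)[OF u(1) y] Ce(2)[OF u(2) y] unfolding distrib_left by linarith
      ultimately show ?thesis by linarith
    qed
    then show ?thesis by (simp add: C_def distrib_right)
  qed
  ultimately show ?thesis by blast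
qed

text \<open>The fill distance is positive because a nonempty open set is not contained in the finite set \<open>X\<close>.\<close>

lemma fill_distance_dense:
  fixes \<Omega> :: "(real^'d) set"
  assumes "open \<Omega>" "bounded \<Omega>" "\<Omega> \<noteq> {}" "finite X" "X \<noteq> {}"
  shows "0 < fill_distance X \<Omega>" "\<And>x. x \<in> \<Omega> \<Longrightarrow> \<exists>z\<in>X. dist x z \<le> fill_distance X \<Omega>"
proof -
  let ?m = "\<lambda>x. Min ((\<lambda>y. norm (x - y)) ` X)"
  obtain z0 where z0: "z0 \<in> X" using assms by blast
  obtain K where K: "\<And>x. x \<in> \<Omega> \<Longrightarrow> norm x \<le> K" using assms(2) unfolding bounded_iff by blast
  have "?m x \<le> K + norm z0" if "x \<in> \<Omega>" for x
  proof -
    have "?m x \<le> norm (x - z0)" using assms z0 by (intro Min_le) auto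
    also have "... \<le> norm x + norm z0" by (rule norm_triangle_ineq4)
    finally show ?thesis using K[OF that] by simp
  qed
  then have "bdd_above (?m ` \<Omega>)" by (rule bdd_aboveI2)
  then have le: "?m x \<le> fill_distance X \<Omega>" if "x \<in> \<Omega>" for x
    unfolding fill_distance_def using that by (intro cSUP_upper)
  show "\<exists>z\<in>X. dist x z \<le> fill_distance X \<Omega>" if "x \<in> \<Omega>" for x
  proof -
    have "?m x \<in> (\<lambda>y. norm (x - y)) ` X" using assms by (intro Min_in) auto
    then show ?thesis using le[OF that] by (auto simp: dist_norm)
  qed
  have "\<not> \<Omega> \<subseteq> X"
    using assms finite_subset finite_imp_not_open by blast
  then obtain x where x: "x \<in> \<Omega>" "x \<notin> X" by blast
  then have "0 < ?m x" using assms by (auto simp: Min_gr_iff)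
  then show "0 < fill_distance X \<Omega>" using le[OF x(1)] by simp
qed

lemma entry_functional_eq: "entry_functional F x (k, i, j) M = F M (x k) $ i $ j"
  by (simp add: entry_functional_def matrix_vector_mul_component inner_axis' inner_axis)

lemma mat_inner_component_le:
  assumes "\<And>i j. ip (\<lambda>x. M x $ i $ j) (\<lambda>x. M x $ i $ j) \<ge> 0"
  shows "ip_norm ip (\<lambda>x. M x $ i $ j) \<le> ip_norm (mat_inner ip) M" "ip_norm (mat_inner ip) M \<ge> 0"
proof -
  let ?q = "\<lambda>i j. ip (\<lambda>x. M x $ i $ j) (\<lambda>x. M x $ i $ j)"
  have "?q i j \<le> (\<Sum>j\<in>UNIV. ?q i j)"
    by (rule member_le_sum[of j UNIV "\<lambda>j. ?q i j"]) (auto simp: assms)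
  also have "... \<le> (\<Sum>i\<in>UNIV. \<Sum>j\<in>UNIV. ?q i j)"
    by (rule member_le_sum[of i UNIV "\<lambda>i. \<Sum>j\<in>UNIV. ?q i j"]) (auto simp: assms intro!: sum_nonneg)
  finally show "ip_norm ip (\<lambda>x. M x $ i $ j) \<le> ip_norm (mat_inner ip) M"
    by (simp add: ip_norm_def mat_inner_def)
  show "ip_norm (mat_inner ip) M \<ge> 0"
    unfolding ip_norm_def mat_inner_def by (intro real_sqrt_ge_zero sum_nonneg assms)
qed

lemma mat_inner_norm_mono:
  assumes "a > 0"
    and p: "\<And>i j. ip (\<lambda>x. M x $ i $ j) (\<lambda>x. M x $ i $ j) \<ge> 0"
    and q: "\<And>i j. iq (\<lambda>x. M x $ i $ j) (\<lambda>x. M x $ i $ j) \<ge> 0"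
    and le: "\<And>i j. a * ip_norm ip (\<lambda>x. M x $ i $ j) \<le> ip_norm iq (\<lambda>x. M x $ i $ j)"
  shows "a * ip_norm (mat_inner ip) M \<le> ip_norm (mat_inner iq) M"
proof -
  have "a\<^sup>2 * ip (\<lambda>x. M x $ i $ j) (\<lambda>x. M x $ i $ j) \<le> iq (\<lambda>x. M x $ i $ j) (\<lambda>x. M x $ i $ j)" for i j
  proof -
    have "(a * ip_norm ip (\<lambda>x. M x $ i $ j))\<^sup>2 \<le> (ip_norm iq (\<lambda>x. M x $ i $ j))\<^sup>2"
      using le assms(1) p by (intro power_mono) (auto simp: ip_norm_def)
    then show ?thesis using p q by (simp add: ip_norm_def power_mult_distrib)
  qed
  then have "a\<^sup>2 * mat_inner ip M M \<le> mat_inner iq M M"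
    unfolding mat_inner_def sum_distrib_left by (intro sum_mono)
  then have "sqrt (a\<^sup>2 * mat_inner ip M M) \<le> sqrt (mat_inner iq M M)" by (rule real_sqrt_le_mono)
  then show ?thesis using assms(1) by (simp add: ip_norm_def real_sqrt_mult)
qed

section \<open>Error of the optimal recovery\<close>

theorem theorem6p2:
  fixes \<Omega> :: "(real^'d) set"
    and \<sigma> \<tau> :: real
    and W :: "(real^('n::{finite,linorder})^('n::{finite,linorder})) set"
    and I :: "('n::{finite,linorder} \<times> 'n) set"
    and F :: "(real^'d \<Rightarrow> real^('n::{finite,linorder})^('n::{finite,linorder})) \<Rightarrow> (real^'d \<Rightarrow> real^('n::{finite,linorder})^('n::{finite,linorder}))"
  assumes "bounded_lipschitz_domain \<Omega>"
    and "\<sigma> > real CARD('d) / 2" and "\<tau> > real CARD('d) / 2"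
    and "(W = UNIV \<and> I = UNIV) \<or> (W = {A. transpose A = A} \<and> I = {(i, j). i \<le> j})"
    and "bounded_linear_operator
           (mat_sobolev \<sigma> \<Omega> W) (ip_norm (mat_inner (sobolev_inner \<sigma> \<Omega>)))
           (mat_sobolev \<tau> \<Omega> W) (ip_norm (mat_inner (sobolev_inner \<tau> \<Omega>))) F"
  shows
    "(\<forall>N x. N \<ge> 1 \<longrightarrow> x ` {1..N} \<subseteq> \<Omega> \<longrightarrow>
        (\<forall>l\<in>{1..N} \<times> I.
           in_dual (mat_sobolev \<sigma> \<Omega> W) (ip_norm (mat_inner (sobolev_inner \<sigma> \<Omega>)))
             (entry_functional F x l))) \<and>
     (\<forall>ip \<Phi>.
        inner_product_on (sobolev \<sigma> \<Omega>) ip \<longrightarrow>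
        equivalent_norms_on (sobolev \<sigma> \<Omega>) (ip_norm (sobolev_inner \<sigma> \<Omega>)) (ip_norm ip) \<longrightarrow>
        reproducing_kernel \<Omega> W (mat_sobolev \<sigma> \<Omega> W) (mat_inner ip) \<Phi> \<longrightarrow>
        (\<exists>C>0. \<forall>N x. N \<ge> 1 \<longrightarrow> x ` {1..N} \<subseteq> \<Omega> \<longrightarrow>
           lin_indep_functionals (mat_sobolev \<sigma> \<Omega> W) ({1..N} \<times> I) (entry_functional F x) \<longrightarrow>
           (\<forall>M\<in>mat_sobolev \<sigma> \<Omega> W. \<forall>S.
              is_optimal_recovery (mat_sobolev \<sigma> \<Omega> W) (ip_norm (mat_inner ip))
                ({1..N} \<times> I) (entry_functional F x) M S \<longrightarrow>
              mat_Linf_norm \<Omega> (\<lambda>y. F M y - F S y) \<le>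
                ereal (C * fill_distance (x ` {1..N}) \<Omega> powr (\<tau> - real CARD('d) / 2)
                         * ip_norm (mat_inner ip) M))))"
proof -
  note dom = assms(1)
  let ?V = "mat_sobolev \<sigma> \<Omega> W"
  let ?n\<sigma> = "ip_norm (mat_inner (sobolev_inner \<sigma> \<Omega>))"
  let ?n\<tau> = "ip_norm (mat_inner (sobolev_inner \<tau> \<Omega>))"
  let ?\<theta> = "\<tau> - real CARD('d) / 2"
  have \<Omega>: "open \<Omega>" "bounded \<Omega>" "\<Omega> \<noteq> {}" using dom unfolding bounded_lipschitz_domain_def by auto
  have FV: "F M \<in> mat_sobolev \<tau> \<Omega> W" if "M \<in> ?V" for M
    using assms(5) that unfolding bounded_linear_operator_def by blast
  have Fadd: "F (\<lambda>x. u x + v x) = (\<lambda>y. F u y + F v y)" if "u \<in> ?V" "v \<in> ?V" for u v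
    using assms(5) that unfolding bounded_linear_operator_def by blast
  have Fscale: "F (\<lambda>x. c *\<^sub>R u x) = (\<lambda>y. c *\<^sub>R F u y)" if "u \<in> ?V" for c u
    using assms(5) that unfolding bounded_linear_operator_def by blast
  obtain B0 where B0: "\<And>u. u \<in> ?V \<Longrightarrow> ?n\<tau> (F u) \<le> B0 * ?n\<sigma> u"
    using assms(5) unfolding bounded_linear_operator_def by blast
  define B where "B = \<bar>B0\<bar>"
  have comp: "(\<lambda>x. M x $ i $ j) \<in> sobolev \<rho> \<Omega>" if "M \<in> mat_sobolev \<rho> \<Omega> W" for M \<rho> i j
    using that unfolding mat_sobolev_def by blast
  have si0: "sobolev_inner \<rho> \<Omega> u u \<ge> 0" for \<rho> u
    unfolding sobolev_inner_self(2)[symmetric] by simp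
  have n0: "?n\<sigma> M \<ge> 0" for M by (rule mat_inner_component_le(2)) (rule si0)
  have B: "?n\<tau> (F u) \<le> B * ?n\<sigma> u" if "u \<in> ?V" for u
  proof -
    have "B0 * ?n\<sigma> u \<le> B * ?n\<sigma> u" unfolding B_def by (intro mult_right_mono n0) simp
    then show ?thesis using B0[OF that] by linarith
  qed
  have FB: "sobolev_norm \<tau> \<Omega> (\<lambda>x. F u x $ i $ j) \<le> B * ?n\<sigma> u" if "u \<in> ?V" for u i j
  proof -
    have "sobolev_norm \<tau> \<Omega> (\<lambda>x. F u x $ i $ j) \<le> ?n\<tau> (F u)"
      by (rule mat_inner_component_le(1)) (rule si0)
    then show ?thesis using B[OF that] by linarith
  qed
  show ?thesis
  proof (intro conjI allI impI ballI)
    fix N x l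
    assume x: "x ` {1..N} \<subseteq> \<Omega>" and l: "l \<in> {1..N::nat} \<times> I"
    obtain k i j where l': "l = (k, i, j)" by (cases l) auto
    have xk: "x k \<in> \<Omega>" using x l l' by auto
    obtain C where C: "C > 0" "\<forall>u\<in>sobolev \<tau> \<Omega>. \<forall>y\<in>\<Omega>. \<bar>u y\<bar> \<le> C * sobolev_norm \<tau> \<Omega> u"
      using sobolev_embedding[OF dom assms(3)] by blast
    have "\<bar>F u (x k) $ i $ j\<bar> \<le> C * B * ?n\<sigma> u" if u: "u \<in> ?V" for u
    proof -
      have "\<bar>F u (x k) $ i $ j\<bar> \<le> C * sobolev_norm \<tau> \<Omega> (\<lambda>x. F u x $ i $ j)"
        using C(2)[rule_format, OF comp[OF FV[OF u], of i j] xk] .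
      also have "... \<le> C * (B * ?n\<sigma> u)" using C(1) FB[OF u] by (intro mult_left_mono) auto
      finally show ?thesis by (simp add: mult.assoc)
    qed
    then show "in_dual ?V ?n\<sigma> (entry_functional F x l)"
      unfolding in_dual_def l' entry_functional_eq
      by (intro conjI ballI allI exI[of _ "C * B"]) (simp_all add: Fadd Fscale)
  next
    fix ip \<Phi>
    assume ip: "inner_product_on (sobolev \<sigma> \<Omega>) ip"
      and eqv: "equivalent_norms_on (sobolev \<sigma> \<Omega>) (sobolev_norm \<sigma> \<Omega>) (ip_norm ip)"
    let ?n = "ip_norm (mat_inner ip)"
    obtain a where a: "a > 0" "\<And>u. u \<in> sobolev \<sigma> \<Omega> \<Longrightarrow> a * sobolev_norm \<sigma> \<Omega> u \<le> ip_norm ip u"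
      using eqv unfolding equivalent_norms_on_def by blast
    have ip0: "ip (\<lambda>x. M x $ i $ j) (\<lambda>x. M x $ i $ j) \<ge> 0" if "M \<in> ?V" for M i j
      using ip comp[OF that] unfolding inner_product_on_def by blast
    have na: "?n\<sigma> M \<le> ?n M / a" if "M \<in> ?V" for M
    proof -
      have "a * ?n\<sigma> M \<le> ?n M"
        by (rule mat_inner_norm_mono[OF a(1) si0 ip0[OF that] a(2)]) (rule comp[OF that])
      then show ?thesis using a(1) by (simp add: pos_le_divide_eq mult.commute)
    qed
    obtain Cs where Cs: "Cs > 0" "\<forall>u1\<in>sobolev \<tau> \<Omega>. \<forall>u2\<in>sobolev \<tau> \<Omega>. \<forall>X h. finite X \<longrightarrow> 0 < h \<longrightarrow>
     (\<forall>x\<in>\<Omega>. \<exists>z\<in>X. dist x z \<le> h) \<longrightarrow> (\<forall>z\<in>X. u1 z = u2 z) \<longrightarrow>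
     (\<forall>y\<in>\<Omega>. \<bar>u1 y - u2 y\<bar> \<le> Cs * h powr ?\<theta> * (sobolev_norm \<tau> \<Omega> u1 + sobolev_norm \<tau> \<Omega> u2))"
      using sobolev_sampling[OF dom assms(3)] by (elim exE conjE) (rule that)
    define C where "C = Cs * (2 * B / a) + 1"
    show "\<exists>C>0. \<forall>N x. N \<ge> 1 \<longrightarrow> x ` {1..N} \<subseteq> \<Omega> \<longrightarrow>
           lin_indep_functionals ?V ({1..N} \<times> I) (entry_functional F x) \<longrightarrow>
           (\<forall>M\<in>?V. \<forall>S. is_optimal_recovery ?V ?n ({1..N} \<times> I) (entry_functional F x) M S \<longrightarrow>
              mat_Linf_norm \<Omega> (\<lambda>y. F M y - F S y) \<le>
                ereal (C * fill_distance (x ` {1..N}) \<Omega> powr ?\<theta> * ?n M))"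
    proof (intro exI[of _ C] conjI allI impI ballI)
      show "C > 0" using Cs(1) a(1) by (simp add: C_def B_def add_nonneg_pos)
    next
      fix N :: nat and x M S
      assume N: "N \<ge> 1" and x: "x ` {1..N} \<subseteq> \<Omega>" and M: "M \<in> ?V"
        and opt: "is_optimal_recovery ?V ?n ({1..N} \<times> I) (entry_functional F x) M S"
      let ?X = "x ` {1..N}"
      let ?h = "fill_distance ?X \<Omega>"
      have S: "S \<in> ?V" and SM: "?n S \<le> ?n M"
        using opt M unfolding is_optimal_recovery_def by auto
      have int: "F S (x k) $ i $ j = F M (x k) $ i $ j" if "k \<in> {1..N}" "(i, j) \<in> I" for k i j
      proof -
        have "entry_functional F x (k, i, j) S = entry_functional F x (k, i, j) M"
          using opt that unfolding is_optimal_recovery_def by blast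
        then show ?thesis unfolding entry_functional_eq .
      qed
      have X: "finite ?X" "?X \<noteq> {}" using N by auto
      note h = fill_distance_dense[OF \<Omega> X]
      have agree: "F M z $ i $ j = F S z $ i $ j" if zX: "z \<in> ?X" for z i j
      proof -
        obtain k where k: "k \<in> {1..N}" "z = x k" using zX by blast
        have z: "z \<in> \<Omega>" using zX x by blast
        show ?thesis
        proof (cases "(i, j) \<in> I")
          case True
          then show ?thesis using int k by simp
        next
          case False
          then have sym: "W = {A. transpose A = A}" and ji: "(j, i) \<in> I" using assms(4) by auto
          have "F Q z $ i $ j = F Q z $ j $ i" if "Q \<in> ?V" for Q
          proof -
            have "F Q z \<in> W" using FV[OF that] z unfolding mat_sobolev_def by blast
            then have "transpose (F Q z) $ i $ j = F Q z $ i $ j" unfolding sym by simp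
            then show ?thesis by (simp add: transpose_def)
          qed
          then show ?thesis using int[OF k(1) ji] k(2) M S by simp
        qed
      qed
      have nM: "?n M \<ge> 0" by (rule mat_inner_component_le(2)) (rule ip0[OF M])
      have B0: "B \<ge> 0" by (simp add: B_def)
      have bound: "\<bar>F M y $ i $ j - F S y $ i $ j\<bar> \<le> C * ?h powr ?\<theta> * ?n M" if y: "y \<in> \<Omega>" for y i j
      proof -
        let ?u = "\<lambda>M x. F M x $ i $ j"
        have "\<bar>?u M y - ?u S y\<bar> \<le> Cs * ?h powr ?\<theta> * (sobolev_norm \<tau> \<Omega> (?u M) + sobolev_norm \<tau> \<Omega> (?u S))"
          using Cs(2)[rule_format, OF comp[OF FV[OF M]] comp[OF FV[OF S]] X(1) h(1) _ _ y] h(2) agree by blast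
        also have "... \<le> Cs * ?h powr ?\<theta> * (B * (?n M / a) + B * (?n M / a))"
        proof (intro mult_left_mono add_mono)
          show "sobolev_norm \<tau> \<Omega> (?u M) \<le> B * (?n M / a)"
            using FB[OF M, of i j] mult_left_mono[OF na[OF M] B0] by linarith
          have "?n S / a \<le> ?n M / a" using SM a(1) by (simp add: divide_right_mono)
          then have "?n\<sigma> S \<le> ?n M / a" using na[OF S] by linarith
          then show "sobolev_norm \<tau> \<Omega> (?u S) \<le> B * (?n M / a)"
            using FB[OF S, of i j] mult_left_mono[OF _ B0, of "?n\<sigma> S" "?n M / a"] by linarith
        qed (use Cs in auto)
        also have "... = Cs * (2 * B / a) * (?h powr ?\<theta> * ?n M)" by (simp add: field_simps)
        also have "... \<le> C * (?h powr ?\<theta> * ?n M)"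
          using nM by (intro mult_right_mono mult_nonneg_nonneg) (auto simp: C_def)
        finally show ?thesis by (simp add: mult.assoc)
      qed
      show "mat_Linf_norm \<Omega> (\<lambda>y. F M y - F S y) \<le> ereal (C * ?h powr ?\<theta> * ?n M)"
        unfolding mat_Linf_norm_def
      proof (rule Max.boundedI)
        fix e
        assume "e \<in> range (\<lambda>(i, j). esssup (vol_on \<Omega>) (\<lambda>x. ereal \<bar>(F M x - F S x) $ i $ j\<bar>))"
        then obtain i j where e: "e = esssup (vol_on \<Omega>) (\<lambda>x. ereal \<bar>(F M x - F S x) $ i $ j\<bar>)" by auto
        have [measurable]: "(\<lambda>x. F Q x $ i $ j) \<in> borel_measurable (vol_on \<Omega>)" if "Q \<in> ?V" for Q
          using comp[OF FV[OF that], of i j] unfolding sobolev_def sobolev_classes_def L2_on_def by blast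
        note [measurable] = this[OF M] this[OF S]
        show "e \<le> ereal (C * ?h powr ?\<theta> * ?n M)"
          unfolding e
        proof (rule esssup_I)
          show "(\<lambda>x. ereal \<bar>(F M x - F S x) $ i $ j\<bar>) \<in> borel_measurable (vol_on \<Omega>)"
            unfolding vector_minus_component by measurable
          show "AE x in vol_on \<Omega>. ereal \<bar>(F M x - F S x) $ i $ j\<bar> \<le> ereal (C * ?h powr ?\<theta> * ?n M)"
            using bound by (intro AE_I2) (simp add: space_restrict_space)
        qed
      qed auto
    qed
  qed
qed

end
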